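(* There exists a maximally homogeneous full transformation limit semigroup, and it is unique up to isomorphism; that is, any two maximally homogeneous full transformation limit semigroups are isomorphic.
   Context: An embedding of semigroups is an injective semigroup homomorphism. $\mathcal{T}_n$ is the full transformation semigroup of all maps from $\{1,\dots,n\}$ to itself under composition. A full transformation limit semigroup ($\mathcal{T}_n$-limit semigroup) is a direct limit of a chain of embeddings $\mathcal{T}_{i_1}\to\mathcal{T}_{i_2}\to\mathcal{T}_{i_3}\to\cdots$ with $i_1<i_2<i_3<\cdots$. A semigroup is locally finite if each of its finitely generated subsemigroups is finite, and universal if every finite semigroup embeds in it; every full transformation limit semigroup is countable, locally finite and universal. A finite semigroup $A_0$ is an amalgamation base for the class of finite semigroups if for all finite semigroups $A_1,A_2$ and embeddings $f_1:A_0\to A_1$, $f_2:A_0\to A_2$ there exist a finite semigroup $B$ and embeddings $g_1:A_1\to B$, $g_2:A_2\to B$ with $f_1g_1=f_2g_2$ (maps are composed left to right). $\mathcal{B}$ denotes the class of all such amalgamation bases. For a semigroup $S$ and a finite semigroup $T$, $\mathrm{Aut}(S)$ acts homogeneously on copies of $T$ if for all subsemigroups $T_1,T_2\le S$ with $T_1\cong T\cong T_2$, every isomorphism $T_1\to T_2$ extends to an automorphism of $S$. A universal locally finite semigroup $S$ is maximally homogeneous (or $\mathcal{B}$-homogeneous) if $\mathrm{Aut}(S)$ acts homogeneously on copies of $T$ for every $T\in\mathcal{B}$. *)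

theory Defs
  imports "HOL-Algebra.Bij"
begin

text \<open>
  Semigroups with an explicit carrier are represented by the \<^emph>\<open>monoid\<close> record of HOL-Algebra, so
  that its \<^const>\<open>hom\<close>, \<^const>\<open>mon\<close> (injective homomorphisms, that is, embeddings), \<^const>\<open>iso\<close>,
  \<^const>\<open>is_iso\<close> and \<^const>\<open>auto\<close> can be used. These constants refer only to the carrier and the
  multiplication. The field \<^const>\<open>one\<close> plays no role anywhere below.
\<close>

locale semigrp =
  fixes S (structure)
  assumes nonempty: "carrier S \<noteq> {}"
    and m_closed: "\<lbrakk>x \<in> carrier S; y \<in> carrier S\<rbrakk> \<Longrightarrow> x \<otimes> y \<in> carrier S"
    and m_assoc: "\<lbrakk>x \<in> carrier S; y \<in> carrier S; z \<in> carrier S\<rbrakk>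
      \<Longrightarrow> (x \<otimes> y) \<otimes> z = x \<otimes> (y \<otimes> z)"

definition finite_semigrp :: "('a, 'b) monoid_scheme \<Rightarrow> bool" where
  "finite_semigrp S \<longleftrightarrow> semigrp S \<and> finite (carrier S)"

definition subsemigrp :: "'a set \<Rightarrow> ('a, 'b) monoid_scheme \<Rightarrow> bool" where
  "subsemigrp H S \<longleftrightarrow> H \<noteq> {} \<and> H \<subseteq> carrier S \<and> (\<forall>x\<in>H. \<forall>y\<in>H. x \<otimes>\<^bsub>S\<^esub> y \<in> H)"

inductive_set semigrp_generate :: "('a, 'b) monoid_scheme \<Rightarrow> 'a set \<Rightarrow> 'a set"
  for S and A where
  incl: "a \<in> A \<Longrightarrow> a \<in> semigrp_generate S A"
| mult: "\<lbrakk>x \<in> semigrp_generate S A; y \<in> semigrp_generate S A\<rbrakk>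
    \<Longrightarrow> x \<otimes>\<^bsub>S\<^esub> y \<in> semigrp_generate S A"

definition locally_finite :: "('a, 'b) monoid_scheme \<Rightarrow> bool" where
  "locally_finite S \<longleftrightarrow> (\<forall>A. finite A \<and> A \<subseteq> carrier S \<longrightarrow> finite (semigrp_generate S A))"

text \<open>
  Quantification over all finite semigroups is expressed as quantification over the finite
  semigroups whose elements are natural numbers; every finite semigroup is isomorphic to one of
  these, and the notions below are invariant under isomorphism.
\<close>

definition universal :: "('a, 'b) monoid_scheme \<Rightarrow> bool" where
  "universal S \<longleftrightarrow> (\<forall>T :: nat monoid. finite_semigrp T \<longrightarrow> mon T S \<noteq> {})"

definition amalgamation_base :: "('a, 'b) monoid_scheme \<Rightarrow> bool" where
  "amalgamation_base A0 \<longleftrightarrow> finite_semigrp A0 \<and>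
     (\<forall>(A1 :: nat monoid) (A2 :: nat monoid). finite_semigrp A1 \<and> finite_semigrp A2 \<longrightarrow>
       (\<forall>f1 \<in> mon A0 A1. \<forall>f2 \<in> mon A0 A2.
         \<exists>B :: nat monoid. finite_semigrp B \<and>
           (\<exists>g1 \<in> mon A1 B. \<exists>g2 \<in> mon A2 B. \<forall>x \<in> carrier A0. g1 (f1 x) = g2 (f2 x))))"

definition acts_homogeneously :: "('a, 'b) monoid_scheme \<Rightarrow> ('c, 'd) monoid_scheme \<Rightarrow> bool" where
  "acts_homogeneously S T \<longleftrightarrow>
     (\<forall>T1 T2. subsemigrp T1 S \<and> subsemigrp T2 S \<and>
        S\<lparr>carrier := T1\<rparr> \<cong> T \<and> T \<cong> S\<lparr>carrier := T2\<rparr> \<longrightarrow>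
        (\<forall>h \<in> iso (S\<lparr>carrier := T1\<rparr>) (S\<lparr>carrier := T2\<rparr>).
           \<exists>\<alpha> \<in> auto S. \<forall>x \<in> T1. \<alpha> x = h x))"

definition maximally_homogeneous :: "('a, 'b) monoid_scheme \<Rightarrow> bool" where
  "maximally_homogeneous S \<longleftrightarrow> semigrp S \<and> universal S \<and> locally_finite S \<and>
     (\<forall>T :: nat monoid. amalgamation_base T \<longrightarrow> acts_homogeneously S T)"

text \<open>Maps are composed from left to right: in the product of \<open>f\<close> and \<open>g\<close>, \<open>f\<close> is applied first.\<close>

definition full_transf :: "nat \<Rightarrow> (nat \<Rightarrow> nat) monoid" where
  "full_transf n =
     \<lparr>carrier = {1..n} \<rightarrow>\<^sub>E {1..n},
      mult = (\<lambda>f g. compose {1..n} g f),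
      one = (\<lambda>x\<in>{1..n}. x)\<rparr>"

text \<open>
  The direct limit of a chain of semigroups \<open>G 0 \<rightarrow> G 1 \<rightarrow> G 2 \<rightarrow> \<dots>\<close> with connecting homomorphisms
  \<open>f k : G k \<rightarrow> G (Suc k)\<close>: the disjoint union of the carriers modulo eventual equality, where
  elements are multiplied after they have been moved to a common member of the chain. The map
  \<open>chain_map f k d\<close> is the composite \<open>G k \<rightarrow> G (k + d)\<close>.
\<close>

primrec chain_map :: "(nat \<Rightarrow> 'a \<Rightarrow> 'a) \<Rightarrow> nat \<Rightarrow> nat \<Rightarrow> 'a \<Rightarrow> 'a" where
  "chain_map f k 0 x = x"
| "chain_map f k (Suc d) x = f (k + d) (chain_map f k d x)"

definition limit_rel ::
  "(nat \<Rightarrow> ('a, 'b) monoid_scheme) \<Rightarrow> (nat \<Rightarrow> 'a \<Rightarrow> 'a) \<Rightarrow> ((nat \<times> 'a) \<times> (nat \<times> 'a)) set" where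
  "limit_rel G f = {((k, x), (l, y)). x \<in> carrier (G k) \<and> y \<in> carrier (G l) \<and>
     (\<exists>m. k \<le> m \<and> l \<le> m \<and> chain_map f k (m - k) x = chain_map f l (m - l) y)}"

definition direct_limit ::
  "(nat \<Rightarrow> ('a, 'b) monoid_scheme) \<Rightarrow> (nat \<Rightarrow> 'a \<Rightarrow> 'a) \<Rightarrow> (nat \<times> 'a) set monoid" where
  "direct_limit G f =
     \<lparr>carrier = (SIGMA k : UNIV. carrier (G k)) // limit_rel G f,
      mult = (\<lambda>X Y. \<Union>(k, x)\<in>X. \<Union>(l, y)\<in>Y. let m = max k l in
        limit_rel G f `` {(m, chain_map f k (m - k) x \<otimes>\<^bsub>G m\<^esub> chain_map f l (m - l) y)}),
      one = undefined\<rparr>"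

definition full_transf_limit :: "('a, 'b) monoid_scheme \<Rightarrow> bool" where
  "full_transf_limit S \<longleftrightarrow> semigrp S \<and>
     (\<exists>(i :: nat \<Rightarrow> nat) f. strict_mono i \<and> 1 \<le> i 0 \<and>
        (\<forall>k. f k \<in> mon (full_transf (i k)) (full_transf (i (Suc k)))) \<and>
        S \<cong> direct_limit (\<lambda>k. full_transf (i k)) f)"

end

theory Submission
  imports Defs "HOL-Algebra.Coset" "HOL-Algebra.Elementary_Groups" "HOL-Algebra.FiniteProduct"
    "HOL-Library.Countable_Set"
begin

text \<open>
  Existence and uniqueness both come from one theorem, \<open>full_transf_amalgam\<close>: for \<open>n \<ge> 2\<close> the
  semigroup of all self-maps of \<open>{1..n}\<close> is an amalgamation base for finite semigroups.

  Consider a limit \<open>S\<close> as the union of an increasing sequence of copies \<open>C k\<close> of full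
  transformation semigroups. Say that \<open>S\<close> absorbs if every embedding \<open>g\<close> of some \<open>C k\<close> into a
  finite semigroup \<open>F\<close> can be undone by an embedding of \<open>F\<close> into \<open>S\<close>, that is, \<open>f (g x) = x\<close> on
  \<open>C k\<close>. A maximally homogeneous limit absorbs: universality embeds \<open>F\<close> into \<open>S\<close> somehow, this
  gives a second copy of \<open>C k\<close>, and since \<open>C k\<close> is an amalgamation base, an automorphism moves the
  second copy back to the first. Two absorbing semigroups are isomorphic by a zigzag argument,
  which can start from any embedding of some \<open>C k\<close>; this is uniqueness. Conversely an absorbing
  \<open>S\<close> is homogeneous for every amalgamation base \<open>T\<close>: given an isomorphism \<open>h\<close> between two copies
  of \<open>T\<close> inside \<open>C k\<close>, amalgamate two copies of \<open>C k\<close> along \<open>h\<close> and absorb the amalgam; the result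
  is an embedding of \<open>C k\<close> into \<open>S\<close> that extends \<open>h\<close>, and the zigzag extends it to an
  automorphism. For existence it therefore suffices to build a chain in which every embedding of
  one of its members into a full transformation semigroup is absorbed at a later stage. One such
  embedding is absorbed by amalgamating and embedding the amalgam into a larger full
  transformation semigroup, and there are only countably many to treat.

  For the amalgamation theorem let \<open>A1\<close> and \<open>A2\<close> be finite semigroups that contain \<open>T\<close>, the
  self-maps of \<open>{0..N}\<close>. It suffices to find finite faithful left acts \<open>D1\<close> of \<open>A1\<close> and \<open>D2\<close> of
  \<open>A2\<close> that are isomorphic as \<open>T\<close>-sets: then both semigroups act faithfully on one set and agree
  there on \<open>T\<close>. The acts are finite abelian groups on which the semigroups act by endomorphisms.
  The group structure serves to count and to average; the isomorphism of \<open>T\<close>-sets need not be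
  additive.

  The fixed points of the idempotents \<open>clip k\<close> form an increasing sequence of levels, and an
  element \<open>x\<close> of level \<open>k\<close> has as its faces the elements \<open>g x\<close> with \<open>g\<close> a singular self-map of
  \<open>{0..k}\<close>; the faces are governed by level \<open>k - 1\<close>. Call a module extensible if every compatible
  system of faces occurs and if one element can be chosen for each system, compatibly with
  permutations of \<open>{0..k}\<close>. The remaining elements with the same faces differ from the chosen one
  by an element all of whose faces are trivial, and on these only the permutations act in a
  nontrivial way. By Burnside's theorem a finite set with a group action is determined by its
  marks, the numbers of fixed points of the subgroups. Hence, by induction on the level,
  extensible modules with equal marks are isomorphic as \<open>T\<close>-sets (\<open>equivariant_bijection\<close>). Level
  1 needs one more invariant, since a pair of elements of level 0 need not be the pair of faces of
  an element of level 1.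

  It remains to find faithful extensible modules with equal marks. Modules of functions on finite
  right acts are extensible, because a function can be extended by the neutral element to the
  points where the faces do not determine it. The marks are then adjusted level by level. At level
  \<open>k\<close> let \<open>Q\<close> be the group of units of the corner \<open>e A e\<close> with \<open>e = clip k\<close>. The module is
  multiplied by a second one, trivial below level \<open>k\<close>, so that the product has at level \<open>k\<close> as
  many \<open>H\<close>-fixed points as there are \<open>H\<close>-invariant functions on \<open>Q\<close> with values in a given group
  (\<open>free_level_adjustment\<close>). The number of these depends only on the order of \<open>Q\<close>, the order of
  \<open>H\<close> and the size of the value group, and the value groups can be chosen so that both sides agree
  (\<open>matched_step\<close>). The second module is cut out by the condition that an average over \<open>Q\<close>
  vanishes; averaging is possible since all groups have an exponent prime to the order of \<open>Q\<close>.
\<close>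

section \<open>Transformations of an initial segment\<close>

definition clip :: "nat \<Rightarrow> nat \<Rightarrow> nat" where
  "clip k i = min i k"

text \<open>
  Self-maps of \<open>{0..k}\<close>, extended to all natural numbers through \<open>clip k\<close>. In this form
  \<open>maps j \<subseteq> maps k\<close> for \<open>j \<le> k\<close>, so that self-maps of different initial segments
  compose without any restriction, and \<open>maps j\<close> is the corner of \<open>maps k\<close> at the idempotent
  \<open>clip j\<close>.
\<close>

definition maps :: "nat \<Rightarrow> (nat \<Rightarrow> nat) set" where
  "maps k = {f. clip k \<circ> f = f \<and> f \<circ> clip k = f}"

definition perms :: "nat \<Rightarrow> (nat \<Rightarrow> nat) set" where
  "perms k = {f \<in> maps k. inj_on f {..k}}"

definition sings :: "nat \<Rightarrow> (nat \<Rightarrow> nat) set" where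
  "sings k = maps k - perms k"

definition move :: "nat \<Rightarrow> nat \<Rightarrow> nat \<Rightarrow> nat \<Rightarrow> nat" where
  "move k a b i = (if min i k = a then b else min i k)"

text \<open>
  Products are taken from left to right, so that a left module over the transformation semigroup
  restricts to a left action of this group.
\<close>

definition perm_group :: "nat \<Rightarrow> (nat \<Rightarrow> nat) monoid" where
  "perm_group k = \<lparr>carrier = perms k, mult = (\<lambda>f g. g \<circ> f), one = clip k\<rparr>"

lemma maps_iff: "f \<in> maps k \<longleftrightarrow> (\<forall>i. f i \<le> k) \<and> (\<forall>i. f (min i k) = f i)"
  by (auto simp: maps_def clip_def fun_eq_iff min_def)

lemma maps_le: "f \<in> maps k \<Longrightarrow> f i \<le> k"
  and maps_min: "f \<in> maps k \<Longrightarrow> f (min i k) = f i"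
  by (auto simp: maps_iff)

lemma maps_eqI: "\<lbrakk>f \<in> maps k; g \<in> maps k; \<And>i. i \<le> k \<Longrightarrow> f i = g i\<rbrakk> \<Longrightarrow> f = g"
  by (metis (no_types, opaque_lifting) ext maps_min min.cobounded2)

lemma maps_comp: "\<lbrakk>f \<in> maps k; g \<in> maps k\<rbrakk> \<Longrightarrow> g \<circ> f \<in> maps k"
  by (simp add: maps_iff)

lemma clip_maps: "j \<le> k \<Longrightarrow> clip j \<in> maps k"
  by (auto simp: maps_iff clip_def)

lemma clip_clip: "clip j \<circ> clip k = clip (min j k)"
  by (auto simp: clip_def)

lemma maps_mono: "j \<le> k \<Longrightarrow> maps j \<subseteq> maps k"
proof
  fix f assume jk: "j \<le> k" and f: "f \<in> maps j"
  have "f (min i k) = f i" for i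
    using maps_min[OF f, of "min i k"] maps_min[OF f, of i] jk by (simp add: min.assoc min_absorb2)
  then show "f \<in> maps k" using maps_le[OF f] jk by (auto simp: maps_iff intro: le_trans)
qed

lemma maps_clip [simp]: "f \<in> maps k \<Longrightarrow> f \<circ> clip k = f" "f \<in> maps k \<Longrightarrow> clip k \<circ> f = f"
  by (auto simp: maps_def)

lemma finite_maps: "finite (maps k)"
proof -
  have "inj_on (\<lambda>f. restrict f {..k}) (maps k)"
    by (rule inj_onI, erule maps_eqI, assumption) (metis atMost_iff restrict_apply')
  moreover have "(\<lambda>f. restrict f {..k}) ` maps k \<subseteq> {..k} \<rightarrow>\<^sub>E {..k}"
    by (force simp: maps_le)
  ultimately show ?thesis
    by (meson finite_PiE finite_atMost finite_imageD finite_subset)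
qed

lemma perms_maps: "f \<in> perms k \<Longrightarrow> f \<in> maps k"
  and sings_maps: "f \<in> sings k \<Longrightarrow> f \<in> maps k"
  by (auto simp: perms_def sings_def)

lemma perms_bij: "f \<in> perms k \<Longrightarrow> bij_betw f {..k} {..k}"
  unfolding perms_def bij_betw_def
  by (auto simp: maps_le endo_inj_surj image_subset_iff)

lemma clip_perms: "clip k \<in> perms k"
  by (auto simp: perms_def clip_maps clip_def inj_on_def)

lemma perms_comp: "\<lbrakk>f \<in> perms k; g \<in> perms k\<rbrakk> \<Longrightarrow> g \<circ> f \<in> perms k"
  using perms_bij[of f k] perms_bij[of g k]
  by (auto simp: perms_def maps_comp bij_betw_def intro: comp_inj_on)

lemma perms_inverse:
  assumes "f \<in> perms k"
  obtains g where "g \<in> perms k" "g \<circ> f = clip k" "f \<circ> g = clip k"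
proof
  define g where "g = inv_into {..k} f \<circ> clip k"
  have b: "bij_betw f {..k} {..k}" using perms_bij[OF assms] .
  have le: "inv_into {..k} f i \<le> k" if "i \<le> k" for i
    using that b by (metis atMost_iff bij_betw_imp_surj_on inv_into_into)
  have gm: "g \<in> maps k"
    by (auto simp: maps_iff g_def clip_def le)
  show "f \<circ> g = clip k"
    by (rule ext) (simp add: g_def clip_def f_inv_into_f bij_betw_imp_surj_on[OF b])
  show "g \<circ> f = clip k"
  proof (rule maps_eqI[of _ k])
    fix i assume "i \<le> k"
    then show "(g \<circ> f) i = clip k i"
      using b assms by (simp add: g_def clip_def perms_def maps_le min_absorb1 bij_betw_def)
  qed (use gm assms in \<open>auto simp: perms_def clip_maps intro: maps_comp\<close>)
  show "g \<in> perms k"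
    using gm b by (auto simp: perms_def g_def clip_def inj_on_def bij_betw_def min_absorb1
        dest: inv_into_injective)
qed

lemma sings_iff_clash: "f \<in> sings k \<longleftrightarrow> f \<in> maps k \<and> (\<exists>a\<le>k. \<exists>b\<le>k. a \<noteq> b \<and> f a = f b)"
  by (auto simp: sings_def perms_def inj_on_def)

lemma sings_miss:
  assumes "f \<in> sings k" obtains a where "a \<le> k" "\<And>i. f i \<noteq> a"
proof -
  have m: "f \<in> maps k" and n: "\<not> inj_on f {..k}" using assms by (auto simp: sings_def perms_def)
  have "f ` {..k} \<noteq> {..k}" using n eq_card_imp_inj_on by (metis finite_atMost)
  moreover have "f ` {..k} \<subseteq> {..k}" using m by (auto simp: maps_le)
  ultimately obtain a where a: "a \<le> k" "a \<notin> f ` {..k}" by auto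
  have "f i \<noteq> a" for i using a maps_min[OF m, of i] by (metis atMost_iff imageI min.cobounded2)
  with a that show thesis by blast
qed

lemma sings_if_miss: "\<lbrakk>f \<in> maps k; a \<le> k; \<And>i. f i \<noteq> a\<rbrakk> \<Longrightarrow> f \<in> sings k"
  unfolding sings_def using perms_bij[of f k]
  by (metis Diff_iff atMost_iff bij_betw_imp_surj_on imageE)

lemma sings_compR: "\<lbrakk>f \<in> maps k; g \<in> sings k\<rbrakk> \<Longrightarrow> f \<circ> g \<in> sings k"
  using sings_maps[of g k] by (auto simp: sings_iff_clash intro!: maps_comp) (metis)

lemma sings_compL: "\<lbrakk>f \<in> maps k; g \<in> sings k\<rbrakk> \<Longrightarrow> g \<circ> f \<in> sings k"
  by (metis comp_apply maps_comp sings_if_miss sings_maps sings_miss)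

lemma move_sings: "\<lbrakk>a \<le> k; b \<le> k; a \<noteq> b\<rbrakk> \<Longrightarrow> move k a b \<in> sings k"
  by (rule sings_if_miss[of _ _ a]) (auto simp: maps_iff move_def)

text \<open>
  A singular map misses some point \<open>a\<close>; moving \<open>a\<close> elsewhere afterwards has no effect.
\<close>

lemma sings_absorber:
  assumes "1 \<le> k" "g \<in> sings k" obtains h where "h \<in> sings k" "h \<circ> g = g"
proof -
  obtain a where a: "a \<le> k" "\<And>i. g i \<noteq> a" using sings_miss[OF assms(2)] by blast
  obtain b where b: "b \<le> k" "a \<noteq> b" using assms(1) by (cases "a = 0") auto
  have "g i \<le> k" for i using assms sings_maps maps_le by metis
  then have "move k a b \<circ> g = g" using a by (auto simp: move_def fun_eq_iff min_absorb1)
  then show thesis using move_sings[OF a(1) b] that by blast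
qed

text \<open>
  The maps miss points \<open>a\<close> and \<open>c\<close>. With a third point \<open>b\<close> available, the two maps that move \<open>a\<close>
  to \<open>b\<close> and \<open>c\<close> to \<open>b\<close> commute; the existence of \<open>b\<close> is the reason for \<open>k \<ge> 2\<close>.
\<close>

lemma sings_commuting_left:
  assumes "g \<in> sings k" "g' \<in> sings k" "2 \<le> k"
  obtains h h' where "h \<in> sings k" "h' \<in> sings k" "h \<circ> g = g" "h' \<circ> g' = g'" "h \<circ> h' = h' \<circ> h"
proof -
  obtain a where a: "a \<le> k" "\<And>i. g i \<noteq> a" using sings_miss[OF assms(1)] by blast
  obtain c where c: "c \<le> k" "\<And>i. g' i \<noteq> c" using sings_miss[OF assms(2)] by blast
  \<comment> \<open>Among 0, 1 and 2 there is a third point.\<close>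
  have "\<exists>b\<le>k. b \<noteq> a \<and> b \<noteq> c"
    using assms(3) by (metis le_trans nat_le_linear numeral_2_eq_2 one_le_numeral zero_le
      One_nat_def Suc_n_not_le_n n_not_Suc_n zero_neq_one)
  then obtain b where b: "b \<le> k" "b \<noteq> a" "b \<noteq> c" by blast
  show thesis
  proof
    show "move k a b \<in> sings k" "move k c b \<in> sings k" using a b c by (auto intro: move_sings)
    have "g i \<le> k" "g' i \<le> k" for i using assms sings_maps maps_le by metis+
    then show "move k a b \<circ> g = g" "move k c b \<circ> g' = g'"
      using a c by (auto simp: move_def fun_eq_iff min_absorb1)
    show "move k a b \<circ> move k c b = move k c b \<circ> move k a b"
      using a b c by (auto simp: move_def fun_eq_iff min_absorb1)
  qed
qed

lemma move_absorb: "\<lbrakk>t \<in> maps k; a \<le> k; b \<le> k; t a = t b\<rbrakk> \<Longrightarrow> t \<circ> move k a b = t"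
  by (rule ext) (auto simp: move_def maps_min)

text \<open>
  Each map identifies a pair of points. If the pairs are disjoint, collapsing one commutes with
  collapsing the other; if they meet, both are collapsed to a common point.
\<close>

lemma sings_commuting_right:
  assumes "t \<in> sings k" "t' \<in> sings k"
  obtains h h' where "h \<in> sings k" "h' \<in> sings k" "t \<circ> h = t" "t' \<circ> h' = t'" "h \<circ> h' = h' \<circ> h"
proof -
  obtain a b where ab: "a \<le> k" "b \<le> k" "a \<noteq> b" "t a = t b"
    using assms by (auto simp: sings_iff_clash)
  obtain c d where cd: "c \<le> k" "d \<le> k" "c \<noteq> d" "t' c = t' d"
    using assms by (auto simp: sings_iff_clash)
  have "\<exists>a b c d. a \<le> k \<and> b \<le> k \<and> a \<noteq> b \<and> t a = t b \<and> c \<le> k \<and> d \<le> k \<and> c \<noteq> d \<and> t' c = t' d \<and>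
      (b = d \<or> {a, b} \<inter> {c, d} = {})"
    using ab cd by (cases "{a, b} \<inter> {c, d} = {}") (blast, clarsimp, metis)
  then obtain a b c d where *: "a \<le> k" "b \<le> k" "a \<noteq> b" "t a = t b" "c \<le> k" "d \<le> k" "c \<noteq> d"
      "t' c = t' d" "b = d \<or> {a, b} \<inter> {c, d} = {}" by blast
  show thesis
  proof
    show "move k a b \<in> sings k" "move k c d \<in> sings k" using * by (auto intro: move_sings)
    show "t \<circ> move k a b = t" "t' \<circ> move k c d = t'"
      using * assms by (auto intro!: move_absorb sings_maps)
    show "move k a b \<circ> move k c d = move k c d \<circ> move k a b"
      using * by (auto simp: move_def fun_eq_iff min_absorb1)
  qed
qed

text \<open>
  A map that misses a point factors through \<open>{0..k}\<close>: exchange the missed point with the last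
  point, and exchange back afterwards.
\<close>

lemma sings_factor:
  assumes "g \<in> sings (Suc k)"
  obtains t u where "t \<in> maps (Suc k)" "u \<in> maps (Suc k)" "g = u \<circ> t" "clip k \<circ> t = t" "u \<circ> clip k = u"
proof -
  obtain a where a: "a \<le> Suc k" "\<And>i. g i \<noteq> a" using sings_miss[OF assms] by blast
  \<comment> \<open>The transposition of the missed point and the last point; it is its own inverse.\<close>
  define p where "p i = (if min i (Suc k) = a then Suc k else if Suc k \<le> i then a else i)" for i
  have g: "g \<in> maps (Suc k)" using assms sings_maps by blast
  have p: "p \<in> maps (Suc k)" using a by (auto simp: maps_iff p_def min_def)
  have pp: "p (p i) = min i (Suc k)" for i using a by (auto simp: p_def min_def)
  have pg: "p (g i) \<le> k" for i using a(2)[of i] maps_le[OF g, of i] a(1)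
    by (auto simp: p_def min_def)
  show thesis
  proof
    show "p \<circ> g \<in> maps (Suc k)" using p g maps_comp by blast
    show "p \<circ> clip k \<in> maps (Suc k)" using p clip_maps[of k "Suc k"] maps_comp by simp
    show "g = (p \<circ> clip k) \<circ> (p \<circ> g)"
      using pg maps_le[OF g] by (auto simp: fun_eq_iff clip_def pp min_absorb1)
    show "clip k \<circ> (p \<circ> g) = p \<circ> g" using pg by (auto simp: fun_eq_iff clip_def min_absorb1)
    show "(p \<circ> clip k) \<circ> clip k = p \<circ> clip k" by (auto simp: fun_eq_iff clip_def)
  qed
qed

lemma low_rank_sings: "\<lbrakk>u \<in> maps (Suc k); u \<circ> clip k = u\<rbrakk> \<Longrightarrow> u \<in> sings (Suc k)"
  unfolding sings_iff_clash
  by (rule conjI, assumption, rule exI[of _ k], simp, rule exI[of _ "Suc k"])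
    (simp, metis clip_def comp_apply min.absorb2 le_SucI min.idem order_refl)

lemma group_perm_group: "group (perm_group k)"
proof (rule groupI)
  fix f assume "f \<in> carrier (perm_group k)"
  then show "\<exists>g\<in>carrier (perm_group k). g \<otimes>\<^bsub>perm_group k\<^esub> f = \<one>\<^bsub>perm_group k\<^esub>"
    by (metis perms_inverse perm_group_def monoid.simps(1,2) partial_object.simps(1))
qed (auto simp: perm_group_def perms_comp clip_perms perms_maps o_assoc)

lemma perm_group_simps [simp]:
  "carrier (perm_group k) = perms k" "mult (perm_group k) f g = g \<circ> f" "one (perm_group k) = clip k"
  by (simp_all add: perm_group_def)

lemma finite_perms: "finite (perms k)"
  by (rule finite_subset[OF _ finite_maps[of k]]) (auto simp: perms_maps)

lemma sings_1: "\<lbrakk>u \<in> maps 1; u \<circ> clip 0 = u\<rbrakk> \<Longrightarrow> u = clip 0 \<or> u = (\<lambda>_. 1)"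
proof -
  assume u: "u \<in> maps 1" "u \<circ> clip 0 = u"
  then have "u i = u 0" "u 0 \<le> 1" for i
    by (metis clip_def comp_apply min_0R, metis maps_le)
  then show ?thesis by (cases "u 0") (auto simp: clip_def fun_eq_iff)
qed

lemma const1_maps: "1 \<le> k \<Longrightarrow> (\<lambda>_. 1) \<in> maps k"
  by (auto simp: maps_iff)

section \<open>Finite group actions with equal marks\<close>

definition acts_on :: "('g, 'b) monoid_scheme \<Rightarrow> ('g \<Rightarrow> 'x \<Rightarrow> 'x) \<Rightarrow> 'x set \<Rightarrow> bool" where
  "acts_on G a X \<longleftrightarrow> (\<forall>g\<in>carrier G. \<forall>x\<in>X. a g x \<in> X) \<and> (\<forall>x\<in>X. a \<one>\<^bsub>G\<^esub> x = x) \<and>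
     (\<forall>g\<in>carrier G. \<forall>h\<in>carrier G. \<forall>x\<in>X. a (g \<otimes>\<^bsub>G\<^esub> h) x = a g (a h x))"

definition fixed :: "('g \<Rightarrow> 'x \<Rightarrow> 'x) \<Rightarrow> 'g set \<Rightarrow> 'x set \<Rightarrow> 'x set" where
  "fixed a H X = {x \<in> X. \<forall>g\<in>H. a g x = x}"

definition stab :: "('g, 'b) monoid_scheme \<Rightarrow> ('g \<Rightarrow> 'x \<Rightarrow> 'x) \<Rightarrow> 'x \<Rightarrow> 'g set" where
  "stab G a x = {g \<in> carrier G. a g x = x}"

lemma acts_onD:
  assumes "acts_on G a X"
  shows "\<lbrakk>g \<in> carrier G; x \<in> X\<rbrakk> \<Longrightarrow> a g x \<in> X" "x \<in> X \<Longrightarrow> a \<one>\<^bsub>G\<^esub> x = x"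
    "\<lbrakk>g \<in> carrier G; h \<in> carrier G; x \<in> X\<rbrakk> \<Longrightarrow> a (g \<otimes>\<^bsub>G\<^esub> h) x = a g (a h x)"
  using assms by (auto simp: acts_on_def)

context group
begin

lemma acts_inv:
  assumes "acts_on G a X" "g \<in> carrier G" "x \<in> X"
  shows "a (inv g) (a g x) = x" "a g (a (inv g) x) = x"
  using assms acts_onD[OF assms(1)] by (metis inv_closed l_inv, metis inv_closed r_inv)

lemma stab_subgroup:
  assumes "acts_on G a X" "x \<in> X" shows "subgroup (stab G a x) G"
proof (rule subgroupI)
  show "stab G a x \<noteq> {}" using acts_onD(2)[OF assms] by (auto simp: stab_def)
  show "inv g \<in> stab G a x" if "g \<in> stab G a x" for g
    using that acts_inv[OF assms(1) _ assms(2)] by (fastforce simp: stab_def)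
  show "g \<otimes> h \<in> stab G a x" if "g \<in> stab G a x" "h \<in> stab G a x" for g h
    using that acts_onD(3)[OF assms(1) _ _ assms(2)] by (simp add: stab_def)
qed (auto simp: stab_def)

lemma translates_eq_iff:
  assumes "acts_on G a X" "x \<in> X" "g \<in> carrier G" "h \<in> carrier G"
  shows "a g x = a h x \<longleftrightarrow> inv h \<otimes> g \<in> stab G a x"
  using assms acts_onD[OF assms(1)] acts_inv[OF assms(1)]
  by (simp add: stab_def) (metis inv_closed)

text \<open>
  Burnside's theorem. Take \<open>x\<close> in \<open>X\<close> with a largest stabiliser. The mark at this stabiliser
  gives a \<open>y\<close> in \<open>Y\<close> with at least the same stabiliser, and the mark at the stabiliser of \<open>y\<close>
  leads back to \<open>X\<close>, so by maximality \<open>x\<close> and \<open>y\<close> have equal stabilisers and isomorphic orbits.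
  Removing the two orbits keeps the marks equal.
\<close>

lemma equal_marks_imp_equivariant_bij:
  assumes "finite X" "finite Y" "finite (carrier G)" "acts_on G a X" "acts_on G b Y"
    and "\<And>H. subgroup H G \<Longrightarrow> card (fixed a H X) = card (fixed b H Y)"
  shows "\<exists>\<kappa>. bij_betw \<kappa> X Y \<and> (\<forall>g\<in>carrier G. \<forall>x\<in>X. \<kappa> (a g x) = b g (\<kappa> x))"
  using assms
proof (induction "card X" arbitrary: X Y rule: less_induct)
  case less
  note X = less.prems(1) and Y = less.prems(2) and fG = less.prems(3)
    and aX = less.prems(4) and bY = less.prems(5) and marks = less.prems(6)
  have one: "subgroup {\<one>} G" by (rule triv_subgroup)
  have "fixed a {\<one>} X = X" "fixed b {\<one>} Y = Y"
    using acts_onD(2)[OF aX] acts_onD(2)[OF bY] by (auto simp: fixed_def)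
  then have cXY: "card X = card Y" using marks[OF one] by simp
  show ?case
  proof (cases "X = {}")
    case True
    then have "Y = {}" using cXY Y by simp
    then show ?thesis using True by (auto simp: bij_betw_def)
  next
    case False
    let ?M = "(\<lambda>z. card (stab G a z)) ` X"
    have "Max ?M \<in> ?M" using False X by (intro Max_in) auto
    then obtain x where x: "x \<in> X" and Mx: "Max ?M = card (stab G a x)" by auto
    have mx: "card (stab G a z) \<le> card (stab G a x)" if "z \<in> X" for z
      unfolding Mx[symmetric] using that X by (intro Max_ge) auto
    have sx: "subgroup (stab G a x) G" using stab_subgroup[OF aX x] .
    have "x \<in> fixed a (stab G a x) X" using x by (auto simp: fixed_def stab_def)
    then have "card (fixed a (stab G a x) X) > 0" using X by (auto simp: card_gt_0_iff fixed_def)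
    then have "fixed b (stab G a x) Y \<noteq> {}" using marks[OF sx] by auto
    then obtain y where y: "y \<in> Y" and "\<forall>g\<in>stab G a x. b g y = y" by (auto simp: fixed_def)
    then have sub: "stab G a x \<subseteq> stab G b y" by (auto simp: stab_def)
    have sy: "subgroup (stab G b y) G" using stab_subgroup[OF bY y] .
    have "y \<in> fixed b (stab G b y) Y" using y by (auto simp: fixed_def stab_def)
    then have "card (fixed b (stab G b y) Y) > 0" using Y by (auto simp: card_gt_0_iff fixed_def)
    then have "fixed a (stab G b y) X \<noteq> {}" using marks[OF sy] by auto
    then obtain x' where x': "x' \<in> X" and "\<forall>g\<in>stab G b y. a g x' = x'" by (auto simp: fixed_def)
    then have "stab G b y \<subseteq> stab G a x'" by (auto simp: stab_def)
    then have "card (stab G b y) \<le> card (stab G a x')"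
      using fG by (intro card_mono) (auto simp: stab_def)
    then have "card (stab G b y) \<le> card (stab G a x)" using mx[OF x'] by simp
    then have st: "stab G b y = stab G a x"
      using sub fG card_seteq[of "stab G b y" "stab G a x"] by (simp add: stab_def)
    define O1 where "O1 = (\<lambda>g. a g x) ` carrier G"
    define O2 where "O2 = (\<lambda>g. b g y) ` carrier G"
    have O1X: "O1 \<subseteq> X" and O2Y: "O2 \<subseteq> Y"
      using acts_onD(1)[OF aX _ x] acts_onD(1)[OF bY _ y] by (auto simp: O1_def O2_def)
    have iff: "a g x = a h x \<longleftrightarrow> b g y = b h y" if "g \<in> carrier G" "h \<in> carrier G" for g h
      using that translates_eq_iff[OF aX x] translates_eq_iff[OF bY y] st by simp
    define k0 where "k0 z = b (SOME g. g \<in> carrier G \<and> a g x = z) y" for z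
    have k0: "k0 (a g x) = b g y" if "g \<in> carrier G" for g
    proof -
      define h where "h = (SOME h. h \<in> carrier G \<and> a h x = a g x)"
      have "h \<in> carrier G \<and> a h x = a g x" unfolding h_def by (rule someI[of _ g]) (use that in simp)
      then show ?thesis using iff that unfolding k0_def h_def[symmetric] by blast
    qed
    have bk0: "bij_betw k0 O1 O2"
      unfolding bij_betw_def inj_on_def O1_def O2_def by (auto simp: k0 iff image_iff)
    have k0e: "k0 (a g z) = b g (k0 z)" if "g \<in> carrier G" "z \<in> O1" for g z
    proof -
      from that(2) obtain h where h: "h \<in> carrier G" "z = a h x" by (auto simp: O1_def)
      then have "a g z = a (g \<otimes> h) x" using that x acts_onD(3)[OF aX] by simp
      then show ?thesis using h that y k0 acts_onD(3)[OF bY] by simp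
    qed
    have O1c: "a g z \<in> O1 \<longleftrightarrow> z \<in> O1" if "g \<in> carrier G" "z \<in> X" for g z
    proof
      assume "a g z \<in> O1"
      then obtain h where h: "h \<in> carrier G" "a g z = a h x" by (auto simp: O1_def)
      then have "z = a (inv g \<otimes> h) x"
        using acts_inv[OF aX that(1,2)] acts_onD(3)[OF aX _ h(1) x, of "inv g"] that by simp
      then show "z \<in> O1" using that h by (auto simp: O1_def)
    next
      assume "z \<in> O1"
      then obtain h where h: "h \<in> carrier G" "z = a h x" by (auto simp: O1_def)
      then have "a g z = a (g \<otimes> h) x" using that x acts_onD(3)[OF aX] by simp
      then show "a g z \<in> O1" using that h by (auto simp: O1_def)
    qed
    have O2c: "b g z \<in> O2 \<longleftrightarrow> z \<in> O2" if "g \<in> carrier G" "z \<in> Y" for g z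
    proof
      assume "b g z \<in> O2"
      then obtain h where h: "h \<in> carrier G" "b g z = b h y" by (auto simp: O2_def)
      then have "z = b (inv g \<otimes> h) y"
        using acts_inv[OF bY that(1,2)] acts_onD(3)[OF bY _ h(1) y, of "inv g"] that by simp
      then show "z \<in> O2" using that h by (auto simp: O2_def)
    next
      assume "z \<in> O2"
      then obtain h where h: "h \<in> carrier G" "z = b h y" by (auto simp: O2_def)
      then have "b g z = b (g \<otimes> h) y" using that y acts_onD(3)[OF bY] by simp
      then show "b g z \<in> O2" using that h by (auto simp: O2_def)
    qed
    have IH: "\<exists>\<kappa>. bij_betw \<kappa> (X - O1) (Y - O2) \<and>
        (\<forall>g\<in>carrier G. \<forall>x\<in>X - O1. \<kappa> (a g x) = b g (\<kappa> x))"
    proof (rule less.hyps)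
      have "x \<in> O1" using acts_onD(2)[OF aX x] unfolding O1_def by (metis image_eqI one_closed)
      then show "card (X - O1) < card X" using x X by (intro psubset_card_mono) auto
      show "acts_on G a (X - O1)" "acts_on G b (Y - O2)"
        using aX bY O1c O2c by (auto simp: acts_on_def)
      fix H assume H: "subgroup H G"
      then have HG: "H \<subseteq> carrier G" using subgroup.subset by blast
      have "k0 ` fixed a H O1 = fixed b H O2"
      proof
        show "k0 ` fixed a H O1 \<subseteq> fixed b H O2"
          using bk0 k0e HG by (force simp: fixed_def bij_betw_def)
        show "fixed b H O2 \<subseteq> k0 ` fixed a H O1"
        proof
          fix w assume w: "w \<in> fixed b H O2"
          then obtain z where z: "z \<in> O1" "w = k0 z" using bk0 by (auto simp: fixed_def bij_betw_def)
          have "a g z = z" if "g \<in> H" for g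
          proof -
            have "k0 (a g z) = k0 z" using that w z HG k0e by (auto simp: fixed_def)
            moreover have "a g z \<in> O1" using O1c z that HG O1X by blast
            ultimately show ?thesis using bk0 z by (auto simp: bij_betw_def dest: inj_onD)
          qed
          then show "w \<in> k0 ` fixed a H O1" using z by (auto simp: fixed_def)
        qed
      qed
      moreover have "inj_on k0 (fixed a H O1)"
        using bk0 by (auto simp: bij_betw_def fixed_def intro: inj_on_subset)
      ultimately have "card (fixed a H O1) = card (fixed b H O2)" by (metis card_image)
      moreover have "fixed a H (X - O1) = fixed a H X - fixed a H O1"
        "fixed b H (Y - O2) = fixed b H Y - fixed b H O2"
        "fixed a H O1 \<subseteq> fixed a H X" "fixed b H O2 \<subseteq> fixed b H Y"
        using O1X O2Y by (auto simp: fixed_def)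
      moreover have "finite (fixed a H O1)" "finite (fixed b H O2)"
        using X Y O1X O2Y by (auto simp: fixed_def intro: finite_subset)
      ultimately show "card (fixed a H (X - O1)) = card (fixed b H (Y - O2))"
        using marks[OF H] by (simp add: card_Diff_subset)
    qed (use X Y fG in auto)
    then obtain k1 where k1: "bij_betw k1 (X - O1) (Y - O2)"
        "\<And>g z. \<lbrakk>g \<in> carrier G; z \<in> X - O1\<rbrakk> \<Longrightarrow> k1 (a g z) = b g (k1 z)" by blast
    define k where "k z = (if z \<in> O1 then k0 z else k1 z)" for z
    have "bij_betw k (O1 \<union> (X - O1)) (O2 \<union> (Y - O2))"
    proof (rule bij_betw_combine)
      show "bij_betw k O1 O2" using bk0 by (rule bij_betw_cong[THEN iffD1, rotated]) (simp add: k_def)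
      show "bij_betw k (X - O1) (Y - O2)" using k1(1)
        by (rule bij_betw_cong[THEN iffD1, rotated]) (simp add: k_def)
    qed auto
    moreover have "O1 \<union> (X - O1) = X" "O2 \<union> (Y - O2) = Y" using O1X O2Y by auto
    moreover have "k (a g z) = b g (k z)" if "g \<in> carrier G" "z \<in> X" for g z
      using that O1c[OF that] k0e k1(2) by (simp add: k_def)
    ultimately show ?thesis by auto
  qed
qed

end

section \<open>Modules over a full transformation semigroup\<close>

definition level :: "('d, 'e) monoid_scheme \<Rightarrow> ((nat \<Rightarrow> nat) \<Rightarrow> 'd \<Rightarrow> 'd) \<Rightarrow> nat \<Rightarrow> 'd set" where
  "level D act k = {x \<in> carrier D. act (clip k) x = x}"

text \<open>
  The terminology is that of simplicial sets: the faces of an element of level \<open>k\<close> are its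
  images under singular self-maps of \<open>{0..k}\<close>, and an element is degenerate if it is such an
  image itself.
\<close>

definition same_faces :: "((nat \<Rightarrow> nat) \<Rightarrow> 'd \<Rightarrow> 'd) \<Rightarrow> nat \<Rightarrow> 'd \<Rightarrow> 'd \<Rightarrow> bool" where
  "same_faces act k x y \<longleftrightarrow> (\<forall>g\<in>sings k. act g x = act g y)"

definition degenerate :: "('d, 'e) monoid_scheme \<Rightarrow> ((nat \<Rightarrow> nat) \<Rightarrow> 'd \<Rightarrow> 'd) \<Rightarrow> nat \<Rightarrow> 'd set" where
  "degenerate D act k = {act g x |g x. g \<in> sings k \<and> x \<in> carrier D}"

definition faceless :: "('d, 'e) monoid_scheme \<Rightarrow> ((nat \<Rightarrow> nat) \<Rightarrow> 'd \<Rightarrow> 'd) \<Rightarrow> nat \<Rightarrow> 'd set" where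
  "faceless D act k = {x \<in> level D act k. \<forall>g\<in>sings k. act g x = \<one>\<^bsub>D\<^esub>}"

text \<open>
  A choice of one element for each system of faces that occurs at level \<open>k\<close>. It respects the
  permutations, but not the group operation.
\<close>

definition splitting ::
  "('d, 'e) monoid_scheme \<Rightarrow> ((nat \<Rightarrow> nat) \<Rightarrow> 'd \<Rightarrow> 'd) \<Rightarrow> nat \<Rightarrow> ('d \<Rightarrow> 'd) \<Rightarrow> bool" where
  "splitting D act k \<pi> \<longleftrightarrow>
     (\<forall>x\<in>level D act k. \<pi> x \<in> level D act k \<and> same_faces act k (\<pi> x) x \<and>
        (\<forall>\<sigma>\<in>perms k. \<pi> (act \<sigma> x) = act \<sigma> (\<pi> x)) \<and>
        (\<forall>y\<in>level D act k. same_faces act k x y \<longrightarrow> \<pi> x = \<pi> y))"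

text \<open>
  Every compatible system of faces is the system of faces of some element. Uniqueness is not
  asked for.
\<close>

definition fills_faces :: "('d, 'e) monoid_scheme \<Rightarrow> ((nat \<Rightarrow> nat) \<Rightarrow> 'd \<Rightarrow> 'd) \<Rightarrow> nat \<Rightarrow> bool" where
  "fills_faces D act k \<longleftrightarrow>
     (\<forall>\<xi>. (\<forall>g\<in>sings k. \<xi> g \<in> carrier D) \<and> (\<forall>f\<in>maps k. \<forall>g\<in>sings k. \<xi> (g \<circ> f) = act f (\<xi> g)) \<longrightarrow>
        (\<exists>x\<in>carrier D. \<forall>g\<in>sings k. act g x = \<xi> g))"

text \<open>
  The filling condition starts at 2: at level 1 it would say that any two elements of level 0
  are the two faces of an element, which already fails for nontrivial modules with trivial
  action.
\<close>

definition extensible :: "('d, 'e) monoid_scheme \<Rightarrow> nat \<Rightarrow> ((nat \<Rightarrow> nat) \<Rightarrow> 'd \<Rightarrow> 'd) \<Rightarrow> bool" where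
  "extensible D N act \<longleftrightarrow> (\<forall>k. 1 \<le> k \<and> k \<le> N \<longrightarrow> (\<exists>\<pi>. splitting D act k \<pi>)) \<and>
     (\<forall>k. 2 \<le> k \<and> k \<le> N \<longrightarrow> fills_faces D act k)"

text \<open>
  Two elements of level 0 are the faces of one element of level 1 exactly if their quotient lies
  in this subgroup of level 0.
\<close>

definition diffs :: "('d, 'e) monoid_scheme \<Rightarrow> ((nat \<Rightarrow> nat) \<Rightarrow> 'd \<Rightarrow> 'd) \<Rightarrow> 'd set" where
  "diffs D act = {act (clip 0) x \<otimes>\<^bsub>D\<^esub> inv\<^bsub>D\<^esub> (act (\<lambda>_. 1) x) |x. x \<in> carrier D}"

text \<open>
  The product of \<open>f\<close> and \<open>g\<close> in the transformation semigroup is \<open>g \<circ> f\<close>, so the last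
  condition makes \<open>D\<close> a left module. Nothing is required to act as the identity, not even
  \<open>clip N\<close>.
\<close>

locale transf_module = comm_group D for D :: "('d, 'e) monoid_scheme" (structure) +
  fixes N :: nat and act :: "(nat \<Rightarrow> nat) \<Rightarrow> 'd \<Rightarrow> 'd"
  assumes fin: "finite (carrier D)"
    and act_hom: "f \<in> maps N \<Longrightarrow> act f \<in> hom D D"
    and act_comp: "\<lbrakk>f \<in> maps N; g \<in> maps N; x \<in> carrier D\<rbrakk> \<Longrightarrow> act (g \<circ> f) x = act f (act g x)"
begin

lemma mult_diff: "\<lbrakk>p \<in> carrier D; x \<in> carrier D\<rbrakk> \<Longrightarrow> p \<otimes> (x \<otimes> inv p) = x"
  by (metis inv_closed m_assoc m_closed m_comm r_inv r_one)

lemma diff_mult: "\<lbrakk>p \<in> carrier D; x \<in> carrier D\<rbrakk> \<Longrightarrow> p \<otimes> x \<otimes> inv p = x"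
  by (metis inv_closed m_assoc m_closed m_comm r_inv r_one)

lemma act_closed: "\<lbrakk>f \<in> maps N; x \<in> carrier D\<rbrakk> \<Longrightarrow> act f x \<in> carrier D"
  using act_hom by (auto simp: hom_def)

lemma act_mult:
  "\<lbrakk>f \<in> maps N; x \<in> carrier D; y \<in> carrier D\<rbrakk> \<Longrightarrow> act f (x \<otimes> y) = act f x \<otimes> act f y"
  using act_hom by (auto simp: hom_def)

lemma act_group_hom: "f \<in> maps N \<Longrightarrow> group_hom D D (act f)"
  using act_hom by (unfold_locales) auto

lemma act_one: "f \<in> maps N \<Longrightarrow> act f \<one> = \<one>"
  using group_hom.hom_one[OF act_group_hom] .

lemma act_inv: "\<lbrakk>f \<in> maps N; x \<in> carrier D\<rbrakk> \<Longrightarrow> act f (inv x) = inv (act f x)"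
  using group_hom.hom_inv[OF act_group_hom] .

lemma level_carrier: "x \<in> level D act k \<Longrightarrow> x \<in> carrier D"
  by (simp add: level_def)

lemma finite_level: "finite (level D act k)"
  using fin by (simp add: level_def)

lemma act_level:
  assumes "k \<le> N" "f \<in> maps k" "x \<in> carrier D" shows "act f x \<in> level D act k"
proof -
  have f: "f \<in> maps N" "clip k \<in> maps N" using assms maps_mono clip_maps by blast+
  have "act (clip k) (act f x) = act (f \<circ> clip k) x" using act_comp[of "clip k" f] f assms by simp
  then show ?thesis using assms f act_closed by (simp add: level_def)
qed

lemma level_mult:
  "\<lbrakk>k \<le> N; x \<in> level D act k; y \<in> level D act k\<rbrakk> \<Longrightarrow> x \<otimes> y \<in> level D act k"
  by (simp add: level_def act_mult clip_maps)

lemma level_inv: "\<lbrakk>k \<le> N; x \<in> level D act k\<rbrakk> \<Longrightarrow> inv x \<in> level D act k"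
  by (simp add: level_def act_inv clip_maps)

lemma level_one: "k \<le> N \<Longrightarrow> \<one> \<in> level D act k"
  by (simp add: level_def act_one clip_maps)

lemma act_compk:
  "\<lbrakk>k \<le> N; f \<in> maps k; g \<in> maps k; x \<in> carrier D\<rbrakk> \<Longrightarrow> act (g \<circ> f) x = act f (act g x)"
  using act_comp maps_mono by blast

lemma acts_on_level: "k \<le> N \<Longrightarrow> acts_on (perm_group k) act (level D act k)"
  unfolding acts_on_def
  by (auto simp: level_carrier perms_maps intro: act_level act_compk) (auto simp: level_def)

text \<open>
  A degenerate element is fixed by a singular map. For two degenerate elements these maps can be
  chosen to commute by \<open>sings_commuting_right\<close>, and then \<open>y = h (h' y') = h' (h y') = y'\<close>, as
  \<open>h\<close> and \<open>h'\<close> do not distinguish \<open>y\<close> from \<open>y'\<close>.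
\<close>

lemma degenerate_eqI:
  assumes k: "k \<le> N" and y: "y \<in> degenerate D act k" "y' \<in> degenerate D act k"
    and same: "same_faces act k y y'"
  shows "y = y'"
proof -
  obtain t x t' x' where t: "t \<in> sings k" "y = act t x" "x \<in> carrier D"
    and t': "t' \<in> sings k" "y' = act t' x'" "x' \<in> carrier D"
    using y by (auto simp: degenerate_def)
  obtain h h' where h: "h \<in> sings k" "h' \<in> sings k" "t \<circ> h = t" "t' \<circ> h' = t'" "h \<circ> h' = h' \<circ> h"
    using sings_commuting_right[OF t(1) t'(1)] by blast
  have m: "h \<in> maps k" "h' \<in> maps k" "t \<in> maps k" "t' \<in> maps k" using h t t' sings_maps by blast+
  have c: "y \<in> carrier D" "y' \<in> carrier D"
    using t t' m k act_level level_carrier by blast+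
  have hy: "act h y = y" "act h' y' = y'"
    using act_compk[OF k m(1) m(3) t(3)] act_compk[OF k m(2) m(4) t'(3)] h t t' by auto
  have s: "act h y = act h y'" "act h' y = act h' y'" using same h by (auto simp: same_faces_def)
  have "y = act h (act h' y')" using hy s by simp
  also have "\<dots> = act h' (act h y')"
    using act_compk[OF k m(1) m(2) c(2)] act_compk[OF k m(2) m(1) c(2)] h(5) by simp
  also have "\<dots> = act h' y" using s hy by simp
  also have "\<dots> = y'" using s hy by simp
  finally show ?thesis .
qed

lemma degenerate_level: "k \<le> N \<Longrightarrow> degenerate D act k \<subseteq> level D act k"
  by (auto simp: degenerate_def intro: act_level sings_maps)

lemma same_faces_act:
  assumes k: "k \<le> N" and f: "f \<in> maps k" and xy: "x \<in> carrier D" "y \<in> carrier D" "same_faces act k x y"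
  shows "same_faces act k (act f x) (act f y)"
  unfolding same_faces_def
proof
  fix g assume g: "g \<in> sings k"
  have "act (f \<circ> g) x = act (f \<circ> g) y" using xy sings_compR[OF f g] by (auto simp: same_faces_def)
  then show "act g (act f x) = act g (act f y)"
    using act_compk[OF k sings_maps[OF g] f] xy by simp
qed

lemma degenerate_act:
  assumes k: "k \<le> N" and f: "f \<in> maps k" and y: "y \<in> degenerate D act k"
  shows "act f y \<in> degenerate D act k"
proof -
  obtain t x where t: "t \<in> sings k" "y = act t x" "x \<in> carrier D"
    using y by (auto simp: degenerate_def)
  then have "act f y = act (t \<circ> f) x" using act_compk[OF k f sings_maps[OF t(1)]] by simp
  then show ?thesis using t sings_compL[OF f t(1)] by (auto simp: degenerate_def)
qed

text \<open>
  There is at most one degenerate element for each system of faces, so choosing this one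
  whenever it exists is compatible with permutations.
\<close>

lemma splitting_fixing_degenerate:
  assumes k: "k \<le> N" and \<pi>: "splitting D act k \<pi>"
  shows "\<exists>\<omega>. splitting D act k \<omega> \<and> (\<forall>y\<in>degenerate D act k. \<omega> y = y)"
proof -
  define P where "P x y \<longleftrightarrow> y \<in> degenerate D act k \<and> same_faces act k y x" for x y
  have uniq: "y = y'" if "P x y" "P x y'" for x y y'
    using that degenerate_eqI[OF k, of y y'] by (simp add: P_def same_faces_def)
  define \<omega> where "\<omega> x = (if \<exists>y. P x y then THE y. P x y else \<pi> x)" for x
  have \<omega>P: "\<omega> x = y" if "P x y" for x y
    using that uniq unfolding \<omega>_def by (auto intro!: the_equality)
  have \<omega>N: "\<omega> x = \<pi> x" if "\<not> (\<exists>y. P x y)" for x using that by (simp add: \<omega>_def)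
  have Pa: "P (act f x) (act f y)" if "P x y" "f \<in> maps k" "x \<in> carrier D" for f x y
    using that degenerate_act[OF k] same_faces_act[OF k] degenerate_level[OF k] level_carrier
    unfolding P_def by (metis subsetD)
  have Ps: "P x = P y" if "same_faces act k x y" for x y
    using that by (auto simp: P_def same_faces_def fun_eq_iff)
  have "splitting D act k \<omega>"
    unfolding splitting_def
  proof (intro ballI conjI impI)
    fix x assume x: "x \<in> level D act k"
    have xc: "x \<in> carrier D" using x level_carrier by blast
    show "\<omega> x \<in> level D act k"
      using \<pi> x degenerate_level[OF k] \<omega>P \<omega>N unfolding splitting_def P_def by (metis subsetD)
    show "same_faces act k (\<omega> x) x"
      using \<pi> x \<omega>P \<omega>N unfolding splitting_def P_def by metis
    show "\<omega> (act \<sigma> x) = act \<sigma> (\<omega> x)" if \<sigma>: "\<sigma> \<in> perms k" for \<sigma>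
    proof (cases "\<exists>y. P x y")
      case True
      then obtain y where "P x y" by blast
      then show ?thesis using \<omega>P Pa \<sigma> perms_maps xc by metis
    next
      case False
      have "\<not> (\<exists>y. P (act \<sigma> x) y)"
      proof
        assume "\<exists>y. P (act \<sigma> x) y"
        then obtain y where y: "P (act \<sigma> x) y" by blast
        obtain \<tau> where \<tau>: "\<tau> \<in> perms k" "\<tau> \<circ> \<sigma> = clip k" "\<sigma> \<circ> \<tau> = clip k"
          using perms_inverse[OF \<sigma>] by blast
        have m: "\<sigma> \<in> maps k" "\<tau> \<in> maps k" using \<sigma> \<tau> perms_maps by blast+
        have "act \<tau> (act \<sigma> x) = x"
          using act_compk[OF k m(2) m(1) xc] \<tau> x by (simp add: level_def)
        moreover have "act \<sigma> x \<in> carrier D" using act_level[OF k m(1) xc] level_carrier by blast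
        ultimately show False using Pa[OF y m(2)] False by auto
      qed
      then show ?thesis using False \<omega>N \<pi> x \<sigma> unfolding splitting_def by simp
    qed
    show "\<omega> x = \<omega> y" if "y \<in> level D act k" "same_faces act k x y" for y
    proof -
      have "\<pi> x = \<pi> y" using \<pi> x that unfolding splitting_def by blast
      then show ?thesis unfolding \<omega>_def Ps[OF that(2)] by (cases "Ex (P y)") auto
    qed
  qed
  moreover have "\<omega> y = y" if "y \<in> degenerate D act k" for y
    using \<omega>P that by (auto simp: P_def same_faces_def)
  ultimately show ?thesis by blast
qed

lemma faceless_iff: "\<lbrakk>k \<le> N; x \<in> level D act k\<rbrakk> \<Longrightarrow>
    x \<in> faceless D act k \<longleftrightarrow> same_faces act k x \<one>"
  using maps_mono[of k N] by (auto simp: faceless_def same_faces_def act_one sings_maps subset_iff)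

lemma same_faces_diff:
  assumes k: "k \<le> N" and "x \<in> level D act k" "y \<in> level D act k"
  shows "same_faces act k x y \<longleftrightarrow> x \<otimes> inv y \<in> faceless D act k"
proof -
  have "act g x = act g y \<longleftrightarrow> act g (x \<otimes> inv y) = \<one>" if "g \<in> sings k" for g
  proof -
    have g: "g \<in> maps N" using that k sings_maps maps_mono by blast
    have c: "x \<in> carrier D" "y \<in> carrier D" "act g x \<in> carrier D" "act g y \<in> carrier D"
      using assms level_carrier act_closed[OF g] by blast+
    then have "act g (x \<otimes> inv y) = act g x \<otimes> inv (act g y)" using g by (simp add: act_mult act_inv)
    then show ?thesis using c by (metis inv_equality inv_inv r_inv inv_closed)
  qed
  then show ?thesis using assms level_mult level_inv by (auto simp: same_faces_def faceless_def)
qed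

text \<open>
  Dividing \<open>x\<close> by the chosen element with the same faces leaves an element with trivial faces,
  so level \<open>k\<close> is as a permutation set the product of the chosen elements and the faceless ones.
\<close>

lemma card_fixed_splitting:
  assumes k: "k \<le> N" and \<pi>: "splitting D act k \<pi>" and H: "H \<subseteq> perms k"
  shows "card (fixed act H (level D act k)) =
    card (fixed act H (\<pi> ` level D act k)) * card (fixed act H (faceless D act k))"
proof -
  let ?L = "level D act k"
  have \<pi>L: "\<pi> x \<in> ?L" and \<pi>f: "same_faces act k (\<pi> x) x" if "x \<in> ?L" for x
    using \<pi> that by (auto simp: splitting_def)
  have \<pi>p: "\<pi> (act \<sigma> x) = act \<sigma> (\<pi> x)" if "x \<in> ?L" "\<sigma> \<in> perms k" for x \<sigma>
    using \<pi> that by (auto simp: splitting_def)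
  have \<pi>e: "\<pi> x = \<pi> y" if "x \<in> ?L" "y \<in> ?L" "same_faces act k x y" for x y
    using \<pi> that by (auto simp: splitting_def)
  have Hm: "\<sigma> \<in> maps N" if "\<sigma> \<in> H" for \<sigma> using that H k perms_maps maps_mono by blast
  have "bij_betw (\<lambda>x. (\<pi> x, x \<otimes> inv (\<pi> x))) (fixed act H ?L)
      (fixed act H (\<pi> ` ?L) \<times> fixed act H (faceless D act k))"
  proof (rule bij_betw_byWitness[where f' = "\<lambda>(p, z). p \<otimes> z"])
    show "\<forall>x\<in>fixed act H ?L. (case (\<pi> x, x \<otimes> inv (\<pi> x)) of (p, z) \<Rightarrow> p \<otimes> z) = x"
      by (auto simp: fixed_def intro!: mult_diff level_carrier[of _ k] \<pi>L)
    have pz: "p \<otimes> z \<in> ?L" "\<pi> (p \<otimes> z) = p" if p: "p \<in> \<pi> ` ?L" and z: "z \<in> faceless D act k" for p z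
    proof -
      obtain x where x: "x \<in> ?L" "p = \<pi> x" using p by blast
      have pL: "p \<in> ?L" "z \<in> ?L" using x \<pi>L z by (auto simp: faceless_def)
      then show "p \<otimes> z \<in> ?L" using level_mult k by blast
      have "p \<otimes> z \<otimes> inv p = z" using pL level_carrier diff_mult by blast
      then have "same_faces act k (p \<otimes> z) p" using same_faces_diff[OF k] pL z level_mult[OF k] by simp
      then have "same_faces act k (p \<otimes> z) x" using \<pi>f[OF x(1)] x(2) by (simp add: same_faces_def)
      then show "\<pi> (p \<otimes> z) = p" using \<pi>e x \<open>p \<otimes> z \<in> ?L\<close> by simp
    qed
    show "\<forall>a'\<in>fixed act H (\<pi> ` ?L) \<times> fixed act H (faceless D act k).
        (\<pi> (case a' of (p, z) \<Rightarrow> p \<otimes> z), (case a' of (p, z) \<Rightarrow> p \<otimes> z) \<otimes> inv (\<pi> (case a' of (p, z) \<Rightarrow> p \<otimes> z))) = a'"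
    proof (clarsimp simp: fixed_def)
      fix x z assume x: "x \<in> ?L" and z: "z \<in> faceless D act k"
      have c: "\<pi> x \<in> carrier D" "z \<in> carrier D"
        using x z \<pi>L level_carrier by (auto simp: faceless_def)
      have "\<pi> (\<pi> x \<otimes> z) = \<pi> x" using pz(2)[of "\<pi> x" z] x z by blast
      moreover have "\<pi> x \<otimes> z \<otimes> inv (\<pi> x) = z"
        using c diff_mult by blast
      ultimately show "\<pi> (\<pi> x \<otimes> z) = \<pi> x \<and> \<pi> x \<otimes> z \<otimes> inv (\<pi> (\<pi> x \<otimes> z)) = z" by simp
    qed
    show "(\<lambda>x. (\<pi> x, x \<otimes> inv (\<pi> x))) ` fixed act H ?L
        \<subseteq> fixed act H (\<pi> ` ?L) \<times> fixed act H (faceless D act k)"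
    proof (clarsimp simp: fixed_def)
      fix x assume x: "x \<in> ?L" and fx: "\<forall>g\<in>H. act g x = x"
      have "act g (\<pi> x) = \<pi> x" if "g \<in> H" for g using \<pi>p[OF x] that H fx by (metis subsetD)
      moreover have "x \<otimes> inv (\<pi> x) \<in> faceless D act k"
        using same_faces_diff[OF k x \<pi>L[OF x]] \<pi>f[OF x] by (simp add: same_faces_def)
      moreover have "act g (x \<otimes> inv (\<pi> x)) = x \<otimes> inv (\<pi> x)" if "g \<in> H" for g
        using that calculation(1) fx x \<pi>L[OF x] Hm level_carrier by (simp add: act_mult act_inv)
      ultimately show "(\<forall>g\<in>H. act g (\<pi> x) = \<pi> x) \<and> x \<otimes> inv (\<pi> x) \<in> faceless D act k \<and>
          (\<forall>g\<in>H. act g (x \<otimes> inv (\<pi> x)) = x \<otimes> inv (\<pi> x))" by blast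
    qed
    show "(\<lambda>(p, z). p \<otimes> z) ` (fixed act H (\<pi> ` ?L) \<times> fixed act H (faceless D act k)) \<subseteq> fixed act H ?L"
    proof (clarsimp simp: fixed_def)
      fix x z assume x: "x \<in> ?L" and z: "z \<in> faceless D act k"
        and f: "\<forall>g\<in>H. act g (\<pi> x) = \<pi> x" "\<forall>g\<in>H. act g z = z"
      have c: "\<pi> x \<in> carrier D" "z \<in> carrier D"
        using x z \<pi>L level_carrier by (auto simp: faceless_def)
      show "\<pi> x \<otimes> z \<in> ?L \<and> (\<forall>g\<in>H. act g (\<pi> x \<otimes> z) = \<pi> x \<otimes> z)"
        using pz(1)[of "\<pi> x" z] x z f c Hm by (simp add: act_mult)
    qed
  qed
  then show ?thesis by (simp add: bij_betw_same_card card_cartesian_product)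
qed

end

text \<open>
  The relation \<open>M\<close> stands for the matching of faces. It induces a map between systems of faces,
  hence between the chosen elements. Used in both directions, this shows that the chosen
  elements of the two modules have equal marks.
\<close>

lemma card_le_fixed_splitting_images:
  assumes "transf_module D1 N a1" "transf_module D2 N a2" and k: "k \<le> N" and H: "H \<subseteq> perms k"
    and \<pi>1: "splitting D1 a1 k \<pi>1" and \<pi>2: "splitting D2 a2 k \<pi>2"
    and lev: "\<And>x x'. M x x' \<Longrightarrow> x \<in> level D1 a1 k \<and> x' \<in> level D2 a2 k"
    and tot: "\<And>x. x \<in> level D1 a1 k \<Longrightarrow> \<exists>x'. M x x'"
    and same: "\<And>x x' z z'. \<lbrakk>M x x'; M z z'\<rbrakk> \<Longrightarrow> same_faces a1 k x z \<longleftrightarrow> same_faces a2 k x' z'"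
    and equi: "\<And>f x x'. \<lbrakk>M x x'; f \<in> maps k\<rbrakk> \<Longrightarrow> M (a1 f x) (a2 f x')"
  shows "card (fixed a1 H (\<pi>1 ` level D1 a1 k)) \<le> card (fixed a2 H (\<pi>2 ` level D2 a2 k))"
proof -
  interpret D1: transf_module D1 N a1 by fact
  interpret D2: transf_module D2 N a2 by fact
  let ?L1 = "level D1 a1 k" and ?L2 = "level D2 a2 k"
  define m where "m x = (SOME x'. M x x')" for x
  have m: "M x (m x)" if "x \<in> ?L1" for x using tot[OF that] unfolding m_def by (rule someI_ex)
  have mL: "m x \<in> ?L2" if "x \<in> ?L1" for x using lev m[OF that] by blast
  have p1: "\<pi>1 x \<in> ?L1" "same_faces a1 k (\<pi>1 x) x" if "x \<in> ?L1" for x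
    using \<pi>1 that by (auto simp: splitting_def)
  have p1e: "\<pi>1 x = \<pi>1 y" if "x \<in> ?L1" "y \<in> ?L1" "same_faces a1 k x y" for x y
    using \<pi>1 that by (auto simp: splitting_def)
  have p2: "\<pi>2 x \<in> ?L2" "same_faces a2 k (\<pi>2 x) x" if "x \<in> ?L2" for x
    using \<pi>2 that by (auto simp: splitting_def)
  have p2e: "\<pi>2 x = \<pi>2 y" if "x \<in> ?L2" "y \<in> ?L2" "same_faces a2 k x y" for x y
    using \<pi>2 that by (auto simp: splitting_def)
  have p2p: "\<pi>2 (a2 \<sigma> x) = a2 \<sigma> (\<pi>2 x)" if "x \<in> ?L2" "\<sigma> \<in> perms k" for x \<sigma>
    using \<pi>2 that by (auto simp: splitting_def)
  have idem: "\<pi>1 x = x" if "x \<in> \<pi>1 ` ?L1" for x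
    using that p1 p1e by (metis imageE)
  show ?thesis
  proof (rule card_inj_on_le[where f = "\<lambda>x. \<pi>2 (m x)"])
    show "inj_on (\<lambda>x. \<pi>2 (m x)) (fixed a1 H (\<pi>1 ` ?L1))"
    proof (rule inj_onI)
      fix x z assume x: "x \<in> fixed a1 H (\<pi>1 ` ?L1)" and z: "z \<in> fixed a1 H (\<pi>1 ` ?L1)"
        and eq: "\<pi>2 (m x) = \<pi>2 (m z)"
      have im: "x \<in> \<pi>1 ` ?L1" "z \<in> \<pi>1 ` ?L1" using x z by (auto simp: fixed_def)
      have I: "\<pi>1 x = x" "\<pi>1 z = z" using idem[OF im(1)] idem[OF im(2)] .
      have L: "x \<in> ?L1" "z \<in> ?L1" using im p1(1) by blast+
      have "same_faces a2 k (m x) (m z)"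
        using p2(2)[OF mL[OF L(1)]] p2(2)[OF mL[OF L(2)]] eq by (simp add: same_faces_def)
      then have "same_faces a1 k x z" using same[OF m[OF L(1)] m[OF L(2)]] by simp
      then show "x = z" using p1e[OF L] I by simp
    qed
    show "(\<lambda>x. \<pi>2 (m x)) ` fixed a1 H (\<pi>1 ` ?L1) \<subseteq> fixed a2 H (\<pi>2 ` ?L2)"
    proof (clarsimp simp: fixed_def mL p1)
      fix x \<sigma> assume x: "x \<in> ?L1" and f: "\<forall>g\<in>H. a1 g (\<pi>1 x) = \<pi>1 x" and \<sigma>: "\<sigma> \<in> H"
      let ?y = "\<pi>1 x"
      have y: "?y \<in> ?L1" using p1 x by blast
      have s: "\<sigma> \<in> perms k" using \<sigma> H by blast
      have "M ?y (a2 \<sigma> (m ?y))" using equi[OF m[OF y] perms_maps[OF s]] f \<sigma> by simp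
      then have "same_faces a2 k (a2 \<sigma> (m ?y)) (m ?y)" "a2 \<sigma> (m ?y) \<in> ?L2"
        using same[OF _ m[OF y]] lev by (auto simp: same_faces_def)
      then have "\<pi>2 (a2 \<sigma> (m ?y)) = \<pi>2 (m ?y)" using p2e mL[OF y] by blast
      then show "a2 \<sigma> (\<pi>2 (m ?y)) = \<pi>2 (m ?y)" using p2p[OF mL[OF y] s] by simp
    qed
    have "fixed a2 H (\<pi>2 ` ?L2) \<subseteq> ?L2" using p2 by (auto simp: fixed_def)
    then show "finite (fixed a2 H (\<pi>2 ` ?L2))" using D2.finite_level finite_subset by blast
  qed
qed

text \<open>
  The chosen elements have equal marks on both sides, so the marks of the levels can be divided
  by them: the faceless elements have equal marks, and Burnside's theorem gives an equivariant
  bijection \<open>\<kappa>\<close> between these. An element \<open>p z\<close> with \<open>p\<close> chosen and \<open>z\<close> faceless is sent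
  to \<open>p' (\<kappa> z)\<close> where \<open>p'\<close> is chosen with matching faces. For singular maps equivariance
  holds since chosen elements include the degenerate ones and since \<open>\<kappa>\<close> fixes the neutral
  element.
\<close>

lemma equivariant_bij_from_face_relation:
  assumes "transf_module D1 N a1" "transf_module D2 N a2" and k: "k \<le> N" and k1: "1 \<le> k"
    and spl: "\<exists>\<pi>. splitting D1 a1 k \<pi>" "\<exists>\<pi>. splitting D2 a2 k \<pi>"
    and lev: "\<And>x x'. M x x' \<Longrightarrow> x \<in> level D1 a1 k \<and> x' \<in> level D2 a2 k"
    and tot: "\<And>x. x \<in> level D1 a1 k \<Longrightarrow> \<exists>x'. M x x'" "\<And>x'. x' \<in> level D2 a2 k \<Longrightarrow> \<exists>x. M x x'"
    and same: "\<And>x x' z z'. \<lbrakk>M x x'; M z z'\<rbrakk> \<Longrightarrow> same_faces a1 k x z \<longleftrightarrow> same_faces a2 k x' z'"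
    and equi: "\<And>f x x'. \<lbrakk>M x x'; f \<in> maps k\<rbrakk> \<Longrightarrow> M (a1 f x) (a2 f x')"
    and marks: "\<And>H. subgroup H (perm_group k) \<Longrightarrow>
      card (fixed a1 H (level D1 a1 k)) = card (fixed a2 H (level D2 a2 k))"
  shows "\<exists>\<Psi>. bij_betw \<Psi> (level D1 a1 k) (level D2 a2 k) \<and>
    (\<forall>f\<in>maps k. \<forall>x\<in>level D1 a1 k. \<Psi> (a1 f x) = a2 f (\<Psi> x))"
proof -
  interpret D1: transf_module D1 N a1 by fact
  interpret D2: transf_module D2 N a2 by fact
  let ?L1 = "level D1 a1 k" and ?L2 = "level D2 a2 k"
  let ?F1 = "faceless D1 a1 k" and ?F2 = "faceless D2 a2 k"
  obtain p1 where s1: "splitting D1 a1 k p1" and d1: "\<forall>y\<in>degenerate D1 a1 k. p1 y = y"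
    using spl(1) D1.splitting_fixing_degenerate[OF k] by blast
  obtain p2 where s2: "splitting D2 a2 k p2" and d2: "\<forall>y\<in>degenerate D2 a2 k. p2 y = y"
    using spl(2) D2.splitting_fixing_degenerate[OF k] by blast
  have p1: "p1 x \<in> ?L1" "same_faces a1 k (p1 x) x" if "x \<in> ?L1" for x
    using s1 that by (auto simp: splitting_def)
  have p1e: "p1 x = p1 y" if "x \<in> ?L1" "y \<in> ?L1" "same_faces a1 k x y" for x y
    using s1 that by (auto simp: splitting_def)
  have p1p: "p1 (a1 \<sigma> x) = a1 \<sigma> (p1 x)" if "x \<in> ?L1" "\<sigma> \<in> perms k" for x \<sigma>
    using s1 that by (auto simp: splitting_def)
  have p2: "p2 x \<in> ?L2" "same_faces a2 k (p2 x) x" if "x \<in> ?L2" for x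
    using s2 that by (auto simp: splitting_def)
  have p2e: "p2 x = p2 y" if "x \<in> ?L2" "y \<in> ?L2" "same_faces a2 k x y" for x y
    using s2 that by (auto simp: splitting_def)
  have p2p: "p2 (a2 \<sigma> x) = a2 \<sigma> (p2 x)" if "x \<in> ?L2" "\<sigma> \<in> perms k" for x \<sigma>
    using s2 that by (auto simp: splitting_def)
  have F1: "\<one>\<^bsub>D1\<^esub> \<in> ?F1" and F2: "\<one>\<^bsub>D2\<^esub> \<in> ?F2"
    using D1.faceless_iff[OF k D1.level_one[OF k]] D2.faceless_iff[OF k D2.level_one[OF k]]
    by (auto simp: same_faces_def)
  have FL: "?F1 \<subseteq> ?L1" "?F2 \<subseteq> ?L2" by (auto simp: faceless_def)
  have fF: "finite ?F1" "finite ?F2"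
    using FL D1.finite_level D2.finite_level finite_subset by blast+
  have mk: "\<sigma> \<in> maps N" if "\<sigma> \<in> perms k" for \<sigma> using that perms_maps maps_mono[OF k] by blast
  have cF: "card (fixed a1 H ?F1) = card (fixed a2 H ?F2)" if H: "subgroup H (perm_group k)" for H
  proof -
    have Hp: "H \<subseteq> perms k" using subgroup.subset[OF H] by simp
    have "card (fixed a1 H (p1 ` ?L1)) \<le> card (fixed a2 H (p2 ` ?L2))"
      by (rule card_le_fixed_splitting_images[where M = M, OF assms(1,2) k Hp s1 s2 lev tot(1) same equi])
    moreover have "card (fixed a2 H (p2 ` ?L2)) \<le> card (fixed a1 H (p1 ` ?L1))"
      by (rule card_le_fixed_splitting_images[where M = "\<lambda>x x'. M x' x",
            OF assms(2,1) k Hp s2 s1 _ tot(2)]) (use lev same equi in blast)+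
    \<comment> \<open>The neutral element is degenerate, hence chosen. So the marks of the chosen elements are
      positive and can be cancelled.\<close>
    moreover have "\<one>\<^bsub>D1\<^esub> \<in> fixed a1 H (p1 ` ?L1)"
    proof -
      have g: "move k 0 1 \<in> sings k" using k1 by (intro move_sings) auto
      then have "a1 (move k 0 1) \<one>\<^bsub>D1\<^esub> = \<one>\<^bsub>D1\<^esub>"
        using D1.act_one sings_maps maps_mono[OF k] by blast
      then have "\<one>\<^bsub>D1\<^esub> \<in> degenerate D1 a1 k" using g D1.one_closed unfolding degenerate_def by force
      then have "p1 \<one>\<^bsub>D1\<^esub> = \<one>\<^bsub>D1\<^esub>" using d1 by simp
      moreover have "a1 \<sigma> \<one>\<^bsub>D1\<^esub> = \<one>\<^bsub>D1\<^esub>" if "\<sigma> \<in> H" for \<sigma>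
        using that Hp mk D1.act_one by blast
      ultimately show ?thesis using D1.level_one[OF k] unfolding fixed_def by force
    qed
    moreover have "finite (fixed a1 H (p1 ` ?L1))"
      using p1 D1.finite_level by (auto simp: fixed_def intro: finite_subset)
    ultimately show ?thesis
      using marks[OF H] D1.card_fixed_splitting[OF k s1 Hp] D2.card_fixed_splitting[OF k s2 Hp]
      by (metis card_gt_0_iff empty_iff le_antisym mult_left_cancel neq0_conv)
  qed
  \<comment> \<open>Burnside's theorem is applied to the faceless elements without the neutral one, so that
    \<open>\<kappa>\<close> can be made to preserve the neutral element.\<close>
  have aF: "acts_on (perm_group k) a (faceless D a k - {\<one>\<^bsub>D\<^esub>})" if "transf_module D N a" for D :: "('z, 'w) monoid_scheme" and a
  proof -
    interpret D: transf_module D N a by fact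
    have 1: "a \<sigma> x \<in> faceless D a k" if x: "x \<in> faceless D a k" and \<sigma>: "\<sigma> \<in> perms k" for \<sigma> x
    proof -
      have "x \<in> level D a k" "x \<in> carrier D" using x D.level_carrier by (auto simp: faceless_def)
      moreover from this have "a \<sigma> x \<in> level D a k" using D.act_level[OF k perms_maps[OF \<sigma>]] by blast
      ultimately show ?thesis
        using x D.faceless_iff[OF k] D.same_faces_act[OF k perms_maps[OF \<sigma>], of x "\<one>\<^bsub>D\<^esub>"]
          D.act_one[OF mk[OF \<sigma>]] by simp
    qed
    have 2: "a \<sigma> x \<noteq> \<one>\<^bsub>D\<^esub>" if x: "x \<in> faceless D a k" "x \<noteq> \<one>\<^bsub>D\<^esub>" and \<sigma>: "\<sigma> \<in> perms k" for \<sigma> x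
    proof
      assume z: "a \<sigma> x = \<one>\<^bsub>D\<^esub>"
      have xL: "x \<in> level D a k" using x by (auto simp: faceless_def)
      have "a (inv\<^bsub>perm_group k\<^esub> \<sigma>) (a \<sigma> x) = x"
        using group.acts_inv(1)[OF group_perm_group D.acts_on_level[OF k] _ xL] \<sigma> by simp
      moreover have "inv\<^bsub>perm_group k\<^esub> \<sigma> \<in> perms k"
        using group.inv_closed[OF group_perm_group, of \<sigma> k] \<sigma> by simp
      ultimately show False using z x(2) D.act_one[OF mk] by metis
    qed
    have "faceless D a k \<subseteq> level D a k" by (auto simp: faceless_def)
    then show ?thesis using 1 2 D.acts_on_level[OF k] unfolding acts_on_def by (simp add: subset_iff)
  qed
  have "\<exists>\<kappa>. bij_betw \<kappa> (?F1 - {\<one>\<^bsub>D1\<^esub>}) (?F2 - {\<one>\<^bsub>D2\<^esub>}) \<and>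
      (\<forall>g\<in>carrier (perm_group k). \<forall>x\<in>?F1 - {\<one>\<^bsub>D1\<^esub>}. \<kappa> (a1 g x) = a2 g (\<kappa> x))"
  proof (rule group.equal_marks_imp_equivariant_bij[OF group_perm_group])
    fix H assume H: "subgroup H (perm_group k)"
    then have Hp: "H \<subseteq> perms k" using subgroup.subset by force
    have o: "\<one>\<^bsub>D1\<^esub> \<in> fixed a1 H ?F1" "\<one>\<^bsub>D2\<^esub> \<in> fixed a2 H ?F2"
      using F1 F2 Hp mk D1.act_one D2.act_one by (auto simp: fixed_def)
    have "fixed a1 H (?F1 - {\<one>\<^bsub>D1\<^esub>}) = fixed a1 H ?F1 - {\<one>\<^bsub>D1\<^esub>}"
      "fixed a2 H (?F2 - {\<one>\<^bsub>D2\<^esub>}) = fixed a2 H ?F2 - {\<one>\<^bsub>D2\<^esub>}" by (auto simp: fixed_def)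
    then show "card (fixed a1 H (?F1 - {\<one>\<^bsub>D1\<^esub>})) = card (fixed a2 H (?F2 - {\<one>\<^bsub>D2\<^esub>}))"
      using cF[OF H] o by simp
  qed (use fF finite_perms aF[OF assms(1)] aF[OF assms(2)] in auto)
  then obtain \<kappa>' where k': "bij_betw \<kappa>' (?F1 - {\<one>\<^bsub>D1\<^esub>}) (?F2 - {\<one>\<^bsub>D2\<^esub>})"
    "\<And>\<sigma> x. \<lbrakk>\<sigma> \<in> perms k; x \<in> ?F1 - {\<one>\<^bsub>D1\<^esub>}\<rbrakk> \<Longrightarrow> \<kappa>' (a1 \<sigma> x) = a2 \<sigma> (\<kappa>' x)" by auto
  define \<kappa> where "\<kappa> x = (if x = \<one>\<^bsub>D1\<^esub> then \<one>\<^bsub>D2\<^esub> else \<kappa>' x)" for x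
  have \<kappa>1: "\<kappa> \<one>\<^bsub>D1\<^esub> = \<one>\<^bsub>D2\<^esub>" by (simp add: \<kappa>_def)
  have \<kappa>inj: "inj_on \<kappa> ?F1" and \<kappa>F: "\<kappa> x \<in> ?F2" if "x \<in> ?F1" for x
  proof -
    have K: "\<kappa>' y \<in> ?F2 - {\<one>\<^bsub>D2\<^esub>}" if "y \<in> ?F1 - {\<one>\<^bsub>D1\<^esub>}" for y
      using k'(1) that bij_betwE by blast
    then show "\<kappa> x \<in> ?F2" using that F2 by (auto simp: \<kappa>_def)
    show "inj_on \<kappa> ?F1"
      using k'(1) K unfolding \<kappa>_def bij_betw_def inj_on_def by (metis Diff_iff singletonI singletonD)
  qed
  have \<kappa>e: "\<kappa> (a1 \<sigma> x) = a2 \<sigma> (\<kappa> x)" if "\<sigma> \<in> perms k" "x \<in> ?F1" for \<sigma> x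
  proof (cases "x = \<one>\<^bsub>D1\<^esub>")
    case True
    then show ?thesis using \<kappa>1 that mk D1.act_one D2.act_one by simp
  next
    case False
    then have "a1 \<sigma> x \<in> ?F1 - {\<one>\<^bsub>D1\<^esub>}"
      using acts_onD(1)[OF aF[OF assms(1)], of \<sigma> x] that by simp
    then show ?thesis using k'(2)[OF that(1), of x] that False by (simp add: \<kappa>_def)
  qed
  define m where "m x = (SOME x'. M x x')" for x
  have m: "M x (m x)" if "x \<in> ?L1" for x using tot(1)[OF that] unfolding m_def by (rule someI_ex)
  have mL: "m x \<in> ?L2" if "x \<in> ?L1" for x using lev m[OF that] by blast
  have md: "p2 (m x) = p2 x'" if "M x x'" for x x'
    using that m lev same[OF that m[of x]] p2e by (metis same_faces_def)
  have xF: "x \<otimes>\<^bsub>D1\<^esub> inv\<^bsub>D1\<^esub> (p1 x) \<in> ?F1" if "x \<in> ?L1" for x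
    using D1.same_faces_diff[OF k that p1(1)[OF that]] p1(2)[OF that] by (simp add: same_faces_def)
  define \<Psi> where "\<Psi> x = p2 (m x) \<otimes>\<^bsub>D2\<^esub> \<kappa> (x \<otimes>\<^bsub>D1\<^esub> inv\<^bsub>D1\<^esub> (p1 x))" for x
  have \<Psi>L: "\<Psi> x \<in> ?L2" and \<Psi>s: "same_faces a2 k (\<Psi> x) (m x)" if "x \<in> ?L1" for x
  proof -
    let ?z = "\<kappa> (x \<otimes>\<^bsub>D1\<^esub> inv\<^bsub>D1\<^esub> (p1 x))"
    have z: "?z \<in> ?F2" using \<kappa>F[OF xF[OF that]] .
    then have zL: "?z \<in> ?L2" and pL: "p2 (m x) \<in> ?L2" using FL p2 mL[OF that] by blast+
    show L: "\<Psi> x \<in> ?L2" unfolding \<Psi>_def using D2.level_mult[OF k pL zL] .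
    have "\<Psi> x \<otimes>\<^bsub>D2\<^esub> inv\<^bsub>D2\<^esub> (p2 (m x)) = ?z"
      unfolding \<Psi>_def using D2.diff_mult D2.level_carrier zL pL by blast
    then have "same_faces a2 k (\<Psi> x) (p2 (m x))" using D2.same_faces_diff[OF k L pL] z by simp
    then show "same_faces a2 k (\<Psi> x) (m x)" using p2(2)[OF mL[OF that]] by (simp add: same_faces_def)
  qed
  have "inj_on \<Psi> ?L1"
  proof (rule inj_onI)
    fix x y assume x: "x \<in> ?L1" and y: "y \<in> ?L1" and eq: "\<Psi> x = \<Psi> y"
    have s2: "same_faces a2 k (m x) (m y)" using \<Psi>s[OF x] \<Psi>s[OF y] eq by (simp add: same_faces_def)
    then have "p2 (m x) = p2 (m y)" using p2e mL x y by blast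
    moreover have "p1 x = p1 y" using p1e[OF x y] same[OF m[OF x] m[OF y]] s2 by simp
    moreover have c: "p2 (m x) \<in> carrier D2" "\<kappa> (x \<otimes>\<^bsub>D1\<^esub> inv\<^bsub>D1\<^esub> (p1 x)) \<in> carrier D2" "\<kappa> (y \<otimes>\<^bsub>D1\<^esub> inv\<^bsub>D1\<^esub> (p1 y)) \<in> carrier D2"
      using p2 mL x y \<kappa>F xF FL D2.level_carrier by (meson subsetD)+
    ultimately have "\<kappa> (x \<otimes>\<^bsub>D1\<^esub> inv\<^bsub>D1\<^esub> (p1 x)) = \<kappa> (y \<otimes>\<^bsub>D1\<^esub> inv\<^bsub>D1\<^esub> (p1 x))"
      using eq D2.Units_l_cancel unfolding \<Psi>_def by simp
    then have "x \<otimes>\<^bsub>D1\<^esub> inv\<^bsub>D1\<^esub> (p1 x) = y \<otimes>\<^bsub>D1\<^esub> inv\<^bsub>D1\<^esub> (p1 x)"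
      using \<kappa>inj[OF F1] xF[OF x] xF[OF y] \<open>p1 x = p1 y\<close> by (auto dest: inj_onD)
    then show "x = y" using x y p1(1)[OF y] D1.level_carrier D1.right_cancel[of "inv\<^bsub>D1\<^esub> (p1 y)" x y] \<open>p1 x = p1 y\<close> by simp
  qed
  moreover have "card ?L1 = card ?L2"
  proof -
    have "fixed a1 {clip k} ?L1 = ?L1" "fixed a2 {clip k} ?L2 = ?L2" by (auto simp: fixed_def level_def)
    then show ?thesis using marks[of "{clip k}"] group.triv_subgroup[OF group_perm_group, of k] by simp
  qed
  ultimately have bij: "bij_betw \<Psi> ?L1 ?L2"
    using \<Psi>L D2.finite_level card_image[of \<Psi> ?L1] card_subset_eq[of ?L2 "\<Psi> ` ?L1"]
    by (auto simp: bij_betw_def)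
  have "\<Psi> (a1 f x) = a2 f (\<Psi> x)" if f: "f \<in> maps k" and x: "x \<in> ?L1" for f x
  proof (cases "f \<in> perms k")
    case True
    have fN: "f \<in> maps N" using mk[OF True] .
    have c: "x \<in> carrier D1" "p1 x \<in> carrier D1" using x p1 D1.level_carrier by blast+
    have c2: "p2 (m x) \<in> carrier D2" "\<kappa> (x \<otimes>\<^bsub>D1\<^esub> inv\<^bsub>D1\<^esub> (p1 x)) \<in> carrier D2"
      using p2 mL x \<kappa>F xF FL D2.level_carrier by (meson subsetD)+
    have "p2 (m (a1 f x)) = a2 f (p2 (m x))"
      using md[OF equi[OF m[OF x] f]] p2p[OF mL[OF x] True] by simp
    moreover have "\<kappa> (a1 f x \<otimes>\<^bsub>D1\<^esub> inv\<^bsub>D1\<^esub> (p1 (a1 f x))) = a2 f (\<kappa> (x \<otimes>\<^bsub>D1\<^esub> inv\<^bsub>D1\<^esub> (p1 x)))"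
      using \<kappa>e[OF True xF[OF x]] p1p[OF x True] c fN by (simp add: D1.act_mult D1.act_inv)
    ultimately show ?thesis unfolding \<Psi>_def using c2 fN by (simp add: D2.act_mult)
  next
    case False
    then have fs: "f \<in> sings k" using f by (simp add: sings_def)
    have c: "x \<in> carrier D1" using x D1.level_carrier by blast
    have dg: "a1 f x \<in> degenerate D1 a1 k" using fs c by (auto simp: degenerate_def)
    have dg2: "a2 f (m x) \<in> degenerate D2 a2 k"
      using fs mL[OF x] D2.level_carrier by (auto simp: degenerate_def)
    have cl: "a1 f x \<in> carrier D1" "a2 f (m x) \<in> carrier D2"
      using dg dg2 D1.degenerate_level[OF k] D2.degenerate_level[OF k] D1.level_carrier D2.level_carrier
      by blast+
    have "p2 (m (a1 f x)) = a2 f (m x)" using md[OF equi[OF m[OF x] f]] d2 dg2 by simp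
    then have "\<Psi> (a1 f x) = a2 f (m x)" unfolding \<Psi>_def using d1 dg \<kappa>1 cl by simp
    then show ?thesis using \<Psi>s[OF x] fs by (simp add: same_faces_def)
  qed
  then show ?thesis using bij by blast
qed

text \<open>
  The maps \<open>u\<close> with \<open>u \<circ> clip k = u\<close> send elements to level \<open>k\<close>, where \<open>\<psi>\<close> is
  defined. By \<open>sings_factor\<close> they determine all faces.
\<close>

definition face_rel where
  "face_rel D1 a1 D2 a2 k \<psi> x x' \<longleftrightarrow> x \<in> level D1 a1 (Suc k) \<and> x' \<in> level D2 a2 (Suc k) \<and>
     (\<forall>u\<in>maps (Suc k). u \<circ> clip k = u \<longrightarrow> a2 u x' = \<psi> (a1 u x))"

lemma (in transf_module) same_faces_iff:
  assumes K: "Suc k \<le> N" and xy: "x \<in> carrier D" "y \<in> carrier D"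
  shows "same_faces act (Suc k) x y \<longleftrightarrow> (\<forall>u\<in>maps (Suc k). u \<circ> clip k = u \<longrightarrow> act u x = act u y)"
proof
  assume "same_faces act (Suc k) x y"
  then show "\<forall>u\<in>maps (Suc k). u \<circ> clip k = u \<longrightarrow> act u x = act u y"
    using low_rank_sings by (auto simp: same_faces_def)
next
  assume *: "\<forall>u\<in>maps (Suc k). u \<circ> clip k = u \<longrightarrow> act u x = act u y"
  show "same_faces act (Suc k) x y"
    unfolding same_faces_def
  proof
    fix g assume "g \<in> sings (Suc k)"
    then obtain t u where tu: "t \<in> maps (Suc k)" "u \<in> maps (Suc k)" "g = u \<circ> t" "u \<circ> clip k = u"
      using sings_factor by metis
    then show "act g x = act g y"
      using act_compk[OF K tu(1,2)] xy * by simp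
  qed
qed

lemma (in transf_module) face_level:
  assumes K: "Suc k \<le> N" and "u \<in> maps (Suc k)" "u \<circ> clip k = u" "x \<in> carrier D"
  shows "act u x \<in> level D act k"
proof -
  have "act (clip k) (act u x) = act u x"
    using act_compk[OF K, of "clip k" u x] clip_maps[of k "Suc k"] assms by simp
  then show ?thesis using act_level[OF K assms(2,4)] by (simp add: level_def)
qed

text \<open>
  The inductive situation: \<open>\<psi>\<close> identifies the two levels \<open>k\<close>, and the next levels are to be
  compared.
\<close>

locale face_step = D1: transf_module D1 N a1 + D2: transf_module D2 N a2
  for D1 :: "('d1, 'e1) monoid_scheme" and N a1 and D2 :: "('d2, 'e2) monoid_scheme" and a2 +
  fixes k :: nat and \<psi> :: "'d1 \<Rightarrow> 'd2"
  assumes K: "Suc k \<le> N"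
    and bij: "bij_betw \<psi> (level D1 a1 k) (level D2 a2 k)"
    and equi: "\<lbrakk>f \<in> maps k; x \<in> level D1 a1 k\<rbrakk> \<Longrightarrow> \<psi> (a1 f x) = a2 f (\<psi> x)"
begin

abbreviation M where "M \<equiv> face_rel D1 a1 D2 a2 k \<psi>"

lemma face_rel_same:
  assumes "M x x'" "M z z'"
  shows "same_faces a1 (Suc k) x z \<longleftrightarrow> same_faces a2 (Suc k) x' z'"
proof -
  have c: "x \<in> carrier D1" "z \<in> carrier D1" "x' \<in> carrier D2" "z' \<in> carrier D2"
    using assms by (auto simp: face_rel_def level_def)
  have "a1 u x = a1 u z \<longleftrightarrow> a2 u x' = a2 u z'" if u: "u \<in> maps (Suc k)" "u \<circ> clip k = u" for u
  proof -
    have "a2 u x' = \<psi> (a1 u x)" "a2 u z' = \<psi> (a1 u z)" using assms u by (auto simp: face_rel_def)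
    moreover have "a1 u x \<in> level D1 a1 k" "a1 u z \<in> level D1 a1 k"
      using D1.face_level[OF K u] c by blast+
    ultimately show ?thesis using bij by (auto simp: bij_betw_def dest: inj_onD)
  qed
  then show ?thesis using D1.same_faces_iff[OF K c(1,2)] D2.same_faces_iff[OF K c(3,4)] by auto
qed

lemma face_rel_equi:
  assumes "M x x'" "f \<in> maps (Suc k)" shows "M (a1 f x) (a2 f x')"
proof -
  have c: "x \<in> carrier D1" "x' \<in> carrier D2" using assms by (auto simp: face_rel_def level_def)
  have "a2 u (a2 f x') = \<psi> (a1 u (a1 f x))" if u: "u \<in> maps (Suc k)" "u \<circ> clip k = u" for u
  proof -
    have "f \<circ> u \<in> maps (Suc k)" "(f \<circ> u) \<circ> clip k = f \<circ> u"
      using maps_comp[OF u(1) assms(2)] u(2) by (auto simp: comp_assoc)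
    then have "a2 (f \<circ> u) x' = \<psi> (a1 (f \<circ> u) x)" using assms(1) by (auto simp: face_rel_def)
    then show ?thesis using D1.act_compk[OF K u(1) assms(2) c(1)] D2.act_compk[OF K u(1) assms(2) c(2)]
      by simp
  qed
  then show ?thesis using D1.act_level[OF K assms(2) c(1)] D2.act_level[OF K assms(2) c(2)]
    by (simp add: face_rel_def)
qed

lemma psi_level: "x \<in> level D1 a1 k \<Longrightarrow> \<psi> x \<in> level D2 a2 k"
  using bij bij_betwE by blast

text \<open>
  Factor \<open>g\<close> through \<open>clip k\<close>: a face of \<open>x\<close> is the image of an element of level \<open>k\<close>, and
  \<open>\<psi>\<close> translates that element.
\<close>

lemma degenerate_related:
  assumes g: "g \<in> sings (Suc k)" and x: "x \<in> carrier D1"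
  shows "\<exists>!y'. y' \<in> degenerate D2 a2 (Suc k) \<and> M (a1 g x) y'"
proof -
  obtain t u where tu: "t \<in> maps (Suc k)" "u \<in> maps (Suc k)" "g = u \<circ> t"
      "clip k \<circ> t = t" "u \<circ> clip k = u" using sings_factor[OF g] by metis
  have w: "a1 u x \<in> level D1 a1 k" "a1 u x \<in> carrier D1"
    using D1.face_level[OF K tu(2,5) x] by (auto simp: level_def)
  have pw: "\<psi> (a1 u x) \<in> carrier D2" using psi_level[OF w(1)] by (simp add: level_def)
  have "t i \<noteq> Suc k" for i using tu(4) by (metis Suc_n_not_le_n clip_def comp_apply min.cobounded2)
  then have ts: "t \<in> sings (Suc k)" using sings_if_miss[OF tu(1), of "Suc k"] by simp
  define y' where "y' = a2 t (\<psi> (a1 u x))"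
  have gx: "a1 g x = a1 t (a1 u x)" using D1.act_compk[OF K tu(1,2) x] tu(3) by simp
  have "a2 v y' = \<psi> (a1 v (a1 g x))" if v: "v \<in> maps (Suc k)" "v \<circ> clip k = v" for v
  proof -
    have tv: "t \<circ> v \<in> maps k" using tu(4) v(2) unfolding maps_def by (auto simp: comp_assoc o_assoc)
    have "a2 v y' = a2 (t \<circ> v) (\<psi> (a1 u x))"
      unfolding y'_def using D2.act_compk[OF K v(1) tu(1) pw] by simp
    also have "\<dots> = \<psi> (a1 (t \<circ> v) (a1 u x))" using equi[OF tv w(1)] by simp
    also have "\<dots> = \<psi> (a1 v (a1 g x))" using D1.act_compk[OF K v(1) tu(1) w(2)] gx by simp
    finally show ?thesis .
  qed
  then have "M (a1 g x) y'"
    using D1.act_level[OF K tu(1) w(2)] D2.act_level[OF K tu(1) pw] by (simp add: face_rel_def gx y'_def)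
  moreover have "y' \<in> degenerate D2 a2 (Suc k)" using ts pw by (auto simp: y'_def degenerate_def)
  moreover have "y'' = z''" if "y'' \<in> degenerate D2 a2 (Suc k)" "z'' \<in> degenerate D2 a2 (Suc k)"
      "M (a1 g x) y''" "M (a1 g x) z''" for y'' z''
    using D2.degenerate_eqI[OF K that(1,2)] face_rel_same[OF that(3,4)] by (simp add: same_faces_def)
  ultimately show ?thesis by blast
qed

text \<open>
  Translating the faces of \<open>x\<close> one by one with \<open>degenerate_related\<close> gives a compatible system of
  degenerate elements in the other module; compatibility follows from uniqueness.
\<close>

lemma face_rel_total:
  assumes fills: "fills_faces D2 a2 (Suc k)" and x: "x \<in> level D1 a1 (Suc k)"
  shows "\<exists>x'. M x x'"
proof -
  have xc: "x \<in> carrier D1" using x by (simp add: level_def)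
  define \<xi> where "\<xi> g = (THE y'. y' \<in> degenerate D2 a2 (Suc k) \<and> M (a1 g x) y')" for g
  have \<xi>: "\<xi> g \<in> degenerate D2 a2 (Suc k)" "M (a1 g x) (\<xi> g)" if "g \<in> sings (Suc k)" for g
    using theI'[OF degenerate_related[OF that xc]] by (auto simp: \<xi>_def)
  have \<xi>c: "\<xi> g \<in> carrier D2" if "g \<in> sings (Suc k)" for g
    using \<xi>(1)[OF that] D2.degenerate_level[OF K] D2.level_carrier by blast
  have "\<xi> (g \<circ> f) = a2 f (\<xi> g)" if f: "f \<in> maps (Suc k)" and g: "g \<in> sings (Suc k)" for f g
  proof -
    have "a1 f (a1 g x) = a1 (g \<circ> f) x" using D1.act_compk[OF K f sings_maps[OF g] xc] by simp
    then have "M (a1 (g \<circ> f) x) (a2 f (\<xi> g))" using face_rel_equi[OF \<xi>(2)[OF g] f] by simp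
    moreover have "a2 f (\<xi> g) \<in> degenerate D2 a2 (Suc k)"
      using D2.degenerate_act[OF K f \<xi>(1)[OF g]] .
    ultimately show ?thesis
      unfolding \<xi>_def[of "g \<circ> f"]
      by (intro the1_equality degenerate_related[OF sings_compL[OF f g] xc] conjI)
  qed
  then obtain y where y: "y \<in> carrier D2" "\<And>g. g \<in> sings (Suc k) \<Longrightarrow> a2 g y = \<xi> g"
    using fills[unfolded fills_faces_def, rule_format, of \<xi>] \<xi>c by auto
  let ?y = "a2 (clip (Suc k)) y"
  have yL: "?y \<in> level D2 a2 (Suc k)" using D2.act_level[OF K clip_maps y(1)] by simp
  have "a2 u ?y = \<psi> (a1 u x)" if u: "u \<in> maps (Suc k)" "u \<circ> clip k = u" for u
  proof -
    have us: "u \<in> sings (Suc k)" using low_rank_sings[OF u] .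
    have ck: "clip k \<in> maps (Suc k)" "clip k \<circ> clip k = clip k"
      using clip_maps[of k "Suc k"] clip_clip[of k k] by auto
    have "a2 u ?y = a2 u y"
      using D2.act_compk[OF K u(1) clip_maps[OF order_refl] y(1)] u(1) by simp
    also have "\<dots> = a2 (clip k) (a2 u y)"
      using D2.act_compk[OF K ck(1) u(1) y(1)] u(2) by simp
    also have "\<dots> = a2 (clip k) (\<xi> u)" using y(2)[OF us] by simp
    also have "\<dots> = \<psi> (a1 (clip k) (a1 u x))" using \<xi>(2)[OF us] ck by (simp add: face_rel_def)
    also have "\<dots> = \<psi> (a1 u x)" using D1.act_compk[OF K ck(1) u(1) xc] u(2) by simp
    finally show ?thesis .
  qed
  then show ?thesis using x yL by (auto simp: face_rel_def)
qed

end

lemma face_step_swap: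
  assumes "face_step D1 N a1 D2 a2 k \<psi>"
  shows "face_step D2 N a2 D1 a1 k (inv_into (level D1 a1 k) \<psi>)"
    "face_rel D2 a2 D1 a1 k (inv_into (level D1 a1 k) \<psi>) x' x \<longleftrightarrow> face_rel D1 a1 D2 a2 k \<psi> x x'"
proof -
  interpret face_step D1 N a1 D2 a2 k \<psi> by fact
  let ?i = "inv_into (level D1 a1 k) \<psi>"
  have kN: "k \<le> N" using K by simp
  have i: "?i (\<psi> x) = x" if "x \<in> level D1 a1 k" for x
    using bij that by (auto simp: bij_betw_def)
  have i': "\<psi> (?i y) = y" "?i y \<in> level D1 a1 k" if "y \<in> level D2 a2 k" for y
    using bij that by (auto simp: bij_betw_def f_inv_into_f inv_into_into)
  show "face_step D2 N a2 D1 a1 k ?i"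
  proof
    show "bij_betw ?i (level D2 a2 k) (level D1 a1 k)" using bij bij_betw_inv_into by blast
    show "?i (a2 f y) = a1 f (?i y)" if "f \<in> maps k" "y \<in> level D2 a2 k" for f y
      using equi[OF that(1) i'(2)[OF that(2)]] i'[OF that(2)] i
        D1.act_level[OF kN that(1) D1.level_carrier[OF i'(2)[OF that(2)]]] by metis
  qed (rule K)
  have "a1 u x = ?i (a2 u x') \<longleftrightarrow> a2 u x' = \<psi> (a1 u x)"
    if "u \<in> maps (Suc k)" "u \<circ> clip k = u" "x \<in> carrier D1" "x' \<in> carrier D2" for u
    using D1.face_level[OF K that(1-3)] D2.face_level[OF K that(1,2,4)] i i' by metis
  then show "face_rel D2 a2 D1 a1 k ?i x' x \<longleftrightarrow> face_rel D1 a1 D2 a2 k \<psi> x x'"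
    by (auto simp: face_rel_def level_def)
qed

text \<open>
  The bijection between the zeroth levels has to respect one equivalence relation only, whose
  classes all have the same size.
\<close>

lemma class_preserving_bij:
  assumes fA: "finite A" and fB: "finite B" and "equiv A r" "equiv B s"
    and cr: "\<And>C. C \<in> A // r \<Longrightarrow> card C = d" and cs: "\<And>C. C \<in> B // s \<Longrightarrow> card C = d"
    and AB: "card A = card B"
  shows "\<exists>\<psi>. bij_betw \<psi> A B \<and> (\<forall>x\<in>A. \<forall>y\<in>A. (x, y) \<in> r \<longleftrightarrow> (\<psi> x, \<psi> y) \<in> s)"
proof (cases "A = {}")
  case True
  then have "B = {}" using AB fB by simp
  then show ?thesis using True by (auto simp: bij_betw_def)
next
  case False
  have "finite (A // r)" "finite (B // s)" using fA fB by (auto simp: quotient_def)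
  moreover have "d * card (A // r) = card (\<Union>(A // r))"
  proof (rule card_partition)
    show "c1 \<inter> c2 = {}" if "c1 \<in> A // r" "c2 \<in> A // r" "c1 \<noteq> c2" for c1 c2
      using quotient_disj[OF assms(3) that(1,2)] that(3) by blast
  qed (use calculation(1) fA cr Union_quotient[OF assms(3)] in auto)
  moreover have "d * card (B // s) = card (\<Union>(B // s))"
  proof (rule card_partition)
    show "c1 \<inter> c2 = {}" if "c1 \<in> B // s" "c2 \<in> B // s" "c1 \<noteq> c2" for c1 c2
      using quotient_disj[OF assms(4) that(1,2)] that(3) by blast
  qed (use calculation(2) fB cs Union_quotient[OF assms(4)] in auto)
  moreover have "0 < d"
  proof -
    obtain x where "x \<in> A" using False by blast
    then have "r `` {x} \<in> A // r" "x \<in> r `` {x}"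
      using quotientI[of x A r] equiv_class_self[OF assms(3)] by auto
    moreover have "r `` {x} \<subseteq> A" using assms(3) by (auto simp: equiv_def refl_on_def)
    ultimately show ?thesis using cr fA by (metis card_gt_0_iff empty_iff finite_subset)
  qed
  ultimately have "d * card (A // r) = d * card (B // s)" "0 < d"
    using AB assms(3,4) by (simp_all add: Union_quotient)
  then have "card (A // r) = card (B // s)" by simp
  then obtain q where q: "bij_betw q (A // r) (B // s)"
    using \<open>finite (A // r)\<close> \<open>finite (B // s)\<close> finite_same_card_bij by blast
  have "\<exists>g. bij_betw g C (q C)" if "C \<in> A // r" for C
  proof (rule finite_same_card_bij)
    have qC: "q C \<in> B // s" using q that bij_betwE by blast
    show "finite C" "finite (q C)" using that qC fA fB Union_quotient[OF assms(3)] Union_quotient[OF assms(4)]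
      by (metis Sup_upper finite_subset)+
    show "card C = card (q C)" using cr cs that qC by simp
  qed
  then obtain g where g: "\<And>C. C \<in> A // r \<Longrightarrow> bij_betw (g C) C (q C)" by metis
  define \<psi> where "\<psi> x = g (r `` {x}) x" for x
  have cl: "r `` {x} \<in> A // r" "x \<in> r `` {x}" if "x \<in> A" for x
    using quotientI[OF that, of r] equiv_class_self[OF assms(3) that] by auto
  have \<psi>q: "\<psi> x \<in> q (r `` {x})" if "x \<in> A" for x
    using g[OF cl(1)[OF that]] cl(2)[OF that] by (auto simp: \<psi>_def bij_betw_def)
  have qB: "q (r `` {x}) \<in> B // s" if "x \<in> A" for x using q cl(1)[OF that] bij_betwE by blast
  have rel: "(x, y) \<in> r \<longleftrightarrow> (\<psi> x, \<psi> y) \<in> s" if x: "x \<in> A" and y: "y \<in> A" for x y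
  proof
    assume "(x, y) \<in> r"
    then have "r `` {x} = r `` {y}" using assms(3) by (rule equiv_class_eq[rotated])
    then show "(\<psi> x, \<psi> y) \<in> s"
      using quotient_eq_iff[OF assms(4) qB[OF x] qB[OF y] \<psi>q[OF x] \<psi>q[OF y]] by simp
  next
    assume "(\<psi> x, \<psi> y) \<in> s"
    then have "q (r `` {x}) = q (r `` {y})"
      using quotient_eqI[OF assms(4) qB[OF x] qB[OF y] \<psi>q[OF x] \<psi>q[OF y]] by blast
    then have "r `` {x} = r `` {y}" using q cl x y by (auto simp: bij_betw_def dest: inj_onD)
    then show "(x, y) \<in> r" using eq_equiv_class[OF _ assms(3) y] by blast
  qed
  have "inj_on \<psi> A"
  proof (rule inj_onI)
    fix x y assume x: "x \<in> A" and y: "y \<in> A" and eq: "\<psi> x = \<psi> y"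
    have "\<psi> x \<in> B" using \<psi>q[OF x] qB[OF x] Union_quotient[OF assms(4)] by blast
    then have "(\<psi> x, \<psi> y) \<in> s" using eq assms(4) by (auto simp: equiv_def refl_on_def)
    then have "(x, y) \<in> r" using rel x y by blast
    then have c: "r `` {x} = r `` {y}" using assms(3) by (rule equiv_class_eq[rotated])
    then have "g (r `` {x}) x = g (r `` {x}) y" using eq by (simp add: \<psi>_def)
    then show "x = y" using g[OF cl(1)[OF x]] cl(2)[OF x] cl(2)[OF y] c
      by (auto simp: bij_betw_def dest: inj_onD)
  qed
  moreover have "\<psi> ` A \<subseteq> B" using \<psi>q qB Union_quotient[OF assms(4)] by blast
  ultimately have "bij_betw \<psi> A B"
    using card_subset_eq[OF fB, of "\<psi> ` A"] card_image[of \<psi> A] AB by (simp add: bij_betw_def)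
  then show ?thesis using rel by blast
qed

lemma (in comm_group) equal_quotients_exchange:
  assumes c: "v \<in> carrier G" "w \<in> carrier G" "a \<in> carrier G" "b \<in> carrier G"
    and eq: "v \<otimes> inv w = a \<otimes> inv b"
  shows "b \<otimes> (v \<otimes> inv a) = w"
proof -
  have "v = v \<otimes> inv w \<otimes> w" using c by (simp add: m_assoc)
  then have "b \<otimes> (v \<otimes> inv a) = b \<otimes> ((a \<otimes> inv b \<otimes> w) \<otimes> inv a)" using eq by simp
  also have "\<dots> = (a \<otimes> inv a) \<otimes> ((b \<otimes> inv b) \<otimes> w)"
    using c by (simp add: m_ac del: r_inv l_inv Units_r_inv Units_l_inv)
  finally show ?thesis using c by simp
qed

text \<open>Related elements are those that are the two faces of some element of level 1.\<close>

definition diff_rel where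
  "diff_rel D act = {(x, y). x \<in> level D act 0 \<and> y \<in> level D act 0 \<and> x \<otimes>\<^bsub>D\<^esub> inv\<^bsub>D\<^esub> y \<in> diffs D act}"

context transf_module
begin

lemma act_0_1:
  assumes "1 \<le> N" "x \<in> carrier D"
  shows "act (clip 0) x \<in> level D act 0" "act (\<lambda>_. 1) x \<in> level D act 0"
proof -
  show "act (clip 0) x \<in> level D act 0" using act_level[of 0] clip_maps[of 0 0] assms by simp
  have "act (clip 0) (act (\<lambda>_. 1) x) = act ((\<lambda>_. 1) \<circ> clip 0) x"
    using act_comp[of "clip 0" "\<lambda>_. 1" x] assms clip_maps[of 0 N] const1_maps[of N] by simp
  then show "act (\<lambda>_. 1) x \<in> level D act 0"
    using assms act_closed[OF const1_maps] by (simp add: level_def comp_def)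
qed

text \<open>
  The map \<open>clip 0\<close> is constant, so that preceding it by another map changes nothing.
\<close>

lemma act_level_0:
  assumes "x \<in> level D act 0" "f \<in> maps N" shows "act f x = x"
proof -
  have "act f (act (clip 0) x) = act (clip 0 \<circ> f) x"
    using act_comp[OF assms(2), of "clip 0" x] assms clip_maps[of 0 N] by (simp add: level_def)
  moreover have "clip 0 \<circ> f = clip 0" by (auto simp: clip_def)
  ultimately show ?thesis using assms by (simp add: level_def)
qed

lemma subgroup_diffs:
  assumes N: "1 \<le> N" shows "subgroup (diffs D act) D"
proof (rule subgroupI)
  have cl: "act (clip 0) x \<in> carrier D" "act (\<lambda>_. 1) x \<in> carrier D" if "x \<in> carrier D" for x
    using act_0_1[OF N that] by (auto simp: level_def)
  have m: "clip 0 \<in> maps N" "(\<lambda>_. 1) \<in> maps N" using clip_maps[of 0 N] const1_maps[OF N] by auto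
  show "diffs D act \<subseteq> carrier D" using cl by (auto simp: diffs_def)
  show "diffs D act \<noteq> {}" using one_closed by (auto simp: diffs_def)
  show "inv d \<in> diffs D act" if d: "d \<in> diffs D act" for d
  proof -
    from d obtain x where x: "x \<in> carrier D" "d = act (clip 0) x \<otimes> inv (act (\<lambda>_. 1) x)" by (auto simp: diffs_def)
    then have "inv d = act (clip 0) (inv x) \<otimes> inv (act (\<lambda>_. 1) (inv x))"
      using cl[OF x(1)] m by (simp add: act_inv inv_mult)
    then show ?thesis using x(1) unfolding diffs_def by (metis (mono_tags, lifting) inv_closed mem_Collect_eq)
  qed
  show "d \<otimes> e \<in> diffs D act" if de: "d \<in> diffs D act" "e \<in> diffs D act" for d e
  proof -
    from de obtain x y where x: "x \<in> carrier D" "d = act (clip 0) x \<otimes> inv (act (\<lambda>_. 1) x)"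
      and y: "y \<in> carrier D" "e = act (clip 0) y \<otimes> inv (act (\<lambda>_. 1) y)" by (auto simp: diffs_def)
    have "d \<otimes> e = act (clip 0) (x \<otimes> y) \<otimes> inv (act (\<lambda>_. 1) (x \<otimes> y))"
      using x y cl[OF x(1)] cl[OF y(1)] m by (simp add: act_mult inv_mult m_ac)
    then show ?thesis using x(1) y(1) unfolding diffs_def by (metis (mono_tags, lifting) m_closed mem_Collect_eq)
  qed
qed

lemma diffs_level: "1 \<le> N \<Longrightarrow> diffs D act \<subseteq> level D act 0"
  using act_0_1 level_mult[of 0] level_inv[of 0] by (auto simp: diffs_def)

lemma equiv_diff_rel:
  assumes N: "1 \<le> N" shows "equiv (level D act 0) (diff_rel D act)"
proof (rule equivI)
  interpret S: subgroup "diffs D act" D using subgroup_diffs[OF N] .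
  have c: "x \<in> carrier D" if "x \<in> level D act 0" for x using that level_carrier by blast
  show "diff_rel D act \<subseteq> level D act 0 \<times> level D act 0" by (auto simp: diff_rel_def)
  show "refl_on (level D act 0) (diff_rel D act)" using c by (auto simp: refl_on_def diff_rel_def)
  show "sym (diff_rel D act)"
  proof (rule symI)
    fix x y assume "(x, y) \<in> diff_rel D act"
    then have *: "x \<in> level D act 0" "y \<in> level D act 0" "x \<otimes> inv y \<in> diffs D act" by (auto simp: diff_rel_def)
    have "inv (x \<otimes> inv y) = y \<otimes> inv x" using c * by (simp add: inv_mult m_comm)
    then show "(y, x) \<in> diff_rel D act" using S.m_inv_closed[OF *(3)] * by (auto simp: diff_rel_def)
  qed
  show "trans (diff_rel D act)"
  proof (rule transI)
    fix x y z assume "(x, y) \<in> diff_rel D act" "(y, z) \<in> diff_rel D act"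
    then have *: "x \<in> level D act 0" "y \<in> level D act 0" "z \<in> level D act 0"
        "x \<otimes> inv y \<in> diffs D act" "y \<otimes> inv z \<in> diffs D act" by (auto simp: diff_rel_def)
    have "(x \<otimes> inv y) \<otimes> (y \<otimes> inv z) = x \<otimes> inv z"
      using c * by (metis inv_closed inv_solve_left m_assoc m_closed)
    then show "(x, z) \<in> diff_rel D act" using S.m_closed[OF *(4,5)] * by (auto simp: diff_rel_def)
  qed
qed

lemma card_diff_class:
  assumes N: "1 \<le> N" and C: "C \<in> level D act 0 // diff_rel D act"
  shows "card C = card (diffs D act)"
proof -
  interpret S: subgroup "diffs D act" D using subgroup_diffs[OF N] .
  from C obtain x where x: "x \<in> level D act 0" "C = diff_rel D act `` {x}" by (auto simp: quotient_def)
  have xc: "x \<in> carrier D" using x level_carrier by blast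
  have "bij_betw (\<lambda>d. x \<otimes> inv d) (diffs D act) C"
  proof (rule bij_betw_byWitness[where f' = "\<lambda>y. x \<otimes> inv y"])
    show "\<forall>d\<in>diffs D act. x \<otimes> inv (x \<otimes> inv d) = d"
      using xc S.mem_carrier by (simp add: inv_mult m_assoc[symmetric])
    show "\<forall>y\<in>C. x \<otimes> inv (x \<otimes> inv y) = y"
      using x xc level_carrier by (auto simp: diff_rel_def inv_mult m_assoc[symmetric])
    show "(\<lambda>d. x \<otimes> inv d) ` diffs D act \<subseteq> C"
    proof clarsimp
      fix d assume d: "d \<in> diffs D act"
      then have "d \<in> level D act 0" using diffs_level[OF N] by blast
      then have "x \<otimes> inv d \<in> level D act 0" using x level_mult[of 0] level_inv[of 0] by blast
      moreover have "x \<otimes> inv (x \<otimes> inv d) = d"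
        using xc S.mem_carrier[OF d] by (simp add: inv_mult m_assoc[symmetric])
      ultimately show "x \<otimes> inv d \<in> C" using x d by (simp add: diff_rel_def)
    qed
    show "(\<lambda>y. x \<otimes> inv y) ` C \<subseteq> diffs D act" using x by (auto simp: diff_rel_def)
  qed
  then show ?thesis using bij_betw_same_card by metis
qed

end

text \<open>
  The first step, from level 0 to level 1. Some \<open>z\<close> has faces with the required quotient, and
  multiplying \<open>z\<close> by an element of level 0, which changes both faces by the same factor, gives
  the required faces.
\<close>

lemma (in face_step) face_rel_total_1:
  assumes k: "k = 0" and x: "x \<in> level D1 a1 1"
    and pres: "\<And>v w. (v, w) \<in> diff_rel D1 a1 \<Longrightarrow> (\<psi> v, \<psi> w) \<in> diff_rel D2 a2"
  shows "\<exists>x'. M x x'"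
proof -
  have N: "1 \<le> N" using K k by simp
  have xc: "x \<in> carrier D1" using x by (simp add: level_def)
  let ?v = "a1 (clip 0) x" and ?w = "a1 (\<lambda>_. 1) x"
  have vw: "?v \<in> level D1 a1 0" "?w \<in> level D1 a1 0" using D1.act_0_1[OF N xc] by auto
  then have "(?v, ?w) \<in> diff_rel D1 a1" using xc by (auto simp: diff_rel_def diffs_def)
  then have "\<psi> ?v \<otimes>\<^bsub>D2\<^esub> inv\<^bsub>D2\<^esub> (\<psi> ?w) \<in> diffs D2 a2" using pres by (auto simp: diff_rel_def)
  then obtain z where z: "z \<in> carrier D2"
      "\<psi> ?v \<otimes>\<^bsub>D2\<^esub> inv\<^bsub>D2\<^esub> (\<psi> ?w) = a2 (clip 0) z \<otimes>\<^bsub>D2\<^esub> inv\<^bsub>D2\<^esub> (a2 (\<lambda>_. 1) z)"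
    by (auto simp: diffs_def)
  have p: "\<psi> ?v \<in> level D2 a2 0" "\<psi> ?w \<in> level D2 a2 0" using psi_level vw k by auto
  have m: "clip 0 \<in> maps N" "(\<lambda>_. 1) \<in> maps N" "clip 1 \<in> maps N"
    using clip_maps[of 0 N] clip_maps[of 1 N] const1_maps[OF N] N by auto
  have z01: "a2 (clip 0) z \<in> level D2 a2 0" "a2 (\<lambda>_. 1) z \<in> level D2 a2 0" using D2.act_0_1[OF N z(1)] .
  have c: "\<psi> ?v \<in> carrier D2" "\<psi> ?w \<in> carrier D2" "a2 (clip 0) z \<in> carrier D2" "a2 (\<lambda>_. 1) z \<in> carrier D2"
    using p z01 D2.level_carrier by blast+
  define y where "y = z \<otimes>\<^bsub>D2\<^esub> (\<psi> ?v \<otimes>\<^bsub>D2\<^esub> inv\<^bsub>D2\<^esub> (a2 (clip 0) z))"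
  have yc: "y \<in> carrier D2" using z c by (simp add: y_def)
  have d0: "\<psi> ?v \<otimes>\<^bsub>D2\<^esub> inv\<^bsub>D2\<^esub> (a2 (clip 0) z) \<in> level D2 a2 0"
    using p z01 D2.level_mult[of 0] D2.level_inv[of 0] by blast
  have "a2 (clip 0) y = a2 (clip 0) z \<otimes>\<^bsub>D2\<^esub> (\<psi> ?v \<otimes>\<^bsub>D2\<^esub> inv\<^bsub>D2\<^esub> (a2 (clip 0) z))"
    using m z c D2.act_level_0[OF d0 m(1)] by (simp add: y_def D2.act_mult)
  then have y0: "a2 (clip 0) y = \<psi> ?v" using c D2.mult_diff by simp
  have "a2 (\<lambda>_. 1) y = a2 (\<lambda>_. 1) z \<otimes>\<^bsub>D2\<^esub> (\<psi> ?v \<otimes>\<^bsub>D2\<^esub> inv\<^bsub>D2\<^esub> (a2 (clip 0) z))"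
    using m z c D2.act_level_0[OF d0 m(2)] by (simp add: y_def D2.act_mult)
  also have "\<dots> = \<psi> ?w"
    using D2.equal_quotients_exchange[OF c(1,2,3,4) z(2)] .
  finally have y1: "a2 (\<lambda>_. 1) y = \<psi> ?w" .
  have "a2 u (a2 (clip 1) y) = \<psi> (a1 u x)" if u: "u \<in> maps 1" "u \<circ> clip 0 = u" for u
  proof -
    have "a2 u (a2 (clip 1) y) = a2 u y"
      using D2.act_compk[of 1 u "clip 1" y] u clip_maps[of 1 1] N yc by simp
    then show ?thesis using sings_1[OF u] y0 y1 by auto
  qed
  then show ?thesis
    using x D2.act_level[OF N clip_maps yc] k by (auto simp: face_rel_def)
qed

text \<open>
  Induction on the level. Beyond level \<open>N\<close>, an element is determined by its image under \<open>clip N\<close>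
  and by an element of the kernel of \<open>clip N\<close>; all of \<open>maps N\<close> acts through that image, so equal
  cardinalities suffice there.
\<close>

theorem equivariant_bijection:
  fixes D1 :: "('d1, 'e1) monoid_scheme" and D2 :: "('d2, 'e2) monoid_scheme"
  assumes "transf_module D1 N a1" "transf_module D2 N a2" and N: "1 \<le> N" and extensible: "extensible D1 N a1" "extensible D2 N a2"
    and marks: "\<And>k H. \<lbrakk>k \<le> N; subgroup H (perm_group k)\<rbrakk> \<Longrightarrow>
      card (fixed a1 H (level D1 a1 k)) = card (fixed a2 H (level D2 a2 k))"
    and dif: "card (diffs D1 a1) = card (diffs D2 a2)"
    and car: "card (carrier D1) = card (carrier D2)"
  shows "\<exists>\<Psi>. bij_betw \<Psi> (carrier D1) (carrier D2) \<and>
    (\<forall>f\<in>maps N. \<forall>x\<in>carrier D1. \<Psi> (a1 f x) = a2 f (\<Psi> x))"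
proof -
  interpret D1: transf_module D1 N a1 by fact
  interpret D2: transf_module D2 N a2 by fact
  have cl: "card (level D1 a1 k) = card (level D2 a2 k)" if "k \<le> N" for k
  proof -
    have "fixed a1 {clip k} (level D1 a1 k) = level D1 a1 k" "fixed a2 {clip k} (level D2 a2 k) = level D2 a2 k"
      by (auto simp: fixed_def level_def)
    then show ?thesis
      using marks[OF that, of "{clip k}"] group.triv_subgroup[OF group_perm_group, of k] by simp
  qed
  define P where "P k \<psi> \<longleftrightarrow> bij_betw \<psi> (level D1 a1 k) (level D2 a2 k) \<and>
    (\<forall>f\<in>maps k. \<forall>x\<in>level D1 a1 k. \<psi> (a1 f x) = a2 f (\<psi> x)) \<and>
    (k = 0 \<longrightarrow> (\<forall>x\<in>level D1 a1 0. \<forall>y\<in>level D1 a1 0. (x, y) \<in> diff_rel D1 a1 \<longleftrightarrow> (\<psi> x, \<psi> y) \<in> diff_rel D2 a2))" for k \<psi>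
  have "\<exists>\<psi>. P k \<psi>" if "k \<le> N" for k
    using that
  proof (induction k)
    case 0
    obtain \<psi> where \<psi>: "bij_betw \<psi> (level D1 a1 0) (level D2 a2 0)"
      "\<forall>x\<in>level D1 a1 0. \<forall>y\<in>level D1 a1 0. (x, y) \<in> diff_rel D1 a1 \<longleftrightarrow> (\<psi> x, \<psi> y) \<in> diff_rel D2 a2"
      using class_preserving_bij[OF D1.finite_level D2.finite_level D1.equiv_diff_rel[OF N] D2.equiv_diff_rel[OF N],
        of "card (diffs D1 a1)"] D1.card_diff_class[OF N] D2.card_diff_class[OF N] dif cl[of 0] by auto
    have "\<psi> (a1 f x) = a2 f (\<psi> x)" if "f \<in> maps 0" "x \<in> level D1 a1 0" for f x
    proof -
      have "f \<in> maps N" "\<psi> x \<in> level D2 a2 0" using that maps_mono[of 0 N] bij_betwE[OF \<psi>(1)] by auto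
      then show ?thesis using D1.act_level_0[OF that(2)] D2.act_level_0 by simp
    qed
    then show ?case using \<psi> unfolding P_def by blast
  next
    case (Suc k)
    then obtain \<psi> where \<psi>: "P k \<psi>" by auto
    have st: "face_step D1 N a1 D2 a2 k \<psi>"
      by unfold_locales (use \<psi> Suc.prems in \<open>auto simp: P_def\<close>)
    interpret S: face_step D1 N a1 D2 a2 k \<psi> by (rule st)
    let ?i = "inv_into (level D1 a1 k) \<psi>"
    interpret R: face_step D2 N a2 D1 a1 k ?i by (rule face_step_swap(1)[OF st])
    have t1: "\<exists>x'. S.M x x'" if x: "x \<in> level D1 a1 (Suc k)" for x
    proof (cases "k = 0")
      case True
      have "(\<psi> v, \<psi> w) \<in> diff_rel D2 a2" if "(v, w) \<in> diff_rel D1 a1" for v w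
        using that \<psi> True unfolding P_def by (auto simp: diff_rel_def)
      then show ?thesis using S.face_rel_total_1[OF True] x True by simp
    next
      case False
      then show ?thesis using S.face_rel_total[OF _ x] extensible(2) Suc.prems by (auto simp: extensible_def)
    qed
    have t2: "\<exists>x'. S.M x' x" if x: "x \<in> level D2 a2 (Suc k)" for x
    proof -
      have "\<exists>x'. R.M x x'"
      proof (cases "k = 0")
        case True
        have "(?i v, ?i w) \<in> diff_rel D1 a1" if vw: "(v, w) \<in> diff_rel D2 a2" for v w
        proof -
          have L: "v \<in> level D2 a2 0" "w \<in> level D2 a2 0" using vw by (auto simp: diff_rel_def)
          then have "?i v \<in> level D1 a1 0" "?i w \<in> level D1 a1 0" "\<psi> (?i v) = v" "\<psi> (?i w) = w"
            using S.bij True by (auto simp: bij_betw_def f_inv_into_f inv_into_into)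
          then show ?thesis using \<psi> True vw unfolding P_def by metis
        qed
        then show ?thesis using R.face_rel_total_1[OF True] x True by simp
      next
        case False
        then show ?thesis using R.face_rel_total[OF _ x] extensible(1) Suc.prems by (auto simp: extensible_def)
      qed
      then show ?thesis using face_step_swap(2)[OF st] by blast
    qed
    have "\<exists>\<Psi>. bij_betw \<Psi> (level D1 a1 (Suc k)) (level D2 a2 (Suc k)) \<and>
        (\<forall>f\<in>maps (Suc k). \<forall>x\<in>level D1 a1 (Suc k). \<Psi> (a1 f x) = a2 f (\<Psi> x))"
    proof (rule equivariant_bij_from_face_relation[where M = S.M, OF assms(1,2) Suc.prems])
      show "\<exists>\<pi>. splitting D1 a1 (Suc k) \<pi>" "\<exists>\<pi>. splitting D2 a2 (Suc k) \<pi>"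
        using extensible Suc.prems by (auto simp: extensible_def)
      show "x \<in> level D1 a1 (Suc k) \<and> x' \<in> level D2 a2 (Suc k)" if "S.M x x'" for x x'
        using that by (simp add: face_rel_def)
    qed (use t1 t2 S.face_rel_same S.face_rel_equi marks[OF Suc.prems] in auto)
    then show ?case unfolding P_def by auto
  qed
  from this[OF order_refl] obtain \<psi> where "P N \<psi>" ..
  then have \<psi>: "bij_betw \<psi> (level D1 a1 N) (level D2 a2 N)"
    "\<And>f x. \<lbrakk>f \<in> maps N; x \<in> level D1 a1 N\<rbrakk> \<Longrightarrow> \<psi> (a1 f x) = a2 f (\<psi> x)"
    by (simp_all add: P_def)
  let ?e = "clip N"
  have e: "?e \<in> maps N" by (rule clip_maps) simp
  have split: "bij_betw (\<lambda>x. (a ?e x, x \<otimes>\<^bsub>D\<^esub> inv\<^bsub>D\<^esub> (a ?e x))) (carrier D)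
      (level D a N \<times> {x \<in> carrier D. a ?e x = \<one>\<^bsub>D\<^esub>})"
    if "transf_module D N a" for D :: "('z, 'w) monoid_scheme" and a
  proof -
    interpret D: transf_module D N a by fact
    have ee: "a ?e (a ?e x) = a ?e x" if "x \<in> carrier D" for x
      using D.act_comp[OF e e that] e by simp
    show ?thesis
    proof (rule bij_betw_byWitness[where f' = "\<lambda>(p, z). p \<otimes>\<^bsub>D\<^esub> z"])
      show "\<forall>a'\<in>carrier D. (case (a ?e a', a' \<otimes>\<^bsub>D\<^esub> inv\<^bsub>D\<^esub> a ?e a') of (p, z) \<Rightarrow> p \<otimes>\<^bsub>D\<^esub> z) = a'"
        using D.mult_diff D.act_closed[OF e] by simp
      show "\<forall>a'\<in>level D a N \<times> {x \<in> carrier D. a ?e x = \<one>\<^bsub>D\<^esub>}.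
          (a ?e (case a' of (p, z) \<Rightarrow> p \<otimes>\<^bsub>D\<^esub> z), (case a' of (p, z) \<Rightarrow> p \<otimes>\<^bsub>D\<^esub> z) \<otimes>\<^bsub>D\<^esub>
            inv\<^bsub>D\<^esub> a ?e (case a' of (p, z) \<Rightarrow> p \<otimes>\<^bsub>D\<^esub> z)) = a'"
        using D.diff_mult e by (auto simp: level_def D.act_mult)
      show "(\<lambda>x. (a ?e x, x \<otimes>\<^bsub>D\<^esub> inv\<^bsub>D\<^esub> a ?e x)) ` carrier D
          \<subseteq> level D a N \<times> {x \<in> carrier D. a ?e x = \<one>\<^bsub>D\<^esub>}"
        using e ee D.act_closed[OF e] by (auto simp: level_def D.act_mult D.act_inv)
      show "(\<lambda>(p, z). p \<otimes>\<^bsub>D\<^esub> z) ` (level D a N \<times> {x \<in> carrier D. a ?e x = \<one>\<^bsub>D\<^esub>}) \<subseteq> carrier D"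
        by (auto simp: level_def)
    qed
  qed
  let ?K1 = "{x \<in> carrier D1. a1 ?e x = \<one>\<^bsub>D1\<^esub>}" and ?K2 = "{x \<in> carrier D2. a2 ?e x = \<one>\<^bsub>D2\<^esub>}"
  have "card (level D1 a1 N) * card ?K1 = card (level D2 a2 N) * card ?K2"
    using bij_betw_same_card[OF split[OF assms(1)]] bij_betw_same_card[OF split[OF assms(2)]] car
    by (simp add: card_cartesian_product)
  moreover have "card (level D1 a1 N) > 0"
    using D1.level_one[of N] D1.finite_level by (auto simp: card_gt_0_iff)
  ultimately have "card ?K1 = card ?K2" using cl[of N] by simp
  moreover have o: "\<one>\<^bsub>D1\<^esub> \<in> ?K1" "\<one>\<^bsub>D2\<^esub> \<in> ?K2" using D1.act_one[OF e] D2.act_one[OF e] by auto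
  moreover have "finite ?K1" "finite ?K2" using D1.fin D2.fin by auto
  ultimately obtain \<kappa>' where k': "bij_betw \<kappa>' (?K1 - {\<one>\<^bsub>D1\<^esub>}) (?K2 - {\<one>\<^bsub>D2\<^esub>})"
    using finite_same_card_bij[of "?K1 - {\<one>\<^bsub>D1\<^esub>}" "?K2 - {\<one>\<^bsub>D2\<^esub>}"] by auto
  define \<kappa> where "\<kappa> x = (if x = \<one>\<^bsub>D1\<^esub> then \<one>\<^bsub>D2\<^esub> else \<kappa>' x)" for x
  have \<kappa>: "bij_betw \<kappa> ?K1 ?K2"
  proof -
    have "bij_betw \<kappa> ({\<one>\<^bsub>D1\<^esub>} \<union> (?K1 - {\<one>\<^bsub>D1\<^esub>})) ({\<one>\<^bsub>D2\<^esub>} \<union> (?K2 - {\<one>\<^bsub>D2\<^esub>}))"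
    proof (rule bij_betw_combine)
      show "bij_betw \<kappa> (?K1 - {\<one>\<^bsub>D1\<^esub>}) (?K2 - {\<one>\<^bsub>D2\<^esub>})" using k'
        by (rule bij_betw_cong[THEN iffD1, rotated]) (simp add: \<kappa>_def)
    qed (auto simp: \<kappa>_def bij_betw_def)
    then show ?thesis using o by (simp add: insert_absorb)
  qed
  define \<Psi> where "\<Psi> x = \<psi> (a1 ?e x) \<otimes>\<^bsub>D2\<^esub> \<kappa> (x \<otimes>\<^bsub>D1\<^esub> inv\<^bsub>D1\<^esub> (a1 ?e x))" for x
  have "bij_betw (inv_into (carrier D2) (\<lambda>x. (a2 ?e x, x \<otimes>\<^bsub>D2\<^esub> inv\<^bsub>D2\<^esub> (a2 ?e x))) \<circ>
      map_prod \<psi> \<kappa> \<circ> (\<lambda>x. (a1 ?e x, x \<otimes>\<^bsub>D1\<^esub> inv\<^bsub>D1\<^esub> (a1 ?e x)))) (carrier D1) (carrier D2)" (is "bij_betw ?F _ _")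
    by (intro bij_betw_trans[OF split[OF assms(1)]] bij_betw_trans[OF bij_betw_map_prod[OF \<psi>(1) \<kappa>]]
        bij_betw_inv_into split[OF assms(2)])
  moreover have PF: "\<Psi> x = ?F x" "a2 ?e (\<Psi> x) = \<psi> (a1 ?e x)" "\<Psi> x \<in> carrier D2" if x: "x \<in> carrier D1" for x
  proof -
    have "(a1 ?e x, x \<otimes>\<^bsub>D1\<^esub> inv\<^bsub>D1\<^esub> (a1 ?e x)) \<in> level D1 a1 N \<times> ?K1"
      using split[OF assms(1)] x bij_betwE by blast
    then have pk: "\<psi> (a1 ?e x) \<in> level D2 a2 N" "\<kappa> (x \<otimes>\<^bsub>D1\<^esub> inv\<^bsub>D1\<^esub> (a1 ?e x)) \<in> ?K2"
      using \<psi>(1) \<kappa> bij_betwE by blast+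
    then show c: "\<Psi> x \<in> carrier D2" by (auto simp: \<Psi>_def level_def)
    show ae: "a2 ?e (\<Psi> x) = \<psi> (a1 ?e x)" using pk e by (auto simp: \<Psi>_def level_def D2.act_mult)
    have "\<Psi> x \<otimes>\<^bsub>D2\<^esub> inv\<^bsub>D2\<^esub> (\<psi> (a1 ?e x)) = \<kappa> (x \<otimes>\<^bsub>D1\<^esub> inv\<^bsub>D1\<^esub> (a1 ?e x))"
      unfolding \<Psi>_def using pk D2.diff_mult by (auto simp: level_def)
    then have eq: "(a2 ?e (\<Psi> x), \<Psi> x \<otimes>\<^bsub>D2\<^esub> inv\<^bsub>D2\<^esub> (a2 ?e (\<Psi> x))) = map_prod \<psi> \<kappa> (a1 ?e x, x \<otimes>\<^bsub>D1\<^esub> inv\<^bsub>D1\<^esub> (a1 ?e x))"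
      using ae by simp
    then show "\<Psi> x = ?F x"
      using bij_betw_inv_into_left[OF split[OF assms(2)] c] by (simp only: comp_apply eq)
  qed
  ultimately have bij: "bij_betw \<Psi> (carrier D1) (carrier D2)" using bij_betw_cong[of "carrier D1" \<Psi> ?F] by simp
  have "\<Psi> (a1 f x) = a2 f (\<Psi> x)" if f: "f \<in> maps N" and x: "x \<in> carrier D1" for f x
  proof -
    have fe: "a1 ?e (a1 f x) = a1 f x" "a1 f (a1 ?e x) = a1 f x" "a2 f (a2 ?e (\<Psi> x)) = a2 f (\<Psi> x)"
      using D1.act_comp[OF e f x] D1.act_comp[OF f e x] D2.act_comp[OF f e PF(3)[OF x]] f by simp_all
    have L: "a1 ?e x \<in> level D1 a1 N" "a1 f x \<in> level D1 a1 N"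
      using D1.act_level[of N] e f x by blast+
    have "\<psi> (a1 f x) \<in> carrier D2" using \<psi>(1) L by (auto simp: level_def dest: bij_betwE)
    then have "\<Psi> (a1 f x) = \<psi> (a1 f x)"
      using fe L by (simp add: \<Psi>_def \<kappa>_def level_def)
    also have "\<dots> = a2 f (\<psi> (a1 ?e x))" using \<psi>(2)[OF f L(1)] fe by simp
    also have "\<dots> = a2 f (\<Psi> x)" using PF(2)[OF x] fe by simp
    finally show ?thesis .
  qed
  then show ?thesis using bij by blast
qed

section \<open>Modules of functions on partial acts\<close>

locale map_ext = semigrp A for A :: "('a, 'b) monoid_scheme" (structure) +
  fixes N :: nat and \<tau> :: "(nat \<Rightarrow> nat) \<Rightarrow> 'a"
  assumes finA: "finite (carrier A)" and N1: "1 \<le> N"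
    and \<tau>_closed: "f \<in> maps N \<Longrightarrow> \<tau> f \<in> carrier A"
    and \<tau>_comp: "\<lbrakk>f \<in> maps N; g \<in> maps N\<rbrakk> \<Longrightarrow> \<tau> (g \<circ> f) = \<tau> f \<otimes> \<tau> g"
    and \<tau>_inj: "inj_on \<tau> (maps N)"

text \<open>
  The exponent is a parameter since averages over a group require an exponent prime to its
  order.
\<close>

locale act_module = D: comm_group D for A :: "('a, 'b) monoid_scheme" and D :: "('d, 'e) monoid_scheme" +
  fixes m :: nat and act :: "'a \<Rightarrow> 'd \<Rightarrow> 'd"
  assumes fin: "finite (carrier D)"
    and act_hom: "a \<in> carrier A \<Longrightarrow> act a \<in> hom D D"
    and act_comp: "\<lbrakk>a \<in> carrier A; b \<in> carrier A; x \<in> carrier D\<rbrakk> \<Longrightarrow> act (a \<otimes>\<^bsub>A\<^esub> b) x = act a (act b x)"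
    and exponent: "x \<in> carrier D \<Longrightarrow> x [^]\<^bsub>D\<^esub> m = \<one>\<^bsub>D\<^esub>"

lemma (in map_ext) transf_module_of_act_module: "act_module A D m act \<Longrightarrow> transf_module D N (\<lambda>f. act (\<tau> f))"
  unfolding transf_module_def transf_module_axioms_def act_module_def act_module_axioms_def by (auto simp: \<tau>_comp \<tau>_closed)

text \<open>
  Here \<open>\<rho>\<close> is a right act of \<open>A\<close> on \<open>Y\<close> by partial maps. The functions from \<open>Y\<close> to \<open>E\<close> are
  subject to a family of linear conditions indexed by \<open>Y\<close>, each involving the points \<open>lam q y\<close>
  with \<open>q \<in> Q\<close>; since the maps \<open>lam q\<close> commute with the right act, the conditions are
  preserved. The empty set \<open>Q\<close> gives all functions.
\<close>

locale function_module = map_ext A N \<tau> + E: comm_group E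
  for A :: "('a, 'b) monoid_scheme" and N \<tau> and E :: "('e, 'f) monoid_scheme" +
  fixes m :: nat and Y :: "'y set" and \<rho> :: "'a \<Rightarrow> 'y \<Rightarrow> 'y option"
    and Q :: "'q set" and c :: "'q \<Rightarrow> 'e \<Rightarrow> 'e" and lam :: "'q \<Rightarrow> 'y \<Rightarrow> 'y"
  assumes finE: "finite (carrier E)" and expE: "x \<in> carrier E \<Longrightarrow> x [^]\<^bsub>E\<^esub> m = \<one>\<^bsub>E\<^esub>"
    and finY: "finite Y"
    and \<rho>_closed: "\<lbrakk>a \<in> carrier A; y \<in> Y; \<rho> a y = Some w\<rbrakk> \<Longrightarrow> w \<in> Y"
    and \<rho>_mult: "\<lbrakk>a \<in> carrier A; b \<in> carrier A; y \<in> Y\<rbrakk> \<Longrightarrow> \<rho> (a \<otimes>\<^bsub>A\<^esub> b) y = Option.bind (\<rho> a y) (\<rho> b)"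
    and c_hom: "q \<in> Q \<Longrightarrow> c q \<in> hom E E"
    and lam_closed: "\<lbrakk>q \<in> Q; y \<in> Y\<rbrakk> \<Longrightarrow> lam q y \<in> Y"
    and lam_inj: "q \<in> Q \<Longrightarrow> inj_on (lam q) Y"
    and lam_\<rho>: "\<lbrakk>q \<in> Q; a \<in> carrier A; y \<in> Y\<rbrakk> \<Longrightarrow> \<rho> a (lam q y) = map_option (lam q) (\<rho> a y)"
begin

definition constr :: "('y \<Rightarrow> 'e) \<Rightarrow> 'y \<Rightarrow> 'e" where
  "constr \<phi> y = finprod E (\<lambda>q. c q (\<phi> (lam q y))) Q"

definition Fun :: "('y \<Rightarrow> 'e) monoid" where
  "Fun = \<lparr>carrier = {\<phi> \<in> Y \<rightarrow>\<^sub>E carrier E. \<forall>y\<in>Y. constr \<phi> y = \<one>\<^bsub>E\<^esub>},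
     mult = (\<lambda>\<phi> \<psi>. \<lambda>y\<in>Y. \<phi> y \<otimes>\<^bsub>E\<^esub> \<psi> y), one = (\<lambda>y\<in>Y. \<one>\<^bsub>E\<^esub>)\<rparr>"

text \<open>Where the right act is undefined, a function takes the neutral value.\<close>

definition ev :: "('y \<Rightarrow> 'e) \<Rightarrow> 'y option \<Rightarrow> 'e" where
  "ev \<phi> o' = (case o' of None \<Rightarrow> \<one>\<^bsub>E\<^esub> | Some w \<Rightarrow> \<phi> w)"

definition pull :: "'a \<Rightarrow> ('y \<Rightarrow> 'e) \<Rightarrow> 'y \<Rightarrow> 'e" where
  "pull a \<phi> = (\<lambda>y\<in>Y. ev \<phi> (\<rho> a y))"

lemma ev_simps [simp]: "ev \<phi> None = \<one>\<^bsub>E\<^esub>" "ev \<phi> (Some w) = \<phi> w"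
  by (simp_all add: ev_def)

lemma Fun_simps [simp]: "\<phi> \<otimes>\<^bsub>Fun\<^esub> \<psi> = (\<lambda>y\<in>Y. \<phi> y \<otimes>\<^bsub>E\<^esub> \<psi> y)" "\<one>\<^bsub>Fun\<^esub> = (\<lambda>y\<in>Y. \<one>\<^bsub>E\<^esub>)"
  by (simp_all add: Fun_def)

lemma Fun_iff: "\<phi> \<in> carrier Fun \<longleftrightarrow> \<phi> \<in> Y \<rightarrow>\<^sub>E carrier E \<and> (\<forall>y\<in>Y. constr \<phi> y = \<one>\<^bsub>E\<^esub>)"
  by (simp add: Fun_def)

lemma Fun_val: "\<lbrakk>\<phi> \<in> carrier Fun; y \<in> Y\<rbrakk> \<Longrightarrow> \<phi> y \<in> carrier E"
  by (auto simp: Fun_iff)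

lemma c_closed: "\<lbrakk>q \<in> Q; x \<in> carrier E\<rbrakk> \<Longrightarrow> c q x \<in> carrier E"
  using c_hom by (auto simp: hom_def)

lemma c_one: "q \<in> Q \<Longrightarrow> c q \<one>\<^bsub>E\<^esub> = \<one>\<^bsub>E\<^esub>"
  using c_hom E.group_axioms by (metis group_hom.hom_one group_hom.intro group_hom_axioms.intro)

lemma constr_one: "\<lbrakk>y \<in> Y; \<And>q. q \<in> Q \<Longrightarrow> \<phi> (lam q y) = \<one>\<^bsub>E\<^esub>\<rbrakk> \<Longrightarrow> constr \<phi> y = \<one>\<^bsub>E\<^esub>"
  unfolding constr_def by (rule E.finprod_one_eqI) (simp add: c_one)

lemma constr_cong:
  "\<lbrakk>y \<in> Y; \<psi> \<in> Y \<rightarrow> carrier E; \<And>q. q \<in> Q \<Longrightarrow> \<phi> (lam q y) = \<psi> (lam q y)\<rbrakk> \<Longrightarrow> constr \<phi> y = constr \<psi> y"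
  unfolding constr_def by (rule E.finprod_cong') (auto simp: c_closed lam_closed Pi_iff)

lemma constr_mult:
  assumes "\<phi> \<in> Y \<rightarrow> carrier E" "\<psi> \<in> Y \<rightarrow> carrier E" "y \<in> Y"
  shows "constr (\<lambda>y\<in>Y. \<phi> y \<otimes>\<^bsub>E\<^esub> \<psi> y) y = constr \<phi> y \<otimes>\<^bsub>E\<^esub> constr \<psi> y"
proof -
  have "constr (\<lambda>y\<in>Y. \<phi> y \<otimes>\<^bsub>E\<^esub> \<psi> y) y = finprod E (\<lambda>q. c q (\<phi> (lam q y)) \<otimes>\<^bsub>E\<^esub> c q (\<psi> (lam q y))) Q"
    unfolding constr_def
    by (rule E.finprod_cong') (use assms c_hom in \<open>auto simp: lam_closed c_closed Pi_iff hom_def\<close>)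
  also have "\<dots> = constr \<phi> y \<otimes>\<^bsub>E\<^esub> constr \<psi> y"
    unfolding constr_def
    by (rule E.finprod_multf) (use assms in \<open>auto simp: lam_closed c_closed Pi_iff\<close>)
  finally show ?thesis .
qed

lemma comm_group_Fun: "comm_group Fun"
proof (rule comm_groupI)
  fix \<phi> \<psi> assume p: "\<phi> \<in> carrier Fun" "\<psi> \<in> carrier Fun"
  then have "\<phi> \<in> Y \<rightarrow> carrier E" "\<psi> \<in> Y \<rightarrow> carrier E" by (auto simp: Fun_iff)
  then show "\<phi> \<otimes>\<^bsub>Fun\<^esub> \<psi> \<in> carrier Fun" using p constr_mult by (auto simp: Fun_iff)
  show "\<phi> \<otimes>\<^bsub>Fun\<^esub> \<psi> = \<psi> \<otimes>\<^bsub>Fun\<^esub> \<phi>" using p Fun_val by (auto simp: E.m_comm intro!: restrict_ext)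
next
  show "\<one>\<^bsub>Fun\<^esub> \<in> carrier Fun" by (auto simp: Fun_iff intro!: constr_one lam_closed)
next
  fix \<phi> assume p: "\<phi> \<in> carrier Fun"
  have P: "\<phi> \<in> Y \<rightarrow> carrier E" using p by (auto simp: Fun_iff)
  have ext: "\<phi> \<in> extensional Y" using p by (auto simp: Fun_iff PiE_def)
  show "\<one>\<^bsub>Fun\<^esub> \<otimes>\<^bsub>Fun\<^esub> \<phi> = \<phi>"
    using Fun_val[OF p] by (auto intro!: extensionalityI[OF _ ext])
  let ?i = "\<lambda>y\<in>Y. inv\<^bsub>E\<^esub> (\<phi> y)"
  have I: "?i \<in> Y \<rightarrow> carrier E" using P by auto
  have z: "(\<lambda>y\<in>Y. ?i y \<otimes>\<^bsub>E\<^esub> \<phi> y) = (\<lambda>y\<in>Y. \<one>\<^bsub>E\<^esub>)"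
    using Fun_val[OF p] by (auto intro!: restrict_ext)
  have "constr ?i y = \<one>\<^bsub>E\<^esub>" if y: "y \<in> Y" for y
  proof -
    have "constr (\<lambda>y\<in>Y. \<one>\<^bsub>E\<^esub>) y = \<one>\<^bsub>E\<^esub>" using y by (auto intro!: constr_one lam_closed)
    then have "constr ?i y \<otimes>\<^bsub>E\<^esub> constr \<phi> y = \<one>\<^bsub>E\<^esub>" using constr_mult[OF I P y] z by simp
    moreover have "constr ?i y \<in> carrier E"
      unfolding constr_def using I y by (intro E.finprod_closed) (auto simp: lam_closed c_closed Pi_iff)
    ultimately show ?thesis using p y by (simp add: Fun_iff)
  qed
  then have "?i \<in> carrier Fun" using Fun_val[OF p] by (auto simp: Fun_iff)
  then show "\<exists>\<psi>\<in>carrier Fun. \<psi> \<otimes>\<^bsub>Fun\<^esub> \<phi> = \<one>\<^bsub>Fun\<^esub>" using z by (auto intro!: bexI[of _ ?i])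
qed (auto simp: Fun_val E.m_assoc intro!: restrict_ext)

lemma pull_closed:
  assumes a: "a \<in> carrier A" and p: "\<phi> \<in> carrier Fun" shows "pull a \<phi> \<in> carrier Fun"
proof -
  have v: "ev \<phi> (\<rho> a y) \<in> carrier E" if "y \<in> Y" for y
    using Fun_val[OF p] \<rho>_closed[OF a that] by (cases "\<rho> a y") auto
  have "constr (pull a \<phi>) y = \<one>\<^bsub>E\<^esub>" if y: "y \<in> Y" for y
  proof (cases "\<rho> a y")
    case None
    then show ?thesis using y a by (intro constr_one) (auto simp: pull_def lam_closed lam_\<rho>)
  next
    case (Some w)
    have w: "w \<in> Y" using \<rho>_closed[OF a y Some] .
    have "constr (pull a \<phi>) y = finprod E (\<lambda>q. c q (\<phi> (lam q w))) Q"
      unfolding constr_def using y a Some w Fun_val[OF p]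
      by (intro E.finprod_cong') (auto simp: pull_def lam_closed lam_\<rho> c_closed Pi_iff)
    then show ?thesis using p w by (simp add: Fun_iff constr_def)
  qed
  then show ?thesis using v by (auto simp: Fun_iff pull_def)
qed

lemma Fun_pow: "\<lbrakk>\<phi> \<in> carrier Fun; y \<in> Y\<rbrakk> \<Longrightarrow> (\<phi> [^]\<^bsub>Fun\<^esub> (j::nat)) y = \<phi> y [^]\<^bsub>E\<^esub> j"
  by (induction j) (auto simp: nat_pow_def)

lemma act_module_Fun: "act_module A Fun m pull"
proof -
  interpret F: comm_group Fun by (rule comm_group_Fun)
  have fin: "finite (carrier Fun)"
    using finY finE by (rule finite_subset[rotated, OF finite_PiE]) (auto simp: Fun_iff)
  have h: "pull a \<in> hom Fun Fun" if a: "a \<in> carrier A" for a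
  proof (rule homI)
    fix \<phi> \<psi> assume "\<phi> \<in> carrier Fun" "\<psi> \<in> carrier Fun"
    have "ev (\<phi> \<otimes>\<^bsub>Fun\<^esub> \<psi>) (\<rho> a y) = ev \<phi> (\<rho> a y) \<otimes>\<^bsub>E\<^esub> ev \<psi> (\<rho> a y)" if "y \<in> Y" for y
      using \<rho>_closed[OF a that] by (cases "\<rho> a y") auto
    then show "pull a (\<phi> \<otimes>\<^bsub>Fun\<^esub> \<psi>) = pull a \<phi> \<otimes>\<^bsub>Fun\<^esub> pull a \<psi>"
      by (auto simp: pull_def intro!: restrict_ext)
  qed (rule pull_closed[OF a])
  have mul: "pull (a \<otimes>\<^bsub>A\<^esub> b) \<phi> = pull a (pull b \<phi>)"
    if "a \<in> carrier A" "b \<in> carrier A" "\<phi> \<in> carrier Fun" for a b \<phi>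
  proof -
    note ab = that(1,2)
    have "ev \<phi> (\<rho> (a \<otimes>\<^bsub>A\<^esub> b) y) = ev (pull b \<phi>) (\<rho> a y)" if y: "y \<in> Y" for y
      using \<rho>_mult[OF ab y] \<rho>_closed[OF ab(1) y] by (cases "\<rho> a y") (auto simp: pull_def)
    then show ?thesis unfolding pull_def[of "a \<otimes>\<^bsub>A\<^esub> b"] pull_def[of a] by (auto intro!: restrict_ext)
  qed
  have e: "\<phi> [^]\<^bsub>Fun\<^esub> m = \<one>\<^bsub>Fun\<^esub>" if p: "\<phi> \<in> carrier Fun" for \<phi>
  proof (rule extensionalityI[of _ Y])
    show "\<phi> [^]\<^bsub>Fun\<^esub> m \<in> extensional Y" using F.nat_pow_closed[OF p, of m] by (auto simp: Fun_iff PiE_def)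
  qed (use p Fun_pow Fun_val expE in auto)
  show ?thesis by unfold_locales (use fin h mul e in auto)
qed

abbreviation r where "r f \<equiv> \<rho> (\<tau> f)"

lemma r_comp: "\<lbrakk>f \<in> maps N; g \<in> maps N; y \<in> Y\<rbrakk> \<Longrightarrow> r (g \<circ> f) y = Option.bind (r f y) (r g)"
  by (simp add: \<tau>_comp \<rho>_mult \<tau>_closed)

text \<open>
  A point with a fixer is a point at which a function of level \<open>k\<close> is determined by its faces.
\<close>

definition fixer where
  "fixer k g y \<longleftrightarrow> g \<in> sings k \<and> r g y = r (clip k) y \<and> r g y \<noteq> None"

definition proj :: "nat \<Rightarrow> ('y \<Rightarrow> 'e) \<Rightarrow> 'y \<Rightarrow> 'e" where
  "proj k \<phi> = (\<lambda>y\<in>Y. if \<exists>g. fixer k g y then \<phi> y else \<one>\<^bsub>E\<^esub>)"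

text \<open>
  Whether the faces determine the value at \<open>y\<close> is a property of the \<open>Q\<close>-orbit of \<open>y\<close>. Thus
  setting a function to the neutral element outside such points keeps the conditions on
  functions valid.
\<close>

lemma fixer_lam:
  assumes k: "k \<le> N" and q: "q \<in> Q" and y: "y \<in> Y"
  shows "fixer k g (lam q y) \<longleftrightarrow> fixer k g y"
proof (cases "g \<in> sings k")
  case True
  then have t: "\<tau> g \<in> carrier A" "\<tau> (clip k) \<in> carrier A"
    using k sings_maps maps_mono clip_maps \<tau>_closed by blast+
  have "map_option (lam q) (r g y) = map_option (lam q) (r (clip k) y) \<longleftrightarrow> r g y = r (clip k) y"
    using lam_inj[OF q] \<rho>_closed[OF t(1) y] \<rho>_closed[OF t(2) y]
    by (cases "r g y"; cases "r (clip k) y") (auto dest: inj_onD)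
  then show ?thesis using lam_\<rho>[OF q _ y] t by (simp add: fixer_def)
qed (simp add: fixer_def)

text \<open>
  The chosen function with given faces takes the neutral value wherever the faces leave the
  value open.
\<close>

lemma splitting_Fun:
  assumes k: "1 \<le> k" "k \<le> N"
  shows "splitting Fun (\<lambda>f. pull (\<tau> f)) k (proj k)"
proof -
  have mN: "f \<in> maps N" if "f \<in> maps k" for f using that maps_mono[OF k(2)] by blast
  have e: "clip k \<in> maps k" "clip k \<in> maps N" using clip_maps[of k] k by auto
  have r0: "r (g \<circ> f) y = Option.bind (r f y) (r g)" if "f \<in> maps k" "g \<in> maps k" "y \<in> Y" for f g y
    using r_comp mN that by blast
  have rY: "w \<in> Y" if "f \<in> maps k" "y \<in> Y" "r f y = Some w" for f y w
    using \<rho>_closed \<tau>_closed mN that by blast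
  let ?L = "level Fun (\<lambda>f. pull (\<tau> f)) k"
  have L: "\<phi> \<in> carrier Fun" "\<And>y. y \<in> Y \<Longrightarrow> \<phi> y = ev \<phi> (r (clip k) y)" if "\<phi> \<in> ?L" for \<phi>
  proof -
    show "\<phi> \<in> carrier Fun" using that by (simp add: level_def)
    have "pull (\<tau> (clip k)) \<phi> = \<phi>" using that by (simp add: level_def)
    then show "\<phi> y = ev \<phi> (r (clip k) y)" if "y \<in> Y" for y
      using that by (metis (no_types, lifting) pull_def restrict_apply')
  qed
  show ?thesis
    unfolding splitting_def
  proof (intro ballI conjI impI)
    fix \<phi> assume p: "\<phi> \<in> ?L"
    note pc = L(1)[OF p] and pe = L(2)[OF p]
    have cP: "proj k \<phi> \<in> carrier Fun"
    proof -
      have "constr (proj k \<phi>) y = \<one>\<^bsub>E\<^esub>" if y: "y \<in> Y" for y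
      proof (cases "\<exists>g. fixer k g y")
        case True
        have "constr (proj k \<phi>) y = constr \<phi> y"
          using y True pc fixer_lam[OF k(2) _ y]
          by (intro constr_cong) (auto simp: proj_def lam_closed Fun_iff)
        then show ?thesis using pc y by (simp add: Fun_iff)
      next
        case False
        then show ?thesis using y fixer_lam[OF k(2) _ y] by (intro constr_one) (auto simp: proj_def lam_closed)
      qed
      then show ?thesis using Fun_val[OF pc] by (auto simp: Fun_iff proj_def)
    qed
    have "pull (\<tau> (clip k)) (proj k \<phi>) y = proj k \<phi> y" if y: "y \<in> Y" for y
    proof (cases "r (clip k) y")
      case None
      then show ?thesis using y by (auto simp: pull_def proj_def fixer_def)
    next
      case (Some w)
      have w: "w \<in> Y" using rY[OF e(1) y Some] .
      have "r g w = r g y" if "g \<in> maps k" for g using r0[OF e(1) that y] Some that by simp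
      then have "fixer k g w \<longleftrightarrow> fixer k g y" for g
        using e(1) sings_maps unfolding fixer_def by metis
      then show ?thesis using y w Some pe[OF y] by (simp add: pull_def proj_def)
    qed
    then have "pull (\<tau> (clip k)) (proj k \<phi>) = proj k \<phi>"
      by (intro extensionalityI[of _ Y]) (auto simp: pull_def proj_def)
    then show "proj k \<phi> \<in> ?L" using cP by (simp add: level_def)
    show "same_faces (\<lambda>f. pull (\<tau> f)) k (proj k \<phi>) \<phi>"
      unfolding same_faces_def
    proof
      fix g assume g: "g \<in> sings k"
      note gm = sings_maps[OF g]
      obtain h where h: "h \<in> sings k" "h \<circ> g = g" using sings_absorber[OF k(1) g] by blast
      note hm = sings_maps[OF h(1)]
      have "ev (proj k \<phi>) (r g y) = ev \<phi> (r g y)" if y: "y \<in> Y" for y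
      proof (cases "r g y")
        case (Some w)
        have "r h w = Some w" using r0[OF gm hm y] Some h(2) by simp
        moreover have "r (clip k) w = Some w" using r0[OF gm e(1) y] Some gm by simp
        ultimately have "fixer k h w" using h by (simp add: fixer_def)
        then show ?thesis using Some rY[OF gm y Some] by (auto simp: proj_def)
      qed simp
      then show "pull (\<tau> g) (proj k \<phi>) = pull (\<tau> g) \<phi>" by (auto simp: pull_def intro!: restrict_ext)
    qed
    show "proj k (pull (\<tau> \<sigma>) \<phi>) = pull (\<tau> \<sigma>) (proj k \<phi>)" if s: "\<sigma> \<in> perms k" for \<sigma>
    proof -
      obtain \<theta> where t: "\<theta> \<in> perms k" "\<theta> \<circ> \<sigma> = clip k" "\<sigma> \<circ> \<theta> = clip k" using perms_inverse[OF s] by blast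
      have m: "\<sigma> \<in> maps k" "\<theta> \<in> maps k" using s t perms_maps by blast+
      have "proj k (pull (\<tau> \<sigma>) \<phi>) y = pull (\<tau> \<sigma>) (proj k \<phi>) y" if y: "y \<in> Y" for y
      proof (cases "r \<sigma> y")
        case None
        then show ?thesis using y by (simp add: pull_def proj_def)
      next
        case (Some w)
        have w: "w \<in> Y" using rY[OF m(1) y Some] .
        have ew: "r (clip k) w = Some w" using r0[OF m(1) e(1) y] Some m by simp
        obtain v where v: "r (clip k) y = Some v"
          using r0[OF e(1) m(1) y] Some m by (cases "r (clip k) y") auto
        have "(\<exists>g. fixer k g w) \<longleftrightarrow> (\<exists>g. fixer k g y)"
        proof
          assume "\<exists>g. fixer k g w"
          then obtain g where g: "g \<in> sings k" "r g w = Some w" using ew by (auto simp: fixer_def)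
          have gs: "g \<circ> \<sigma> \<in> sings k" using sings_compL[OF m(1) g(1)] .
          have "r (g \<circ> \<sigma>) y = Some w" using r0[OF m(1) sings_maps[OF g(1)] y] Some g by simp
          then have "r (\<theta> \<circ> (g \<circ> \<sigma>)) y = r (\<theta> \<circ> \<sigma>) y"
            using r0[OF sings_maps[OF gs] m(2) y] r0[OF m(1,2) y] Some by simp
          then have "fixer k (\<theta> \<circ> (g \<circ> \<sigma>)) y"
            using sings_compR[OF m(2) gs] t v by (simp add: fixer_def)
          then show "\<exists>g. fixer k g y" by blast
        next
          assume "\<exists>g. fixer k g y"
          then obtain g where g: "g \<in> sings k" "r g y = Some v" using v by (auto simp: fixer_def)
          have gs: "\<sigma> \<circ> g \<in> sings k" using sings_compR[OF m(1) g(1)] .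
          have gs': "(\<sigma> \<circ> g) \<circ> \<theta> \<in> sings k" using sings_compL[OF m(2) gs] .
          have "r (\<sigma> \<circ> g) y = Some w"
            using r0[OF sings_maps[OF g(1)] m(1) y] r0[OF e(1) m(1) y] g v Some m by simp
          moreover have "((\<sigma> \<circ> g) \<circ> \<theta>) \<circ> \<sigma> = \<sigma> \<circ> g"
            using t(2) sings_maps[OF gs] by (metis comp_assoc maps_clip(1))
          ultimately have "r ((\<sigma> \<circ> g) \<circ> \<theta>) w = Some w"
            using r0[OF m(1) sings_maps[OF gs'] y] Some by simp
          then have "fixer k ((\<sigma> \<circ> g) \<circ> \<theta>) w" using gs' ew by (simp add: fixer_def)
          then show "\<exists>g. fixer k g w" by blast
        qed
        then show ?thesis using y w Some by (simp add: pull_def proj_def)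
      qed
      then show ?thesis by (intro extensionalityI[of _ Y]) (auto simp: pull_def proj_def)
    qed
    show "proj k \<phi> = proj k \<psi>" if q: "\<psi> \<in> ?L" "same_faces (\<lambda>f. pull (\<tau> f)) k \<phi> \<psi>" for \<psi>
    proof -
      have "\<phi> y = \<psi> y" if y: "y \<in> Y" and "fixer k g y" for g y
      proof -
        have g: "g \<in> sings k" "r g y = r (clip k) y" using that by (auto simp: fixer_def)
        have "pull (\<tau> g) \<phi> y = pull (\<tau> g) \<psi> y" using q(2) g(1) by (simp add: same_faces_def)
        then show ?thesis using pe[OF y] L(2)[OF q(1) y] g y by (simp add: pull_def)
      qed
      then show ?thesis by (auto simp: proj_def intro!: restrict_ext)
    qed
  qed
qed

text \<open>
  The faces prescribe the values at all points that have a fixer. Two fixers of the same point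
  prescribe the same value, because singular maps that absorb them can be chosen to commute. The
  function is extended by the neutral value.
\<close>

lemma fills_faces_Fun:
  assumes k: "2 \<le> k" "k \<le> N"
  shows "fills_faces Fun (\<lambda>f. pull (\<tau> f)) k"
  unfolding fills_faces_def
proof (intro allI impI, elim conjE)
  fix \<xi> assume \<xi>c: "\<forall>g\<in>sings k. \<xi> g \<in> carrier Fun"
    and \<xi>e: "\<forall>f\<in>maps k. \<forall>g\<in>sings k. \<xi> (g \<circ> f) = pull (\<tau> f) (\<xi> g)"
  have mN: "f \<in> maps N" if "f \<in> maps k" for f using that maps_mono[OF k(2)] by blast
  have e: "clip k \<in> maps k" by (simp add: clip_maps)
  have r0: "r (g \<circ> f) y = Option.bind (r f y) (r g)" if "f \<in> maps k" "g \<in> maps k" "y \<in> Y" for f g y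
    using r_comp mN that by blast
  have rY: "w \<in> Y" if "f \<in> maps k" "y \<in> Y" "r f y = Some w" for f y w
    using \<rho>_closed \<tau>_closed mN that by blast
  have \<xi>v: "\<xi> g y = ev (\<xi> h) (r g y)" if "g \<in> sings k" "h \<in> sings k" "h \<circ> g = g" "y \<in> Y" for g h y
    using \<xi>e[rule_format, OF sings_maps[OF that(1)] that(2)] that by (simp add: pull_def)
  have wd: "\<xi> g y = \<xi> g' y" if y: "y \<in> Y" and g: "fixer k g y" "fixer k g' y" for g g' y
  proof -
    have s: "g \<in> sings k" "g' \<in> sings k" using g by (auto simp: fixer_def)
    from g obtain w where w: "r g y = Some w" "r g' y = Some w" unfolding fixer_def by force
    obtain h h' where h: "h \<in> sings k" "h' \<in> sings k" "h \<circ> g = g" "h' \<circ> g' = g'" "h \<circ> h' = h' \<circ> h"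
      using sings_commuting_left[OF s k(1)] by blast
    have wY: "w \<in> Y" using rY[OF sings_maps[OF s(1)] y w(1)] .
    have hw: "r h w = Some w"
      using r0[OF sings_maps[OF s(1)] sings_maps[OF h(1)] y] h(3) w(1) by simp
    have hw': "r h' w = Some w"
      using r0[OF sings_maps[OF s(2)] sings_maps[OF h(2)] y] h(4) w(2) by simp
    have "\<xi> g y = \<xi> h w" "\<xi> g' y = \<xi> h' w" using \<xi>v[OF s(1) h(1,3) y] \<xi>v[OF s(2) h(2,4) y] w by simp_all
    moreover have "\<xi> (h' \<circ> h) w = \<xi> h' w" "\<xi> (h \<circ> h') w = \<xi> h w"
      using \<xi>e[rule_format, OF sings_maps[OF h(1)] h(2)] \<xi>e[rule_format, OF sings_maps[OF h(2)] h(1)] hw hw' wY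
      by (simp_all add: pull_def)
    ultimately show ?thesis using h(5) by simp
  qed
  define \<phi> where "\<phi> = (\<lambda>y\<in>Y. if \<exists>g. fixer k g y then \<xi> (SOME g. fixer k g y) y else \<one>\<^bsub>E\<^esub>)"
  have \<phi>: "\<phi> y = \<xi> g y" if "y \<in> Y" "fixer k g y" for g y
  proof -
    have s: "fixer k (SOME g. fixer k g y) y"
      using that(2) by (rule someI[where P = "\<lambda>g. fixer k g y"])
    have "\<exists>g. fixer k g y" using that(2) by blast
    then have "\<phi> y = \<xi> (SOME g. fixer k g y) y" unfolding \<phi>_def using that(1) by simp
    then show ?thesis using wd[OF that(1) s that(2)] by simp
  qed
  have \<phi>1: "\<phi> y = \<one>\<^bsub>E\<^esub>" if "y \<in> Y" "\<not> (\<exists>g. fixer k g y)" for y using that by (simp add: \<phi>_def)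
  have \<phi>E: "\<phi> y \<in> carrier E" if y: "y \<in> Y" for y
  proof (cases "\<exists>g. fixer k g y")
    case True
    then obtain g where "fixer k g y" by blast
    then show ?thesis using \<phi>[OF y] \<xi>c Fun_val y by (auto simp: fixer_def)
  qed (use \<phi>1 y in simp)
  have "constr \<phi> y = \<one>\<^bsub>E\<^esub>" if y: "y \<in> Y" for y
  proof (cases "\<exists>g. fixer k g y")
    case True
    then obtain g where g: "fixer k g y" by blast
    then have gF: "\<xi> g \<in> carrier Fun" using \<xi>c by (simp add: fixer_def)
    have "constr \<phi> y = constr (\<xi> g) y"
      using y gF fixer_lam[OF k(2) _ y] \<phi> g by (intro constr_cong) (auto simp: Fun_iff lam_closed)
    then show ?thesis using gF y by (simp add: Fun_iff)
  next
    case False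
    then show ?thesis using y fixer_lam[OF k(2) _ y] \<phi>1 by (intro constr_one) (auto simp: lam_closed)
  qed
  then have "\<phi> \<in> carrier Fun" using \<phi>E by (auto simp: Fun_iff \<phi>_def)
  moreover have "pull (\<tau> g) \<phi> = \<xi> g" if g: "g \<in> sings k" for g
  proof -
    note gm = sings_maps[OF g]
    obtain h where h: "h \<in> sings k" "h \<circ> g = g" using sings_absorber[OF _ g] k(1) by auto
    have "pull (\<tau> g) \<phi> y = \<xi> g y" if y: "y \<in> Y" for y
    proof (cases "r g y")
      case None
      then show ?thesis using \<xi>v[OF g h y] y by (simp add: pull_def)
    next
      case (Some w)
      have "r h w = Some w" using r0[OF gm sings_maps[OF h(1)] y] Some h(2) by simp
      moreover have "r (clip k) w = Some w" using r0[OF gm e y] Some gm by simp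
      ultimately have "fixer k h w" using h by (simp add: fixer_def)
      then have "\<phi> w = \<xi> h w" using \<phi> rY[OF gm y Some] by blast
      then show ?thesis using \<xi>v[OF g h y] y Some by (simp add: pull_def)
    qed
    moreover have "\<xi> g \<in> extensional Y" using \<xi>c g by (auto simp: Fun_iff PiE_def)
    ultimately show ?thesis by (intro extensionalityI[of _ Y]) (auto simp: pull_def)
  qed
  ultimately show "\<exists>x\<in>carrier Fun. \<forall>g\<in>sings k. pull (\<tau> g) x = \<xi> g" by blast
qed

lemma extensible_Fun: "extensible Fun N (\<lambda>f. pull (\<tau> f))"
  using splitting_Fun fills_faces_Fun by (auto simp: extensible_def)

end

section \<open>Products and copies of modules\<close>

definition copy_group :: "('d \<Rightarrow> 'c) \<Rightarrow> ('d, 'e) monoid_scheme \<Rightarrow> 'c monoid" where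
  "copy_group j D = \<lparr>carrier = j ` carrier D,
     mult = (\<lambda>x y. j (inv_into (carrier D) j x \<otimes>\<^bsub>D\<^esub> inv_into (carrier D) j y)), one = j \<one>\<^bsub>D\<^esub>\<rparr>"

definition copy_act where
  "copy_act j D act a x = j (act a (inv_into (carrier D) j x))"

definition bounded_group :: "nat \<Rightarrow> ('d, 'e) monoid_scheme \<Rightarrow> bool" where
  "bounded_group m D \<longleftrightarrow> comm_group D \<and> finite (carrier D) \<and> (\<forall>x\<in>carrier D. x [^]\<^bsub>D\<^esub> m = \<one>\<^bsub>D\<^esub>)"

lemma bounded_group_copy:
  assumes D: "bounded_group m D" and j: "inj_on j (carrier D)"
  shows "bounded_group m (copy_group j D)"
proof -
  interpret D: comm_group D using D by (simp add: bounded_group_def)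
  let ?D' = "copy_group j D"
  have C: "carrier ?D' = j ` carrier D" by (simp add: copy_group_def)
  have m': "j x \<otimes>\<^bsub>?D'\<^esub> j y = j (x \<otimes>\<^bsub>D\<^esub> y)" if "x \<in> carrier D" "y \<in> carrier D" for x y
    using that j by (simp add: copy_group_def)
  have o': "\<one>\<^bsub>?D'\<^esub> = j \<one>\<^bsub>D\<^esub>" by (simp add: copy_group_def)
  have "comm_group ?D'"
  proof (rule comm_groupI)
    fix x assume "x \<in> carrier ?D'"
    then obtain z where z: "z \<in> carrier D" "x = j z" by (auto simp: C)
    show "\<exists>y\<in>carrier ?D'. y \<otimes>\<^bsub>?D'\<^esub> x = \<one>\<^bsub>?D'\<^esub>"
      by (rule bexI[of _ "j (inv\<^bsub>D\<^esub> z)"]) (use z in \<open>auto simp: C m' o'\<close>)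
  qed (auto simp: C m' o' D.m_ac)
  moreover have "j x [^]\<^bsub>?D'\<^esub> (n::nat) = j (x [^]\<^bsub>D\<^esub> n)" if "x \<in> carrier D" for x n
    using that by (induction n) (simp_all add: o' m')
  ultimately show ?thesis using D by (auto simp: bounded_group_def C o')
qed

lemma bounded_group_prod:
  assumes "bounded_group m D" "bounded_group m E" shows "bounded_group m (D \<times>\<times> E)"
proof -
  interpret D: comm_group D using assms by (simp add: bounded_group_def)
  interpret E: comm_group E using assms by (simp add: bounded_group_def)
  interpret G: group "D \<times>\<times> E" by (rule DirProd_group) unfold_locales
  have "comm_group (D \<times>\<times> E)"
    by (rule G.group_comm_groupI) (auto simp: D.m_comm E.m_comm)
  moreover have "(x, y) [^]\<^bsub>D \<times>\<times> E\<^esub> (n::nat) = (x [^]\<^bsub>D\<^esub> n, y [^]\<^bsub>E\<^esub> n)" for x y n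
    by (induction n) simp_all
  ultimately show ?thesis using assms by (auto simp: bounded_group_def)
qed

lemma act_module_iff:
  "act_module A D m act \<longleftrightarrow> bounded_group m D \<and> (\<forall>a\<in>carrier A. act a \<in> hom D D) \<and>
     (\<forall>a\<in>carrier A. \<forall>b\<in>carrier A. \<forall>x\<in>carrier D. act (a \<otimes>\<^bsub>A\<^esub> b) x = act a (act b x))"
  by (auto simp: act_module_def act_module_axioms_def bounded_group_def)

context map_ext
begin

abbreviation tact :: "('a \<Rightarrow> 'd \<Rightarrow> 'd) \<Rightarrow> (nat \<Rightarrow> nat) \<Rightarrow> 'd \<Rightarrow> 'd" where
  "tact act \<equiv> \<lambda>f. act (\<tau> f)"

definition extensible_module :: "nat \<Rightarrow> ('d, 'e) monoid_scheme \<Rightarrow> ('a \<Rightarrow> 'd \<Rightarrow> 'd) \<Rightarrow> bool" where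
  "extensible_module m D act \<longleftrightarrow> act_module A D m act \<and> extensible D N (tact act)"

definition mark :: "('d, 'e) monoid_scheme \<Rightarrow> ('a \<Rightarrow> 'd \<Rightarrow> 'd) \<Rightarrow> nat \<Rightarrow> (nat \<Rightarrow> nat) set \<Rightarrow> nat" where
  "mark D act k H = card (fixed (tact act) H (level D (tact act) k))"

definition spread :: "('d, 'e) monoid_scheme \<Rightarrow> ('a \<Rightarrow> 'd \<Rightarrow> 'd) \<Rightarrow> nat" where
  "spread D act = card (diffs D (tact act))"

definition faithful :: "('d, 'e) monoid_scheme \<Rightarrow> ('a \<Rightarrow> 'd \<Rightarrow> 'd) \<Rightarrow> bool" where
  "faithful D act \<longleftrightarrow> (\<forall>a\<in>carrier A. \<forall>b\<in>carrier A. a \<noteq> b \<longrightarrow> (\<exists>x\<in>carrier D. act a x \<noteq> act b x))"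

lemma transf_module_extensible: "extensible_module m D act \<Longrightarrow> transf_module D N (tact act)"
  using transf_module_of_act_module by (auto simp: extensible_module_def)

text \<open>
  All invariants are kept when the underlying set is renamed; in this way modules over different
  carrier types can be treated together.
\<close>

lemma extensible_module_copy:
  fixes D :: "('d, 'e) monoid_scheme" and j :: "'d \<Rightarrow> 'c"
  assumes extensible_module: "extensible_module m D act" and j: "inj_on j (carrier D)"
  defines "D' \<equiv> copy_group j D" and "act' \<equiv> copy_act j D act"
  shows "extensible_module m D' act'" "\<lbrakk>k \<le> N; H \<subseteq> perms k\<rbrakk> \<Longrightarrow> mark D' act' k H = mark D act k H" "spread D' act' = spread D act"
    "card (carrier D') = card (carrier D)" "faithful D act \<Longrightarrow> faithful D' act'"
proof -
  interpret D: act_module A D m act using extensible_module by (simp add: extensible_module_def)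
  let ?i = "inv_into (carrier D) j"
  have i [simp]: "?i (j x) = x" if "x \<in> carrier D" for x using j that by simp
  have C: "carrier D' = j ` carrier D" by (simp add: D'_def copy_group_def)
  have m': "j x \<otimes>\<^bsub>D'\<^esub> j y = j (x \<otimes>\<^bsub>D\<^esub> y)" if "x \<in> carrier D" "y \<in> carrier D" for x y
    using that by (simp add: D'_def copy_group_def)
  have o': "\<one>\<^bsub>D'\<^esub> = j \<one>\<^bsub>D\<^esub>" by (simp add: D'_def copy_group_def)
  have ji: "j x = j y \<longleftrightarrow> x = y" if "x \<in> carrier D" "y \<in> carrier D" for x y
    using that j by (auto dest: inj_onD)
  have a': "act' a (j x) = j (act a x)" if "x \<in> carrier D" for a x
    using that by (simp add: act'_def copy_act_def)
  have ac: "act a x \<in> carrier D" if "a \<in> carrier A" "x \<in> carrier D" for a x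
    using D.act_hom that by (auto simp: hom_def)
  have bg': "bounded_group m D'"
    unfolding D'_def by (rule bounded_group_copy[OF _ j]) (use extensible_module in \<open>simp add: extensible_module_def act_module_iff\<close>)
  interpret D': comm_group D' using bg' by (simp add: bounded_group_def)
  have inv': "inv\<^bsub>D'\<^esub> (j x) = j (inv\<^bsub>D\<^esub> x)" if "x \<in> carrier D" for x
    by (rule D'.inv_equality) (use that in \<open>auto simp: C m' o'\<close>)
  have am: "act_module A D' m act'"
    unfolding act_module_iff
  proof (intro conjI ballI bg')
    show "act' a \<in> hom D' D'" if "a \<in> carrier A" for a
    proof (rule homI)
      show "act' a x \<in> carrier D'" if "x \<in> carrier D'" for x
        using that \<open>a \<in> carrier A\<close> by (auto simp: C a' ac)
      show "act' a (x \<otimes>\<^bsub>D'\<^esub> y) = act' a x \<otimes>\<^bsub>D'\<^esub> act' a y" if "x \<in> carrier D'" "y \<in> carrier D'" for x y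
        using that hom_mult[OF D.act_hom[OF \<open>a \<in> carrier A\<close>]] \<open>a \<in> carrier A\<close>
        by (auto simp: C a' m' ac)
    qed
    show "act' (a \<otimes> b) x = act' a (act' b x)" if "a \<in> carrier A" "b \<in> carrier A" "x \<in> carrier D'" for a b x
      using that by (auto simp: C a' ac D.act_comp)
  qed
  have t: "\<tau> f \<in> carrier A" if "f \<in> maps k" "k \<le> N" for f k
    using that maps_mono \<tau>_closed by blast
  have lev: "level D' (tact act') k = j ` level D (tact act) k" if "k \<le> N" for k
    using t[OF clip_maps[OF order_refl] that] by (auto simp: level_def C a' ac ji)
  have levc: "x \<in> carrier D" if "x \<in> level D (tact act) k" for x k using that by (simp add: level_def)
  have sf: "same_faces (tact act') k (j x) (j y) \<longleftrightarrow> same_faces (tact act) k x y"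
    if "k \<le> N" "x \<in> carrier D" "y \<in> carrier D" for k x y
    using that t[OF sings_maps that(1)] by (simp add: same_faces_def a' ac ji)
  have "\<exists>\<pi>. splitting D' (tact act') k \<pi>" if k: "1 \<le> k" "k \<le> N" for k
  proof -
    obtain \<pi> where p: "splitting D (tact act) k \<pi>" using extensible_module k by (auto simp: extensible_module_def extensible_def)
    have pL: "\<pi> x \<in> level D (tact act) k" "same_faces (tact act) k (\<pi> x) x" if "x \<in> level D (tact act) k" for x
      using p that by (auto simp: splitting_def)
    have pc: "\<pi> x \<in> carrier D" if "x \<in> level D (tact act) k" for x using pL[OF that] levc by blast
    have "splitting D' (tact act') k (\<lambda>x. j (\<pi> (?i x)))"
      unfolding splitting_def lev[OF k(2)]
    proof (clarsimp simp: levc pL sf[OF k(2)] pc, intro conjI ballI impI)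
      fix x \<sigma> assume x: "x \<in> level D (tact act) k" and s: "\<sigma> \<in> perms k"
      have "\<pi> (act (\<tau> \<sigma>) x) = act (\<tau> \<sigma>) (\<pi> x)" using p x s by (auto simp: splitting_def)
      then show "j (\<pi> (?i (act' (\<tau> \<sigma>) (j x)))) = act' (\<tau> \<sigma>) (j (\<pi> x))"
        using x s t[OF perms_maps k(2)] by (simp add: a' ac levc pc)
    next
      fix x y assume "x \<in> level D (tact act) k" "y \<in> level D (tact act) k" "same_faces (tact act) k x y"
      then show "j (\<pi> x) = j (\<pi> y)" using p by (metis splitting_def)
    qed
    then show ?thesis by blast
  qed
  moreover have "fills_faces D' (tact act') k" if k: "2 \<le> k" "k \<le> N" for k
    unfolding fills_faces_def
  proof (intro allI impI, elim conjE)
    fix \<xi> assume c: "\<forall>g\<in>sings k. \<xi> g \<in> carrier D'"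
      and e: "\<forall>f\<in>maps k. \<forall>g\<in>sings k. \<xi> (g \<circ> f) = act' (\<tau> f) (\<xi> g)"
    have ic: "?i (\<xi> g) \<in> carrier D" "j (?i (\<xi> g)) = \<xi> g" if "g \<in> sings k" for g
      using c that by (auto simp: C f_inv_into_f inv_into_into)
    have "?i (\<xi> (g \<circ> f)) = act (\<tau> f) (?i (\<xi> g))" if "f \<in> maps k" "g \<in> sings k" for f g
      using e that ic[OF that(2)] t[OF that(1) k(2)] by (metis a' ac i)
    then have "\<exists>x\<in>carrier D. \<forall>g\<in>sings k. act (\<tau> g) x = ?i (\<xi> g)"
      using extensible_module k ic unfolding extensible_module_def extensible_def fills_faces_def by auto
    then obtain x where "x \<in> carrier D" "\<forall>g\<in>sings k. act (\<tau> g) x = ?i (\<xi> g)" by blast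
    then show "\<exists>x\<in>carrier D'. \<forall>g\<in>sings k. act' (\<tau> g) x = \<xi> g"
      using ic(2) by (intro bexI[of _ "j x"]) (auto simp: C a')
  qed
  ultimately show "extensible_module m D' act'" using am by (auto simp: extensible_module_def extensible_def)
  have injL: "inj_on j X" if "X \<subseteq> carrier D" for X using j that inj_on_subset by blast
  show "card (carrier D') = card (carrier D)" using j by (simp add: C card_image)
  show "spread D' act' = spread D act"
  proof -
    have t01: "\<tau> (clip 0) \<in> carrier A" "\<tau> (\<lambda>_. 1) \<in> carrier A"
      using clip_maps[of 0 N] const1_maps[OF N1] \<tau>_closed by auto
    have "diffs D' (tact act') = j ` diffs D (tact act)"
      unfolding diffs_def Setcompr_eq_image C image_image
      using t01 by (intro image_cong) (auto simp: a' ac inv' m')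
    moreover have "diffs D (tact act) \<subseteq> carrier D" using t01 by (auto simp: diffs_def ac)
    ultimately show ?thesis using injL by (simp add: spread_def card_image)
  qed
  show "faithful D' act'" if "faithful D act"
    using that by (auto simp: faithful_def C a' ac ji)
  show "mark D' act' k H = mark D act k H" if k: "k \<le> N" and H: "H \<subseteq> perms k"
  proof -
    have "act' (\<tau> h) (j x) = j x \<longleftrightarrow> act (\<tau> h) x = x" if "h \<in> H" "x \<in> level D (tact act) k" for h x
      using that t[OF perms_maps k] H levc by (auto simp: a' ac ji)
    then have "fixed (tact act') H (level D' (tact act') k) = j ` fixed (tact act) H (level D (tact act) k)"
      unfolding lev[OF k] fixed_def by blast
    moreover have "fixed (tact act) H (level D (tact act) k) \<subseteq> carrier D"
      using levc by (auto simp: fixed_def)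
    ultimately show ?thesis using injL by (simp add: mark_def card_image)
  qed
qed

lemma act_module_prod:
  assumes "act_module A D m a1" "act_module A E m a2"
  shows "act_module A (D \<times>\<times> E) m (\<lambda>a. map_prod (a1 a) (a2 a))"
proof -
  interpret D: act_module A D m a1 by fact
  interpret E: act_module A E m a2 by fact
  have "bounded_group m (D \<times>\<times> E)" using assms by (simp add: act_module_iff bounded_group_prod)
  then show ?thesis
    unfolding act_module_iff using D.act_hom E.act_hom
    by (auto simp: D.act_comp E.act_comp hom_def Pi_iff)
qed

lemma level_prod: "level (D \<times>\<times> E) (tact (\<lambda>a. map_prod (a1 a) (a2 a))) k = level D (tact a1) k \<times> level E (tact a2) k"
  by (auto simp: level_def)

lemma mark_prod: "mark (D \<times>\<times> E) (\<lambda>a. map_prod (a1 a) (a2 a)) k H = mark D a1 k H * mark E a2 k H"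
proof -
  have "fixed (tact (\<lambda>a. map_prod (a1 a) (a2 a))) H (level D (tact a1) k \<times> level E (tact a2) k) =
      fixed (tact a1) H (level D (tact a1) k) \<times> fixed (tact a2) H (level E (tact a2) k)"
    by (auto simp: fixed_def)
  then show ?thesis unfolding mark_def level_prod by (simp add: card_cartesian_product)
qed

lemma spread_prod:
  assumes "act_module A D m a1" "act_module A E m a2"
  shows "spread (D \<times>\<times> E) (\<lambda>a. map_prod (a1 a) (a2 a)) = spread D a1 * spread E a2"
proof -
  interpret D: act_module A D m a1 by fact
  interpret E: act_module A E m a2 by fact
  have t01: "\<tau> (clip 0) \<in> carrier A" "\<tau> (\<lambda>_. 1) \<in> carrier A"
    using clip_maps[of 0 N] const1_maps[OF N1] \<tau>_closed by auto
  have c: "a1 a x \<in> carrier D" if "a \<in> carrier A" "x \<in> carrier D" for a x using D.act_hom that by (auto simp: hom_def)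
  have c': "a2 a x \<in> carrier E" if "a \<in> carrier A" "x \<in> carrier E" for a x using E.act_hom that by (auto simp: hom_def)
  have "diffs (D \<times>\<times> E) (tact (\<lambda>a. map_prod (a1 a) (a2 a))) = diffs D (tact a1) \<times> diffs E (tact a2)"
  proof -
    have "inv\<^bsub>D \<times>\<times> E\<^esub> (x, y) = (inv\<^bsub>D\<^esub> x, inv\<^bsub>E\<^esub> y)" if "x \<in> carrier D" "y \<in> carrier E" for x y
      using that by (intro inv_DirProd) (unfold_locales, auto)
    then have "diffs (D \<times>\<times> E) (tact (\<lambda>a. map_prod (a1 a) (a2 a))) =
        (\<lambda>z. (a1 (\<tau> (clip 0)) (fst z) \<otimes>\<^bsub>D\<^esub> inv\<^bsub>D\<^esub> (a1 (\<tau> (\<lambda>_. 1)) (fst z)),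
          a2 (\<tau> (clip 0)) (snd z) \<otimes>\<^bsub>E\<^esub> inv\<^bsub>E\<^esub> (a2 (\<tau> (\<lambda>_. 1)) (snd z)))) ` (carrier D \<times> carrier E)"
      unfolding diffs_def Setcompr_eq_image using t01 by (intro image_cong) (auto simp: c c')
    then show ?thesis unfolding diffs_def Setcompr_eq_image by (auto simp: image_iff)
  qed
  then show ?thesis by (simp add: spread_def card_cartesian_product)
qed

lemma extensible_module_prod:
  assumes "extensible_module m D a1" "extensible_module m E a2"
  shows "extensible_module m (D \<times>\<times> E) (\<lambda>a. map_prod (a1 a) (a2 a))"
proof -
  let ?P = "D \<times>\<times> E" and ?a = "tact (\<lambda>a. map_prod (a1 a) (a2 a))"
  have sf: "same_faces ?a k (x, y) (x', y') \<longleftrightarrow> same_faces (tact a1) k x x' \<and> same_faces (tact a2) k y y'" for k x y x' y'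
    by (auto simp: same_faces_def)
  have "\<exists>\<pi>. splitting ?P ?a k \<pi>" if k: "1 \<le> k" "k \<le> N" for k
  proof -
    obtain p where p: "splitting D (tact a1) k p" using assms k by (auto simp: extensible_module_def extensible_def)
    obtain q where q: "splitting E (tact a2) k q" using assms k by (auto simp: extensible_module_def extensible_def)
    have "splitting ?P ?a k (map_prod p q)"
      using p q unfolding splitting_def level_prod by (auto simp: sf)
    then show ?thesis by blast
  qed
  moreover have "fills_faces ?P ?a k" if k: "2 \<le> k" "k \<le> N" for k
    unfolding fills_faces_def
  proof (intro allI impI, elim conjE)
    fix \<xi> assume c: "\<forall>g\<in>sings k. \<xi> g \<in> carrier ?P"
      and e: "\<forall>f\<in>maps k. \<forall>g\<in>sings k. \<xi> (g \<circ> f) = map_prod (a1 (\<tau> f)) (a2 (\<tau> f)) (\<xi> g)"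
    have ff: "fills_faces D (tact a1) k" "fills_faces E (tact a2) k"
      using assms k by (auto simp: extensible_module_def extensible_def)
    have "\<exists>x\<in>carrier D. \<forall>g\<in>sings k. a1 (\<tau> g) x = fst (\<xi> g)"
      using ff(1)[unfolded fills_faces_def, rule_format, of "\<lambda>g. fst (\<xi> g)"] c e by (auto simp: mem_Times_iff)
    moreover have "\<exists>y\<in>carrier E. \<forall>g\<in>sings k. a2 (\<tau> g) y = snd (\<xi> g)"
      using ff(2)[unfolded fills_faces_def, rule_format, of "\<lambda>g. snd (\<xi> g)"] c e by (auto simp: mem_Times_iff)
    ultimately obtain x y where "x \<in> carrier D" "\<forall>g\<in>sings k. a1 (\<tau> g) x = fst (\<xi> g)"
      "y \<in> carrier E" "\<forall>g\<in>sings k. a2 (\<tau> g) y = snd (\<xi> g)" by blast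
    then show "\<exists>x\<in>carrier ?P. \<forall>g\<in>sings k. map_prod (a1 (\<tau> g)) (a2 (\<tau> g)) x = \<xi> g"
      by (intro bexI[of _ "(x, y)"]) auto
  qed
  ultimately show ?thesis using act_module_prod assms by (auto simp: extensible_module_def extensible_def)
qed

lemma faithful_prod:
  assumes "faithful D a1" "act_module A E m a2"
  shows "faithful (D \<times>\<times> E) (\<lambda>a. map_prod (a1 a) (a2 a))"
proof -
  interpret E: act_module A E m a2 by fact
  show ?thesis
    unfolding faithful_def
  proof (intro ballI impI)
    fix a b assume "a \<in> carrier A" "b \<in> carrier A" "a \<noteq> b"
    then obtain x where "x \<in> carrier D" "a1 a x \<noteq> a1 b x" using assms(1) by (auto simp: faithful_def)
    then show "\<exists>z\<in>carrier (D \<times>\<times> E). map_prod (a1 a) (a2 a) z \<noteq> map_prod (a1 b) (a2 b) z"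
      by (intro bexI[of _ "(x, \<one>\<^bsub>E\<^esub>)"]) auto
  qed
qed

end

section \<open>Unit groups of corners\<close>

text \<open>These are the functions on the set of left cosets of \<open>H\<close>.\<close>

lemma (in group) card_coset_invariant_functions:
  assumes H: "subgroup H G" and fG: "finite (carrier G)" and fV: "finite V"
  shows "card {\<chi> \<in> carrier G \<rightarrow>\<^sub>E V. \<forall>g\<in>carrier G. \<forall>h\<in>H. \<chi> (g \<otimes> h) = \<chi> g} =
    card V ^ (card (carrier G) div card H)"
proof -
  interpret H: subgroup H G by fact
  let ?r = "rcong H"
  let ?I = "{\<chi> \<in> carrier G \<rightarrow>\<^sub>E V. \<forall>g\<in>carrier G. \<forall>h\<in>H. \<chi> (g \<otimes> h) = \<chi> g}"
  have eq: "equiv (carrier G) ?r" by (rule H.equiv_rcong) (rule group_axioms)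
  have r: "(x, y) \<in> ?r \<longleftrightarrow> x \<in> carrier G \<and> y \<in> carrier G \<and> inv x \<otimes> y \<in> H" for x y
    by (auto simp: r_congruent_def)
  have cl: "card C = card H" if "C \<in> carrier G // ?r" for C
  proof -
    from that obtain x where x: "x \<in> carrier G" "C = ?r `` {x}" by (auto simp: quotient_def)
    have "bij_betw (\<lambda>h. x \<otimes> h) H C"
      by (rule bij_betw_byWitness[where f' = "\<lambda>y. inv x \<otimes> y"])
        (use x H.mem_carrier in \<open>auto simp: r m_assoc[symmetric]\<close>)
    then show ?thesis using bij_betw_same_card by metis
  qed
  have fQ: "finite (carrier G // ?r)" using fG by (auto simp: quotient_def)
  have "card H * card (carrier G // ?r) = card (\<Union>(carrier G // ?r))"
  proof (rule card_partition)
    show "c1 \<inter> c2 = {}" if "c1 \<in> carrier G // ?r" "c2 \<in> carrier G // ?r" "c1 \<noteq> c2" for c1 c2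
      using quotient_disj[OF eq that(1,2)] that(3) by blast
  qed (use fQ fG cl Union_quotient[OF eq] in auto)
  moreover have "card H > 0" using H.one_closed fG H.subset finite_subset card_gt_0_iff by blast
  ultimately have q: "card (carrier G // ?r) = card (carrier G) div card H"
    using Union_quotient[OF eq] by (metis nonzero_mult_div_cancel_left less_numeral_extra(3))
  have "bij_betw (\<lambda>f. \<lambda>g\<in>carrier G. f (?r `` {g})) ((carrier G // ?r) \<rightarrow>\<^sub>E V) ?I"
  proof (rule bij_betw_byWitness[where f' = "\<lambda>\<chi>. \<lambda>C\<in>carrier G // ?r. \<chi> (SOME g. g \<in> C)"])
    have some: "(SOME g. g \<in> C) \<in> C" "(SOME g. g \<in> C) \<in> carrier G" if "C \<in> carrier G // ?r" for C
    proof -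
      show "(SOME g. g \<in> C) \<in> C" using that in_quotient_imp_non_empty[OF eq that] by (simp add: some_in_eq)
      then show "(SOME g. g \<in> C) \<in> carrier G" using that in_quotient_imp_subset[OF eq that] by blast
    qed
    have cls: "?r `` {SOME g. g \<in> C} = C" if "C \<in> carrier G // ?r" for C
    proof -
      from that obtain x where x: "C = ?r `` {x}" by (auto simp: quotient_def)
      then have "(x, SOME g. g \<in> C) \<in> ?r" using some(1)[OF that] by blast
      then show ?thesis using equiv_class_eq[OF eq] x by metis
    qed
    show "\<forall>f\<in>(carrier G // ?r) \<rightarrow>\<^sub>E V.
        (\<lambda>C\<in>carrier G // ?r. (\<lambda>g\<in>carrier G. f (?r `` {g})) (SOME g. g \<in> C)) = f"
    proof
      fix f assume "f \<in> (carrier G // ?r) \<rightarrow>\<^sub>E V"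
      then show "(\<lambda>C\<in>carrier G // ?r. (\<lambda>g\<in>carrier G. f (?r `` {g})) (SOME g. g \<in> C)) = f"
        using some cls by (intro extensionalityI[of _ "carrier G // ?r"]) (auto simp: PiE_def)
    qed
    have inv: "\<chi> x = \<chi> y" if "\<chi> \<in> ?I" "(x, y) \<in> ?r" for \<chi> x y
    proof -
      have "\<chi> (x \<otimes> (inv x \<otimes> y)) = \<chi> x" using that by (auto simp: r)
      then show ?thesis using that(2) by (simp add: r m_assoc[symmetric])
    qed
    have self: "((SOME y. y \<in> ?r `` {g}), g) \<in> ?r" if "g \<in> carrier G" for g
    proof -
      have "(g, SOME y. y \<in> ?r `` {g}) \<in> ?r" using some(1)[OF quotientI[OF that, of ?r]] by blast
      then show ?thesis using eq unfolding equiv_def sym_def by blast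
    qed
    show "\<forall>\<chi>\<in>?I. (\<lambda>g\<in>carrier G. (\<lambda>C\<in>carrier G // ?r. \<chi> (SOME g. g \<in> C)) (?r `` {g})) = \<chi>"
    proof
      fix \<chi> assume \<chi>: "\<chi> \<in> ?I"
      show "(\<lambda>g\<in>carrier G. (\<lambda>C\<in>carrier G // ?r. \<chi> (SOME g. g \<in> C)) (?r `` {g})) = \<chi>"
      proof (rule extensionalityI[of _ "carrier G"])
        fix g assume g: "g \<in> carrier G"
        show "(\<lambda>g\<in>carrier G. (\<lambda>C\<in>carrier G // ?r. \<chi> (SOME g. g \<in> C)) (?r `` {g})) g = \<chi> g"
          using inv[OF \<chi> self[OF g]] g quotientI[OF g, of ?r] by simp
      qed (use \<chi> in \<open>auto simp: PiE_def\<close>)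
    qed
    show "(\<lambda>f. \<lambda>g\<in>carrier G. f (?r `` {g})) ` ((carrier G // ?r) \<rightarrow>\<^sub>E V) \<subseteq> ?I"
    proof (rule image_subsetI)
      fix f assume f: "f \<in> (carrier G // ?r) \<rightarrow>\<^sub>E V"
      have "f (?r `` {g}) \<in> V" if "g \<in> carrier G" for g using f quotientI[OF that, of ?r] by auto
      moreover have "f (?r `` {g \<otimes> h}) = f (?r `` {g})" if gh: "g \<in> carrier G" "h \<in> H" for g h
      proof -
        have "(g, g \<otimes> h) \<in> ?r" using gh H.mem_carrier by (auto simp: r m_assoc[symmetric])
        then show ?thesis using equiv_class_eq[OF eq] by metis
      qed
      ultimately show "(\<lambda>g\<in>carrier G. f (?r `` {g})) \<in> ?I" using H.mem_carrier by auto
    qed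
    show "(\<lambda>\<chi>. \<lambda>C\<in>carrier G // ?r. \<chi> (SOME g. g \<in> C)) ` ?I \<subseteq> (carrier G // ?r) \<rightarrow>\<^sub>E V"
      using some by fastforce
  qed
  then have "card ?I = card ((carrier G // ?r) \<rightarrow>\<^sub>E V)" by (rule bij_betw_same_card[symmetric])
  also have "\<dots> = card V ^ card (carrier G // ?r)" by (rule card_funcsetE[OF fQ])
  finally show ?thesis using q by simp
qed

lemma (in monoid) finite_inverse_comm:
  assumes "finite (carrier G)" and uv: "u \<in> carrier G" "v \<in> carrier G" "u \<otimes> v = \<one>"
  shows "v \<otimes> u = \<one>"
proof -
  have "inj_on (\<lambda>x. v \<otimes> x) (carrier G)"
  proof (rule inj_onI)
    fix x y assume xy: "x \<in> carrier G" "y \<in> carrier G" "v \<otimes> x = v \<otimes> y"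
    then have "u \<otimes> (v \<otimes> x) = u \<otimes> (v \<otimes> y)" by simp
    then have "(u \<otimes> v) \<otimes> x = (u \<otimes> v) \<otimes> y" by (simp only: m_assoc xy(1,2) uv(1,2))
    then show "x = y" using xy(1,2) uv(3) by simp
  qed
  then have "(\<lambda>x. v \<otimes> x) ` carrier G = carrier G"
    using assms(1) uv by (intro endo_inj_surj) auto
  then obtain w where w: "w \<in> carrier G" "v \<otimes> w = \<one>" using one_closed by (metis imageE)
  then have "u = u \<otimes> (v \<otimes> w)" using uv by simp
  also have "\<dots> = (u \<otimes> v) \<otimes> w" by (simp only: m_assoc uv(1,2) w(1))
  also have "\<dots> = w" using uv w by simp
  finally show ?thesis using w by simp
qed

lemma hom_finprod_comm_group:
  assumes "comm_group G" "comm_group H" and f: "f \<in> hom G H" and g: "g \<in> A \<rightarrow> carrier G"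
  shows "f (finprod G g A) = finprod H (\<lambda>a. f (g a)) A"
proof -
  interpret G: comm_group G by fact
  interpret H: comm_group H by fact
  interpret group_hom G H f by unfold_locales (rule f)
  show ?thesis
  proof (cases "finite A")
    case True
    then show ?thesis using g
    proof (induction A rule: finite_induct)
      case (insert a A)
      have "f (finprod G g (insert a A)) = f (g a) \<otimes>\<^bsub>H\<^esub> f (finprod G g A)"
        using insert by (simp add: Pi_iff)
      then show ?case using insert by (simp add: Pi_iff)
    qed simp
  qed (simp add: G.finprod_infinite H.finprod_infinite)
qed

lemma bounded_subgroup:
  assumes "bounded_group m D" "subgroup H D" shows "bounded_group m (D\<lparr>carrier := H\<rparr>)"
proof -
  interpret D: comm_group D using assms by (simp add: bounded_group_def)
  interpret H: subgroup H D by fact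
  have g: "group (D\<lparr>carrier := H\<rparr>)" by (rule H.subgroup_is_group) unfold_locales
  have "comm_group (D\<lparr>carrier := H\<rparr>)"
    by (rule group.group_comm_groupI[OF g]) (auto simp: D.m_comm)
  moreover have "x [^]\<^bsub>D\<lparr>carrier := H\<rparr>\<^esub> (n::nat) = x [^]\<^bsub>D\<^esub> n" for x n
    by (induction n) simp_all
  ultimately show ?thesis
    using assms(1) H.subset finite_subset by (auto simp: bounded_group_def)
qed

context map_ext
begin

definition idem :: "nat \<Rightarrow> 'a" where "idem k = \<tau> (clip k)"

definition corner :: "nat \<Rightarrow> 'a monoid" where
  "corner k = \<lparr>carrier = {x \<in> carrier A. idem k \<otimes> x = x \<and> x \<otimes> idem k = x}, mult = mult A, one = idem k\<rparr>"

text \<open>Green's \<open>\<R>\<close>-class of the idempotent \<open>idem k\<close>.\<close>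

definition rclass :: "nat \<Rightarrow> 'a set" where
  "rclass k = {y \<in> carrier A. idem k \<otimes> y = y \<and> (\<exists>b\<in>carrier A. y \<otimes> b = idem k)}"

text \<open>
  Right multiplication on an \<open>\<R>\<close>-class is a partial act: once a product has left the class it
  cannot return.
\<close>

definition \<rho>R :: "nat \<Rightarrow> 'a \<Rightarrow> 'a \<Rightarrow> 'a option" where
  "\<rho>R k a y = (if y \<otimes> a \<in> rclass k then Some (y \<otimes> a) else None)"

lemma corner_simps [simp]:
  "carrier (corner k) = {x \<in> carrier A. idem k \<otimes> x = x \<and> x \<otimes> idem k = x}"
  "mult (corner k) = mult A" "one (corner k) = idem k"
  by (simp_all add: corner_def)

lemma idem_closed: "k \<le> N \<Longrightarrow> idem k \<in> carrier A"
  by (simp add: idem_def \<tau>_closed clip_maps)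

lemma idem_idem: "k \<le> N \<Longrightarrow> idem k \<otimes> idem k = idem k"
  using \<tau>_comp[of "clip k" "clip k"] by (simp add: idem_def clip_maps clip_clip)

lemma idem_maps:
  "\<lbrakk>k \<le> N; f \<in> maps k\<rbrakk> \<Longrightarrow> idem k \<otimes> \<tau> f = \<tau> f" "\<lbrakk>k \<le> N; f \<in> maps k\<rbrakk> \<Longrightarrow> \<tau> f \<otimes> idem k = \<tau> f"
  using \<tau>_comp[of "clip k" f] \<tau>_comp[of f "clip k"] maps_mono[of k N]
  by (auto simp: idem_def clip_maps)

lemma maps_corner: "\<lbrakk>k \<le> N; f \<in> maps k\<rbrakk> \<Longrightarrow> \<tau> f \<in> carrier (corner k)"
  using idem_maps \<tau>_closed maps_mono[of k N] by auto

lemma monoid_corner: "k \<le> N \<Longrightarrow> monoid (corner k)"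
proof (rule monoidI)
  fix x y assume k: "k \<le> N" and "x \<in> carrier (corner k)" "y \<in> carrier (corner k)"
  then show "x \<otimes>\<^bsub>corner k\<^esub> y \<in> carrier (corner k)"
    using idem_closed[OF k] by (simp add: m_closed) (metis m_assoc)
qed (auto simp: idem_closed idem_idem m_assoc)

lemma finite_corner: "finite (carrier (corner k))"
  using finA by simp

lemma units_rclass: "k \<le> N \<Longrightarrow> Units (corner k) \<subseteq> rclass k"
  by (auto simp: Units_def rclass_def)

lemma rclass_units:
  assumes k: "k \<le> N" and y: "y \<in> rclass k" "y \<otimes> idem k = y"
  shows "y \<in> Units (corner k)"
proof -
  interpret M: monoid "corner k" using monoid_corner[OF k] .
  obtain b where b: "b \<in> carrier A" "y \<otimes> b = idem k" and yc: "y \<in> carrier (corner k)"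
    using y by (auto simp: rclass_def)
  note e = idem_closed[OF k] idem_idem[OF k]
  let ?b = "idem k \<otimes> b \<otimes> idem k"
  have bc: "?b \<in> carrier (corner k)" using b(1) e by (simp add: m_closed m_assoc) (metis m_assoc m_closed)
  have "y \<otimes> ?b = idem k" using b e yc by (simp add: m_assoc[symmetric] m_closed)
  then have "y \<otimes>\<^bsub>corner k\<^esub> ?b = \<one>\<^bsub>corner k\<^esub>" by simp
  then show ?thesis
    using M.finite_inverse_comm[OF finite_corner yc bc] yc bc unfolding Units_def by blast
qed

lemma rclass_carrier: "y \<in> rclass k \<Longrightarrow> y \<in> carrier A"
  by (simp add: rclass_def)

lemma unit_mult_rclass:
  assumes k: "k \<le> N" and q: "q \<in> Units (corner k)" and y: "y \<in> rclass k"
  shows "q \<otimes> y \<in> rclass k"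
proof -
  obtain p where p: "p \<in> carrier A" "q \<otimes> p = idem k" "idem k \<otimes> p = p" using q by (auto simp: Units_def)
  have q': "q \<in> carrier A" "idem k \<otimes> q = q" "q \<otimes> idem k = q" using q by (auto simp: Units_def)
  obtain b where b: "b \<in> carrier A" "y \<otimes> b = idem k" using y by (auto simp: rclass_def)
  note yc = rclass_carrier[OF y] and e = idem_closed[OF k]
  have "(q \<otimes> y) \<otimes> (b \<otimes> p) = q \<otimes> ((y \<otimes> b) \<otimes> p)"
    by (simp only: m_assoc m_closed yc b(1) q'(1) p(1))
  then have "(q \<otimes> y) \<otimes> (b \<otimes> p) = idem k" using b p by simp
  moreover have "idem k \<otimes> (q \<otimes> y) = q \<otimes> y" using q' yc e by (simp add: m_assoc[symmetric])
  ultimately show ?thesis using b p q' yc by (auto simp: rclass_def m_closed)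
qed

lemma rclass_prefix:
  assumes k: "k \<le> N" and y: "y \<in> rclass k" and ab: "a \<in> carrier A" "b \<in> carrier A" "y \<otimes> (a \<otimes> b) \<in> rclass k"
  shows "y \<otimes> a \<in> rclass k"
proof -
  obtain c where c: "c \<in> carrier A" "y \<otimes> (a \<otimes> b) \<otimes> c = idem k" using ab by (auto simp: rclass_def)
  note yc = rclass_carrier[OF y]
  have "(y \<otimes> a) \<otimes> (b \<otimes> c) = idem k" using c ab yc by (simp add: m_assoc m_closed)
  moreover have "idem k \<otimes> (y \<otimes> a) = y \<otimes> a"
    using y ab idem_closed[OF k] by (simp add: rclass_def m_assoc[symmetric])
  ultimately show ?thesis using c ab yc by (auto simp: rclass_def m_closed)
qed

lemma perms_units: "\<lbrakk>k \<le> N; \<sigma> \<in> perms k\<rbrakk> \<Longrightarrow> \<tau> \<sigma> \<in> Units (corner k)"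
proof -
  assume k: "k \<le> N" and s: "\<sigma> \<in> perms k"
  obtain \<theta> where t: "\<theta> \<in> perms k" "\<theta> \<circ> \<sigma> = clip k" "\<sigma> \<circ> \<theta> = clip k" using perms_inverse[OF s] by blast
  have m: "\<sigma> \<in> maps k" "\<theta> \<in> maps k" using s t perms_maps by blast+
  have "\<tau> \<sigma> \<otimes> \<tau> \<theta> = idem k" "\<tau> \<theta> \<otimes> \<tau> \<sigma> = idem k"
    using \<tau>_comp[of \<sigma> \<theta>] \<tau>_comp[of \<theta> \<sigma>] t subsetD[OF maps_mono[OF k] m(1)] subsetD[OF maps_mono[OF k] m(2)]
    by (simp_all add: idem_def)
  then show ?thesis using maps_corner[OF k m(1)] maps_corner[OF k m(2)] unfolding Units_def by auto
qed

text \<open>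
  If \<open>y f\<close> were in the class for \<open>f = clip j\<close>, then it would have a one-sided inverse in the
  finite monoid \<open>e A e\<close>, hence be a unit there, although \<open>f\<close> fixes it from the right; so
  \<open>f = e\<close>, which is absurd.
\<close>

lemma rclass_not_lower:
  assumes jk: "j < k" and k: "k \<le> N" and y: "y \<in> rclass k"
  shows "y \<otimes> \<tau> (clip j) \<notin> rclass k"
proof
  interpret M: monoid "corner k" using monoid_corner[OF k] .
  assume "y \<otimes> \<tau> (clip j) \<in> rclass k"
  then obtain b where b: "b \<in> carrier A" "y \<otimes> \<tau> (clip j) \<otimes> b = idem k" by (auto simp: rclass_def)
  have cm: "clip j \<in> maps k" using jk clip_maps by simp
  note e = idem_closed[OF k] idem_idem[OF k]
  define f where "f = \<tau> (clip j)"
  have f: "f \<in> carrier A" "idem k \<otimes> f = f" "f \<otimes> idem k = f" "f \<otimes> f = f"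
    using maps_corner[OF k cm] \<tau>_comp[of "clip j" "clip j"] clip_maps[of j N] clip_clip[of j j] jk k
    by (auto simp: f_def)
  have yc: "y \<in> carrier A" "idem k \<otimes> y = y" using y by (auto simp: rclass_def)
  let ?u = "y \<otimes> f" and ?v = "f \<otimes> b \<otimes> idem k"
  have u: "?u \<in> carrier (corner k)" using yc f e by (simp add: m_closed m_assoc) (metis m_assoc)
  have v: "?v \<in> carrier (corner k)" using b f e by (simp add: m_closed m_assoc) (metis m_assoc m_closed)
  have "?u \<otimes> ?v = (y \<otimes> (f \<otimes> f) \<otimes> b) \<otimes> idem k"
    by (simp only: m_assoc m_closed yc(1) f(1) b(1) e(1))
  also have "\<dots> = idem k" using b(2) f e by (simp add: f_def)
  finally have "?v \<otimes>\<^bsub>corner k\<^esub> ?u = \<one>\<^bsub>corner k\<^esub>" using M.finite_inverse_comm[OF finite_corner u v] by simp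
  then have vu: "?v \<otimes> ?u = idem k" by simp
  have "idem k \<otimes> f = (?v \<otimes> ?u) \<otimes> f" using vu by simp
  also have "\<dots> = ?v \<otimes> (y \<otimes> (f \<otimes> f))" using yc f b e by (simp only: m_assoc m_closed)
  also have "\<dots> = idem k" using vu f by simp
  finally have "\<tau> (clip j) = \<tau> (clip k)" using f by (simp add: f_def idem_def)
  then have "clip j = clip k" using \<tau>_inj clip_maps[of j N] clip_maps[of k N] jk k by (auto dest: inj_onD)
  then have "clip j k = clip k k" by simp
  then show False using jk by (simp add: clip_def)
qed

lemma \<rho>R_mult:
  assumes k: "k \<le> N" and ab: "a \<in> carrier A" "b \<in> carrier A" and y: "y \<in> rclass k"
  shows "\<rho>R k (a \<otimes> b) y = Option.bind (\<rho>R k a y) (\<rho>R k b)"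
proof -
  have "y \<otimes> a \<otimes> b = y \<otimes> (a \<otimes> b)" using rclass_carrier[OF y] ab by (simp add: m_assoc)
  then show ?thesis using rclass_prefix[OF k y ab] by (auto simp: \<rho>R_def)
qed

lemma \<rho>R_lam:
  assumes k: "k \<le> N" and q: "q \<in> Units (corner k)" and a: "a \<in> carrier A" and y: "y \<in> rclass k"
  shows "\<rho>R k a (q \<otimes> y) = map_option (\<lambda>y. q \<otimes> y) (\<rho>R k a y)"
proof -
  interpret M: monoid "corner k" using monoid_corner[OF k] .
  note yc = rclass_carrier[OF y]
  have q': "q \<in> carrier A" using q by (auto simp: Units_def)
  obtain p where p: "p \<in> Units (corner k)" "p \<otimes> q = idem k"
    using M.Units_l_inv_ex[OF q] M.Units_l_inv[OF q] M.Units_inv_Units[OF q] by auto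
  have p': "p \<in> carrier A" using p by (auto simp: Units_def)
  have "y \<otimes> a \<in> rclass k" if "q \<otimes> y \<otimes> a \<in> rclass k"
  proof -
    have "p \<otimes> (q \<otimes> y \<otimes> a) = (p \<otimes> q) \<otimes> y \<otimes> a" using p' q' yc a by (simp add: m_assoc m_closed)
    also have "\<dots> = y \<otimes> a" using p y by (simp add: rclass_def)
    finally show ?thesis using unit_mult_rclass[OF k p(1) that] by simp
  qed
  moreover have "q \<otimes> y \<otimes> a \<in> rclass k" if "y \<otimes> a \<in> rclass k"
    using unit_mult_rclass[OF k q that] q' yc a by (simp add: m_assoc)
  ultimately show ?thesis using q' yc a by (auto simp: \<rho>R_def m_assoc)
qed

lemma lam_inj_rclass: 
  assumes k: "k \<le> N" and q: "q \<in> Units (corner k)" shows "inj_on (\<lambda>y. q \<otimes> y) (rclass k)"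
proof (rule inj_onI)
  interpret M: monoid "corner k" using monoid_corner[OF k] .
  fix x y assume xy: "x \<in> rclass k" "y \<in> rclass k" "q \<otimes> x = q \<otimes> y"
  have q': "q \<in> carrier A" using q by (auto simp: Units_def)
  obtain p where p: "p \<in> Units (corner k)" "p \<otimes> q = idem k"
    using M.Units_l_inv[OF q] M.Units_inv_Units[OF q] by auto
  have p': "p \<in> carrier A" using p by (auto simp: Units_def)
  have "(p \<otimes> q) \<otimes> x = (p \<otimes> q) \<otimes> y" using xy p' q' rclass_carrier by (simp add: m_assoc)
  then show "x = y" using p(2) xy by (simp add: rclass_def)
qed

end

section \<open>Making a level free\<close>

context map_ext
begin

lemma subgroup_level:
  assumes "extensible_module m D act" "k \<le> N" shows "subgroup (level D (tact act) k) D"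
proof -
  interpret transf_module D N "tact act" by (rule transf_module_extensible) fact
  show ?thesis
    using level_mult level_inv level_one assms(2) level_carrier
    by (intro subgroupI) (auto, blast)
qed

lemma group_hom_perm_units:
  assumes k: "k \<le> N" shows "group_hom (perm_group k) (units_of (corner k)) \<tau>"
proof -
  interpret M: monoid "corner k" by (rule monoid_corner) fact
  have "\<tau> \<in> hom (perm_group k) (units_of (corner k))"
    using perms_units[OF k] \<tau>_comp subsetD[OF maps_mono[OF k] perms_maps]
    by (auto simp: hom_def units_of_carrier units_of_mult)
  then show ?thesis
    by (intro group_hom.intro group_perm_group M.units_group group_hom_axioms.intro)
qed

text \<open>
  Let \<open>L\<close> be level \<open>k\<close> of \<open>D\<close>, a module over the group \<open>Q\<close> of units of \<open>e A e\<close>. The module \<open>Z\<close>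
  consists of the functions \<open>\<phi>\<close> on the \<open>\<R>\<close>-class of \<open>e\<close> with values in \<open>L \<times> U\<close>
  such that for all \<open>y\<close> the \<open>L\<close>-components of \<open>\<phi> (q y)\<close>, translated by the inverse of \<open>q\<close>,
  multiply to the neutral element. Level \<open>k\<close> of the function module without this condition would
  be all functions from \<open>Q\<close> to \<open>L \<times> U\<close>, and averaging over \<open>Q\<close> splits this as the product
  of \<open>L\<close> and the functions that satisfy the condition. So the product of \<open>D\<close> and \<open>Z\<close> has at
  level \<open>k\<close> the marks of the full function space, on which permutations act through right
  translations of \<open>Q\<close>. Below level \<open>k\<close> the module \<open>Z\<close> is trivial by \<open>rclass_not_lower\<close>.
\<close>

theorem free_level_adjustment:
  fixes D :: "'d monoid" and U :: "'u monoid"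
  assumes extensible_module: "extensible_module m D act" and k: "k \<le> N" and U: "bounded_group m U"
    and tw: "t * card (Units (corner k)) = m * w + 1"
  obtains Z :: "('a \<Rightarrow> 'd \<times> 'u) monoid" and actZ where
    "extensible_module m Z actZ"
    "\<And>j H. \<lbrakk>j < k; H \<subseteq> perms j\<rbrakk> \<Longrightarrow> mark Z actZ j H = 1"
    "\<And>H. subgroup H (perm_group k) \<Longrightarrow> mark D act k H * mark Z actZ k H =
       (card (level D (tact act) k) * card (carrier U)) ^ (card (Units (corner k)) div card H)"
    "0 < k \<Longrightarrow> spread Z actZ = 1" "k = 0 \<Longrightarrow> spread Z actZ = card (level Z (tact actZ) 0)"
proof -
  define L where "L = level D (tact act) k"
  define E0 where "E0 = D\<lparr>carrier := L\<rparr>"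
  define E where "E = E0 \<times>\<times> U"
  define Q where "Q = Units (corner k)"
  define e where "e = idem k"
  define i where "i q = inv\<^bsub>corner k\<^esub> q" for q
  define c where "c q = (\<lambda>(x, u::'u). (act (i q) x, \<one>\<^bsub>U\<^esub>))" for q
  interpret D: act_module A D m act using extensible_module by (simp add: extensible_module_def)
  interpret T: transf_module D N "tact act" by (rule transf_module_extensible) fact
  interpret M: monoid "corner k" by (rule monoid_corner) fact
  interpret QG: group "units_of (corner k)" by (rule M.units_group)
  have QGs: "carrier (units_of (corner k)) = Q" "mult (units_of (corner k)) = mult A"
    "one (units_of (corner k)) = e"
    by (simp_all add: units_of_carrier units_of_mult units_of_one Q_def e_def)
  have bE0: "bounded_group m E0"
    unfolding E0_def L_def
    by (rule bounded_subgroup) (use extensible_module k subgroup_level in \<open>auto simp: extensible_module_def act_module_iff\<close>)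
  have bE: "bounded_group m E" unfolding E_def by (rule bounded_group_prod[OF bE0 U])
  interpret E0: comm_group E0 using bE0 by (simp add: bounded_group_def)
  interpret U: comm_group U using U by (simp add: bounded_group_def)
  interpret E: comm_group E using bE by (simp add: bounded_group_def)
  have E0s [simp]: "carrier E0 = L" "mult E0 = mult D" "one E0 = one D" by (simp_all add: E0_def)
  have Es [simp]: "carrier E = L \<times> carrier U" "one E = (\<one>\<^bsub>D\<^esub>, \<one>\<^bsub>U\<^esub>)"
    "\<And>x u y v. (x, u) \<otimes>\<^bsub>E\<^esub> (y, v) = (x \<otimes>\<^bsub>D\<^esub> y, u \<otimes>\<^bsub>U\<^esub> v)"
    by (simp_all add: E_def)
  have LD: "x \<in> carrier D" if "x \<in> L" for x using that T.level_carrier by (simp add: L_def)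
  have Lm: "x \<otimes>\<^bsub>D\<^esub> y \<in> L" if "x \<in> L" "y \<in> L" for x y using that T.level_mult[OF k] by (simp add: L_def)
  have Li: "inv\<^bsub>D\<^esub> x \<in> L" if "x \<in> L" for x using that T.level_inv[OF k] by (simp add: L_def)
  have L1: "\<one>\<^bsub>D\<^esub> \<in> L" using T.level_one[OF k] by (simp add: L_def)
  have QA: "q \<in> carrier A" "e \<otimes> q = q" "q \<otimes> e = q" if "q \<in> Q" for q
    using that by (auto simp: Q_def Units_def e_def)
  have eA: "e \<in> carrier A" "e \<otimes> e = e" using idem_closed[OF k] idem_idem[OF k] by (auto simp: e_def)
  have actL: "act q x \<in> L" if "q \<in> Q" "x \<in> L" for q x
  proof -
    have "act q x \<in> carrier D" using D.act_hom[OF QA(1)[OF that(1)]] LD[OF that(2)] by (rule hom_in_carrier)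
    moreover have "act e (act q x) = act q x"
      using D.act_comp[OF eA(1) QA(1)[OF that(1)] LD[OF that(2)]] QA[OF that(1)] by simp
    ultimately show ?thesis by (simp add: L_def level_def e_def idem_def)
  qed
  have act1: "act e x = x" if "x \<in> L" for x using that by (simp add: L_def level_def e_def idem_def)
  have actm: "act (q \<otimes> p) x = act q (act p x)" if "q \<in> Q" "p \<in> Q" "x \<in> L" for q p x
    using D.act_comp QA(1) LD that by blast
  have acth: "act q (x \<otimes>\<^bsub>D\<^esub> y) = act q x \<otimes>\<^bsub>D\<^esub> act q y" if "q \<in> Q" "x \<in> L" "y \<in> L" for q x y
    using hom_mult[OF D.act_hom[OF QA(1)[OF that(1)]]] LD that by blast
  have iQ: "i q \<in> Q" "i q \<otimes> q = e" "q \<otimes> i q = e" if "q \<in> Q" for q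
    using that M.Units_inv_Units M.Units_l_inv M.Units_r_inv by (auto simp: i_def Q_def e_def)
  have QQ: "q \<otimes> p \<in> Q" if "q \<in> Q" "p \<in> Q" for q p
    using M.Units_m_closed that by (auto simp: Q_def)
  have acthom: "act q \<in> hom E0 E0" if "q \<in> Q" for q
    using actL acth that by (auto simp: hom_def)
  have chom: "c q \<in> hom E E" if "q \<in> Q" for q
    using acthom[OF iQ(1)[OF that]] by (auto simp: hom_def c_def)
  have QR: "Q \<subseteq> rclass k" using units_rclass[OF k] by (simp add: Q_def)
  have RA: "y \<in> carrier A" "e \<otimes> y = y" if "y \<in> rclass k" for y
    using that by (auto simp: rclass_def e_def)
  have RQ: "y \<otimes> e \<in> Q" if "y \<in> rclass k" "y \<otimes> e \<in> rclass k" for y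
    using rclass_units[OF k, of "y \<otimes> e"] that RA eA by (simp add: Q_def e_def m_assoc)
  interpret F: function_module A N \<tau> E m "rclass k" "\<rho>R k" Q c "\<lambda>q y. q \<otimes> y"
  proof unfold_locales
    show "finite (carrier E)" "\<And>x. x \<in> carrier E \<Longrightarrow> x [^]\<^bsub>E\<^esub> m = \<one>\<^bsub>E\<^esub>"
      using bE by (auto simp: bounded_group_def)
    show "finite (rclass k)" using finA rclass_carrier by (auto intro: finite_subset)
    show "w \<in> rclass k" if "\<rho>R k a y = Some w" for a y w
      using that by (auto simp: \<rho>R_def split: if_splits)
    show "\<rho>R k (a \<otimes> b) y = Option.bind (\<rho>R k a y) (\<rho>R k b)"
      if "a \<in> carrier A" "b \<in> carrier A" "y \<in> rclass k" for a b y using \<rho>R_mult[OF k that] .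
    show "c q \<in> hom E E" if "q \<in> Q" for q using chom that .
    show "q \<otimes> y \<in> rclass k" if "q \<in> Q" "y \<in> rclass k" for q y
      using unit_mult_rclass[OF k] that by (simp add: Q_def)
    show "inj_on (\<lambda>y. q \<otimes> y) (rclass k)" if "q \<in> Q" for q
      using lam_inj_rclass[OF k] that by (simp add: Q_def)
    show "\<rho>R k a (q \<otimes> y) = map_option (\<lambda>y. q \<otimes> y) (\<rho>R k a y)"
      if "q \<in> Q" "a \<in> carrier A" "y \<in> rclass k" for q a y
      using \<rho>R_lam[OF k] that by (simp add: Q_def)
  qed
  \<comment> \<open>The product over \<open>Q\<close> of the translated \<open>L\<close>-components, a map to \<open>L\<close> that is equivariant
    for right translations of functions. Division by the order of \<open>Q\<close> is deferred to
    \<open>\<delta>\<close>.\<close>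
  define avg where "avg \<chi> = finprod E0 (\<lambda>q. act (i q) (fst (\<chi> q))) Q" for \<chi> :: "'a \<Rightarrow> 'd \<times> 'u"
  have fQ: "finite Q" using QA(1) finA by (auto intro: finite_subset)
  have avg_closed: "avg \<chi> \<in> L" if "\<chi> \<in> Q \<rightarrow> carrier E" for \<chi>
    unfolding avg_def using that actL[OF iQ(1)]
    by (intro E0.finprod_closed[simplified]) (auto simp: Pi_iff mem_Times_iff)
  have avg_shift: "avg (\<lambda>q. \<chi> (q \<otimes> p)) = act p (avg \<chi>)" if p: "p \<in> Q" and \<chi>: "\<chi> \<in> Q \<rightarrow> carrier E" for p \<chi>
  proof -
    have f: "fst (\<chi> q) \<in> L" if "q \<in> Q" for q using \<chi> that by (auto simp: Pi_iff mem_Times_iff)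
    have b: "inj_on (\<lambda>q. q \<otimes> p) Q" "(\<lambda>q. q \<otimes> p) ` Q = Q"
    proof -
      show "inj_on (\<lambda>q. q \<otimes> p) Q"
        using QG.right_cancel[of p] p QGs by (auto simp: inj_on_def)
      then show "(\<lambda>q. q \<otimes> p) ` Q = Q" using fQ QQ p by (intro endo_inj_surj) auto
    qed
    have "act p (avg \<chi>) = finprod E0 (\<lambda>q. act p (act (i q) (fst (\<chi> q)))) Q"
      unfolding avg_def
      by (rule hom_finprod_comm_group) (use acthom[OF p] actL iQ f E0.comm_group_axioms in auto)
    also have "\<dots> = finprod E0 (\<lambda>q. act p (act (i q) (fst (\<chi> q)))) ((\<lambda>q. q \<otimes> p) ` Q)" using b by simp
    also have "\<dots> = finprod E0 (\<lambda>q. act p (act (i (q \<otimes> p)) (fst (\<chi> (q \<otimes> p))))) Q"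
      by (rule E0.finprod_reindex) (use b actL iQ f p QQ in \<open>auto simp: Pi_iff\<close>)
    also have "\<dots> = avg (\<lambda>q. \<chi> (q \<otimes> p))"
      unfolding avg_def
    proof (rule E0.finprod_cong', rule refl)
      show "(\<lambda>q. act (i q) (fst (\<chi> (q \<otimes> p)))) \<in> Q \<rightarrow> carrier E0" using actL iQ f p QQ by auto
      fix q assume q: "q \<in> Q"
      have "p \<otimes> i (q \<otimes> p) = p \<otimes> i (q \<otimes> p) \<otimes> (q \<otimes> i q)" using q p iQ QQ QA m_assoc m_closed by simp
      also have "\<dots> = p \<otimes> (i (q \<otimes> p) \<otimes> (q \<otimes> (p \<otimes> i p)) \<otimes> i q)"
        using q p iQ(3)[OF p] QA(3)[OF q] by (simp add: m_assoc m_closed QA(1) iQ(1) QQ)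
      also have "\<dots> = p \<otimes> ((i (q \<otimes> p) \<otimes> (q \<otimes> p)) \<otimes> i p \<otimes> i q)"
        by (simp only: m_assoc m_closed QA(1) iQ(1) QQ q p)
      also have "\<dots> = i q"
        using iQ(2)[OF QQ[OF q p]] iQ(3)[OF p] QA(2)[OF iQ(1)[OF q]] QA(2)[OF iQ(1)[OF p]] q p
        by (simp add: QA(1) iQ(1) m_assoc[symmetric])
      finally have "p \<otimes> i (q \<otimes> p) = i q" .
      then show "act p (act (i (q \<otimes> p)) (fst (\<chi> (q \<otimes> p)))) = act (i q) (fst (\<chi> (q \<otimes> p)))"
        using actm[OF p iQ(1)[OF QQ[OF q p]] f[OF QQ[OF q p]]] by simp
    qed
    finally show ?thesis by simp
  qed
  have avg_cong: "avg \<chi> = avg \<psi>" if "\<psi> \<in> Q \<rightarrow> carrier E" "\<And>q. q \<in> Q \<Longrightarrow> \<chi> q = \<psi> q" for \<chi> \<psi>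
    unfolding avg_def
    by (rule E0.finprod_cong') (use that actL iQ in \<open>auto simp: Pi_iff mem_Times_iff\<close>)
  have avg_mult: "avg (\<lambda>q. \<chi> q \<otimes>\<^bsub>E\<^esub> \<psi> q) = avg \<chi> \<otimes>\<^bsub>D\<^esub> avg \<psi>"
    if "\<chi> \<in> Q \<rightarrow> carrier E" "\<psi> \<in> Q \<rightarrow> carrier E" for \<chi> \<psi>
  proof -
    have v: "fst (\<chi> q) \<in> L" "fst (\<psi> q) \<in> L" if "q \<in> Q" for q
      using that \<open>\<chi> \<in> Q \<rightarrow> carrier E\<close> \<open>\<psi> \<in> Q \<rightarrow> carrier E\<close> by (auto simp: Pi_iff mem_Times_iff)
    have f: "fst (\<chi> q \<otimes>\<^bsub>E\<^esub> \<psi> q) = fst (\<chi> q) \<otimes>\<^bsub>D\<^esub> fst (\<psi> q)" for q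
      by (cases "\<chi> q"; cases "\<psi> q") simp
    have "avg (\<lambda>q. \<chi> q \<otimes>\<^bsub>E\<^esub> \<psi> q) = finprod E0 (\<lambda>q. act (i q) (fst (\<chi> q)) \<otimes>\<^bsub>E0\<^esub> act (i q) (fst (\<psi> q))) Q"
      unfolding avg_def f by (rule E0.finprod_cong') (use v actL acth iQ Lm in auto)
    also have "\<dots> = avg \<chi> \<otimes>\<^bsub>E0\<^esub> avg \<psi>"
      unfolding avg_def by (rule E0.finprod_multf) (use v actL iQ in auto)
    finally show ?thesis by simp
  qed
  \<comment> \<open>Since \<open>t * card Q = 1\<close> modulo the exponent, the power with exponent \<open>t\<close> plays the role of
    division by the order of \<open>Q\<close>.\<close>
  define pw where "pw x = x [^]\<^bsub>D\<^esub> t" for x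
  have powE0: "x [^]\<^bsub>E0\<^esub> (n::nat) = x [^]\<^bsub>D\<^esub> n" for x n by (induction n) simp_all
  have pwL: "pw x \<in> L" if "x \<in> L" for x
    using E0.nat_pow_closed[of x t] that by (simp add: powE0 pw_def)
  have pwact: "act q (pw x) = pw (act q x)" if "q \<in> Q" "x \<in> L" for q x
  proof -
    interpret h: group_hom D D "act q" by unfold_locales (rule D.act_hom[OF QA(1)[OF that(1)]])
    show ?thesis unfolding pw_def using h.hom_nat_pow LD[OF that(2)] by simp
  qed
  have pwinv: "pw (inv\<^bsub>D\<^esub> x) \<otimes>\<^bsub>D\<^esub> pw x = \<one>\<^bsub>D\<^esub>" if "x \<in> L" for x
    using D.D.nat_pow_distrib[of "inv\<^bsub>D\<^esub> x" x t] LD[OF that] by (simp add: pw_def)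
  have actinv: "act q (inv\<^bsub>D\<^esub> x) = inv\<^bsub>D\<^esub> (act q x)" if "q \<in> Q" "x \<in> L" for q x
  proof -
    interpret h: group_hom D D "act q" by unfold_locales (rule D.act_hom[OF QA(1)[OF that(1)]])
    show ?thesis using LD[OF that(2)] by simp
  qed
  \<comment> \<open>The equivariant section of \<open>avg\<close> that makes \<open>L\<close> a direct factor of the functions on \<open>Q\<close>.\<close>
  define \<delta> where "\<delta> x q = (act q (pw x), \<one>\<^bsub>U\<^esub>)" for x q
  have \<delta>E: "\<delta> x q \<in> carrier E" if "q \<in> Q" "x \<in> L" for q x
    using that actL pwL by (simp add: \<delta>_def)
  have avg_\<delta>: "avg (\<delta> x) = x" if x: "x \<in> L" for x
  proof -
    have "avg (\<delta> x) = finprod E0 (\<lambda>q. pw x) Q"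
      unfolding avg_def
    proof (rule E0.finprod_cong', rule refl)
      fix q assume q: "q \<in> Q"
      show "act (i q) (fst (\<delta> x q)) = pw x"
        using actm[OF iQ(1)[OF q] q pwL[OF x]] iQ[OF q] act1[OF pwL[OF x]] by (simp add: \<delta>_def)
    qed (use pwL x in auto)
    also have "\<dots> = pw x [^]\<^bsub>D\<^esub> card Q" using E0.finprod_const[of "pw x" Q] pwL[OF x] by (simp add: powE0)
    also have "\<dots> = x [^]\<^bsub>D\<^esub> (m * w + 1)"
      using tw D.D.nat_pow_pow[OF LD[OF x], of t "card Q"] by (simp add: pw_def Q_def)
    also have "\<dots> = (x [^]\<^bsub>D\<^esub> m) [^]\<^bsub>D\<^esub> w \<otimes>\<^bsub>D\<^esub> x"
      using D.D.nat_pow_pow[OF LD[OF x], of m w] by simp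
    also have "\<dots> = x" using D.exponent LD[OF x] by simp
    finally show ?thesis .
  qed
  have constr: "F.constr \<phi> y = (avg (\<lambda>q. \<phi> (q \<otimes> y)), \<one>\<^bsub>U\<^esub>)" if "\<phi> \<in> rclass k \<rightarrow> carrier E" "y \<in> rclass k" for \<phi> y
  proof -
    have v: "fst (\<phi> (q \<otimes> y)) \<in> L" if "q \<in> Q" for q
      using \<open>\<phi> \<in> _\<close> F.lam_closed[OF that \<open>y \<in> rclass k\<close>] by (auto simp: Pi_iff mem_Times_iff)
    have "F.constr \<phi> y = finprod E (\<lambda>q. (act (i q) (fst (\<phi> (q \<otimes> y))), \<one>\<^bsub>U\<^esub>)) Q"
      unfolding F.constr_def
      by (rule E.finprod_cong') (use v actL iQ in \<open>auto simp: c_def split: prod.splits\<close>)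
    also have "\<dots> = (avg (\<lambda>q. \<phi> (q \<otimes> y)), \<one>\<^bsub>U\<^esub>)"
      unfolding avg_def
      by (rule hom_finprod_comm_group[symmetric, where f = "\<lambda>x. (x, \<one>\<^bsub>U\<^esub>)" and G = E0])
        (use v actL iQ E0.comm_group_axioms E.comm_group_axioms in \<open>auto simp: hom_def\<close>)
    finally show ?thesis .
  qed
  let ?Z = "F.Fun" and ?a = "tact F.pull"
  have extZ: "extensible_module m F.Fun F.pull" using F.act_module_Fun F.extensible_Fun by (simp add: extensible_module_def)
  interpret TZ: transf_module F.Fun N "tact F.pull" by (rule transf_module_extensible[OF extZ])
  have lev: "\<phi> \<in> carrier F.Fun" "\<And>y. y \<in> rclass k \<Longrightarrow> \<phi> y = F.ev \<phi> (\<rho>R k (\<tau> (clip j)) y)"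
    if "\<phi> \<in> level F.Fun ?a j" for \<phi> j
  proof -
    show "\<phi> \<in> carrier F.Fun" using that by (simp add: level_def)
    have "F.pull (\<tau> (clip j)) \<phi> = \<phi>" using that by (simp add: level_def)
    then show "\<phi> y = F.ev \<phi> (\<rho>R k (\<tau> (clip j)) y)" if "y \<in> rclass k" for y
      using that by (metis (no_types, lifting) F.pull_def restrict_apply')
  qed
  have low: "level F.Fun ?a j = {\<one>\<^bsub>F.Fun\<^esub>}" if j: "j < k" for j
  proof -
    have "\<phi> = \<one>\<^bsub>F.Fun\<^esub>" if "\<phi> \<in> level F.Fun ?a j" for \<phi>
    proof (rule extensionalityI[of _ "rclass k"])
      show "\<phi> \<in> extensional (rclass k)" using lev(1)[OF that] by (auto simp: F.Fun_iff PiE_def)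
      show "\<phi> y = \<one>\<^bsub>F.Fun\<^esub> y" if y: "y \<in> rclass k" for y
        using lev(2)[OF \<open>\<phi> \<in> level F.Fun ?a j\<close> y] rclass_not_lower[OF j k y] y by (simp add: \<rho>R_def del: Es)
    qed simp
    moreover have "j \<le> N" using j k by simp
    ultimately show ?thesis using TZ.level_one[of j] by blast
  qed
  show thesis
  proof (rule that[of F.Fun F.pull])
    show "extensible_module m F.Fun F.pull" by (rule extZ)
    show "mark F.Fun F.pull j H = 1" if "j < k" "H \<subseteq> perms j" for j H
    proof -
      have "F.pull (\<tau> h) \<one>\<^bsub>F.Fun\<^esub> = \<one>\<^bsub>F.Fun\<^esub>" if "h \<in> H" for h
        using TZ.act_one[of h] that \<open>H \<subseteq> perms j\<close> \<open>j < k\<close> k perms_maps maps_mono[of j N] by auto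
      then have "fixed ?a H {\<one>\<^bsub>F.Fun\<^esub>} = {\<one>\<^bsub>F.Fun\<^esub>}" by (auto simp: fixed_def)
      then show ?thesis by (simp add: mark_def low[OF that(1)] del: F.Fun_simps)
    qed
    show "spread F.Fun F.pull = 1" if "0 < k"
    proof -
      have "diffs F.Fun ?a \<subseteq> {\<one>\<^bsub>F.Fun\<^esub>}" using TZ.diffs_level[OF N1] low[OF that] by simp
      moreover have "diffs F.Fun ?a \<noteq> {}" using TZ.one_closed by (auto simp: diffs_def simp del: F.Fun_simps)
      ultimately have "diffs F.Fun ?a = {\<one>\<^bsub>F.Fun\<^esub>}" by blast
      then show ?thesis by (simp add: spread_def)
    qed
    show "spread F.Fun F.pull = card (level F.Fun (tact F.pull) 0)" if k0: "k = 0"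
    proof -
      have "\<phi> \<in> diffs F.Fun ?a" if p: "\<phi> \<in> level F.Fun ?a 0" for \<phi>
      proof -
        let ?c1 = "\<lambda>_::nat. 1::nat"
        \<comment> \<open>Cutting \<open>\<phi>\<close> off outside the units keeps the face under \<open>clip 0\<close>, while the face
          under the constant map with value 1 becomes trivial, since this map sends no element
          of the \<open>\<R>\<close>-class to a unit of the corner.\<close>
        define x where "x = (\<lambda>y\<in>rclass k. if y \<otimes> e = y then \<phi> y else \<one>\<^bsub>E\<^esub>)"
        have e0: "e = \<tau> (clip 0)" using k0 by (simp add: e_def idem_def)
        have m: "clip 0 \<in> maps N" "?c1 \<in> maps N" using clip_maps[of 0 N] const1_maps[OF N1] by auto
        have c1: "\<tau> ?c1 \<in> carrier A" "\<tau> ?c1 \<otimes> e = e" "e \<otimes> \<tau> ?c1 = \<tau> ?c1"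
        proof -
          have "clip 0 \<circ> ?c1 = clip 0" "?c1 \<circ> clip 0 = ?c1" by (auto simp: clip_def)
          then show "\<tau> ?c1 \<in> carrier A" "\<tau> ?c1 \<otimes> e = e" "e \<otimes> \<tau> ?c1 = \<tau> ?c1"
            using \<tau>_comp[OF m(2) m(1)] \<tau>_comp[OF m] \<tau>_closed[OF m(2)] by (auto simp: e0)
        qed
        have ne: "\<tau> ?c1 \<noteq> e"
        proof
          assume "\<tau> ?c1 = e"
          then have "?c1 = clip 0" using \<tau>_inj m by (auto simp: e0 dest: inj_onD)
          then show False by (auto simp: clip_def fun_eq_iff)
        qed
        note pc = lev(1)[OF p]
        have pv: "\<phi> y \<in> carrier E" if "y \<in> rclass k" for y using F.Fun_val[OF pc that] .
        have "F.constr x y = \<one>\<^bsub>E\<^esub>" if y: "y \<in> rclass k" for y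
        proof -
          have qy: "(q \<otimes> y) \<otimes> e = q \<otimes> y \<longleftrightarrow> y \<otimes> e = y" if q: "q \<in> Q" for q
          proof -
            have a: "q \<otimes> y \<otimes> e = q \<otimes> (y \<otimes> e)" using QA(1)[OF q] RA(1)[OF y] eA by (simp add: m_assoc)
            have "y \<otimes> e = y" if "q \<otimes> (y \<otimes> e) = q \<otimes> y"
            proof -
              have "i q \<otimes> (q \<otimes> (y \<otimes> e)) = i q \<otimes> (q \<otimes> y)" using that by simp
              then have "(i q \<otimes> q) \<otimes> y \<otimes> e = (i q \<otimes> q) \<otimes> y"
                using QA(1)[OF q] QA(1)[OF iQ(1)[OF q]] RA(1)[OF y] eA(1) by (simp add: m_assoc m_closed)
              then show ?thesis using iQ(2)[OF q] RA(2)[OF y] by simp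
            qed
            then show ?thesis using a by auto
          qed
          show ?thesis
          proof (cases "y \<otimes> e = y")
            case True
            have "F.constr x y = F.constr \<phi> y"
              using y True qy pv F.lam_closed by (intro F.constr_cong) (auto simp: x_def simp del: Es)
            then show ?thesis using pc y by (simp add: F.Fun_iff del: Es)
          next
            case False
            then show ?thesis
              using y qy F.lam_closed by (intro F.constr_one) (auto simp: x_def simp del: Es)
          qed
        qed
        then have xF: "x \<in> carrier F.Fun" using pv by (auto simp: F.Fun_iff x_def simp del: Es)
        have x0: "F.pull (\<tau> (clip 0)) x = \<phi>"
        proof (rule extensionalityI[of _ "rclass k"])
          show "\<phi> \<in> extensional (rclass k)" using pc by (auto simp: F.Fun_iff PiE_def)
          fix y assume y: "y \<in> rclass k"
          have "y \<otimes> e \<otimes> e = y \<otimes> e" using RA[OF y] eA by (simp add: m_assoc)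
          then show "F.pull (\<tau> (clip 0)) x y = \<phi> y"
            using lev(2)[OF p y] y by (simp add: F.pull_def \<rho>R_def e0[symmetric] x_def del: Es)
        qed (simp add: F.pull_def)
        have x1: "F.pull (\<tau> ?c1) x = \<one>\<^bsub>F.Fun\<^esub>"
        proof (rule extensionalityI[of _ "rclass k"])
          fix y assume y: "y \<in> rclass k"
          have "y \<otimes> \<tau> ?c1 \<otimes> e \<noteq> y \<otimes> \<tau> ?c1" if r: "y \<otimes> \<tau> ?c1 \<in> rclass k"
          proof
            assume eq: "y \<otimes> \<tau> ?c1 \<otimes> e = y \<otimes> \<tau> ?c1"
            have ye: "y \<otimes> e = y \<otimes> \<tau> ?c1" using eq RA[OF y] c1 eA by (simp add: m_assoc)
            have g: "y \<otimes> e \<in> Q" using RQ[OF y] r ye by simp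
            have "y \<otimes> e \<otimes> \<tau> ?c1 = y \<otimes> (e \<otimes> \<tau> ?c1)" by (simp only: m_assoc RA(1)[OF y] c1(1) eA(1))
            then have "y \<otimes> e \<otimes> \<tau> ?c1 = y \<otimes> e" using ye c1(3) by simp
            then have "i (y \<otimes> e) \<otimes> (y \<otimes> e \<otimes> \<tau> ?c1) = i (y \<otimes> e) \<otimes> (y \<otimes> e)" by simp
            then have "(i (y \<otimes> e) \<otimes> (y \<otimes> e)) \<otimes> \<tau> ?c1 = i (y \<otimes> e) \<otimes> (y \<otimes> e)"
              by (simp only: m_assoc m_closed QA(1)[OF g] QA(1)[OF iQ(1)[OF g]] c1(1))
            then show False using iQ(2)[OF g] c1(3) ne by simp
          qed
          then show "F.pull (\<tau> ?c1) x y = \<one>\<^bsub>F.Fun\<^esub> y"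
            using y by (auto simp: F.pull_def \<rho>R_def x_def simp del: Es)
        qed (auto simp: F.pull_def)
        have "\<phi> \<otimes>\<^bsub>F.Fun\<^esub> inv\<^bsub>F.Fun\<^esub> \<one>\<^bsub>F.Fun\<^esub> = \<phi>" using TZ.inv_one TZ.r_one pc by metis
        then show ?thesis
          unfolding diffs_def using xF x0 x1 by (intro CollectI exI[of _ x]) (simp del: F.Fun_simps)
      qed
      then have "diffs F.Fun ?a = level F.Fun ?a 0" using TZ.diffs_level[OF N1] by blast
      then show ?thesis by (simp add: spread_def)
    qed
    fix H assume H: "subgroup H (perm_group k)"
    show "mark D act k H * mark F.Fun F.pull k H =
       (card (level D (tact act) k) * card (carrier U)) ^ (card (Units (corner k)) div card H)"
    proof -
      have Hp: "H \<subseteq> perms k" using subgroup.subset[OF H] by simp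
      have HQ: "\<tau> h \<in> Q" if "h \<in> H" for h using perms_units[OF k] that Hp by (auto simp: Q_def)
      let ?X = "fixed (tact act) H L" and ?Y = "fixed ?a H (level F.Fun ?a k)"
      let ?I = "{\<chi> \<in> Q \<rightarrow>\<^sub>E carrier E. \<forall>g\<in>Q. \<forall>h\<in>\<tau> ` H. \<chi> (g \<otimes> h) = \<chi> g}"
      \<comment> \<open>A function of level \<open>k\<close> is determined by its values on \<open>Q\<close>: at \<open>y\<close> it has the value at
        \<open>y e\<close> if \<open>y e\<close> is in \<open>Q\<close>, and the neutral value otherwise. Dividing by the average
        first makes the conditions hold.\<close>
      define ext where "ext \<chi> = (\<lambda>y\<in>rclass k. if y \<otimes> e \<in> rclass k
          then \<delta> (inv\<^bsub>D\<^esub> (avg \<chi>)) (y \<otimes> e) \<otimes>\<^bsub>E\<^esub> \<chi> (y \<otimes> e) else \<one>\<^bsub>E\<^esub>)" for \<chi>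
      have eR: "e \<in> rclass k" using QR M.Units_one_closed by (auto simp: Q_def e_def)
      have ye: "\<rho>R k (\<tau> (clip k)) y = (if y \<otimes> e \<in> rclass k then Some (y \<otimes> e) else None)" for y
        by (simp add: \<rho>R_def e_def idem_def)
      have levk: "\<phi> y = (if y \<otimes> e \<in> rclass k then \<phi> (y \<otimes> e) else \<one>\<^bsub>E\<^esub>)"
        if "\<phi> \<in> level F.Fun ?a k" "y \<in> rclass k" for \<phi> y
        using lev(2)[OF that] by (simp add: ye del: Es)
      have val: "\<phi> q \<in> carrier E" if "\<phi> \<in> level F.Fun ?a k" "q \<in> rclass k" for \<phi> q
        using F.Fun_val[OF lev(1)[OF that(1)] that(2)] .
      have avg1: "avg \<phi> = \<one>\<^bsub>D\<^esub>" if p: "\<phi> \<in> level F.Fun ?a k" for \<phi>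
      proof -
        have "\<phi> \<in> rclass k \<rightarrow> carrier E" using val[OF p] by blast
        then have "F.constr \<phi> e = (avg (\<lambda>q. \<phi> (q \<otimes> e)), \<one>\<^bsub>U\<^esub>)" using constr eR by blast
        moreover have "F.constr \<phi> e = \<one>\<^bsub>E\<^esub>" using lev(1)[OF p] eR by (simp add: F.Fun_iff del: Es)
        moreover have "avg (\<lambda>q. \<phi> (q \<otimes> e)) = avg \<phi>"
          using val[OF p] QR QA(3) by (intro avg_cong) auto
        ultimately show ?thesis by simp
      qed
      have \<delta>\<delta>: "\<delta> (inv\<^bsub>D\<^esub> x) q \<otimes>\<^bsub>E\<^esub> (\<delta> x q \<otimes>\<^bsub>E\<^esub> z) = z" "\<delta> x q \<otimes>\<^bsub>E\<^esub> (\<delta> (inv\<^bsub>D\<^esub> x) q \<otimes>\<^bsub>E\<^esub> z) = z"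
        if "x \<in> L" "q \<in> Q" "z \<in> carrier E" for x q z
      proof -
        have c: "\<delta> (inv\<^bsub>D\<^esub> x) q \<in> carrier E" "\<delta> x q \<in> carrier E" using \<delta>E Li that by blast+
        have "act q (pw (inv\<^bsub>D\<^esub> x)) \<otimes>\<^bsub>D\<^esub> act q (pw x) = act q \<one>\<^bsub>D\<^esub>"
          using acth[OF that(2) pwL[OF Li[OF that(1)]] pwL[OF that(1)]] pwinv[OF that(1)] by simp
        also have "\<dots> = \<one>\<^bsub>D\<^esub>"
          using D.act_hom[OF QA(1)[OF that(2)]] D.D.group_axioms
          by (metis group_hom.hom_one group_hom.intro group_hom_axioms.intro)
        finally have "\<delta> (inv\<^bsub>D\<^esub> x) q \<otimes>\<^bsub>E\<^esub> \<delta> x q = \<one>\<^bsub>E\<^esub>" by (simp add: \<delta>_def)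
        then show "\<delta> (inv\<^bsub>D\<^esub> x) q \<otimes>\<^bsub>E\<^esub> (\<delta> x q \<otimes>\<^bsub>E\<^esub> z) = z" "\<delta> x q \<otimes>\<^bsub>E\<^esub> (\<delta> (inv\<^bsub>D\<^esub> x) q \<otimes>\<^bsub>E\<^esub> z) = z"
          using c that(3) E.m_comm[OF c] E.m_assoc E.l_one by metis+
      qed
      have \<delta>H: "\<delta> x (q \<otimes> \<tau> h) = \<delta> x q" if "x \<in> L" "q \<in> Q" "h \<in> H" "act (\<tau> h) x = x" for x q h
        using actm[OF that(2) HQ[OF that(3)] pwL[OF that(1)]] pwact[OF HQ[OF that(3)] that(1)] that(4)
        by (simp add: \<delta>_def)
      have IE: "\<chi> \<in> Q \<rightarrow> carrier E" "avg \<chi> \<in> L" if "\<chi> \<in> ?I" for \<chi>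
        using that avg_closed by auto
      have avgH: "act (\<tau> h) (avg \<chi>) = avg \<chi>" if "\<chi> \<in> ?I" "h \<in> H" for \<chi> h
      proof -
        have "avg (\<lambda>q. \<chi> (q \<otimes> \<tau> h)) = avg \<chi>" using that IE(1)[OF that(1)] by (intro avg_cong) auto
        then show ?thesis using avg_shift[OF HQ[OF that(2)] IE(1)[OF that(1)]] by simp
      qed
      have extv: "ext \<chi> y = \<delta> (inv\<^bsub>D\<^esub> (avg \<chi>)) (y \<otimes> e) \<otimes>\<^bsub>E\<^esub> \<chi> (y \<otimes> e)"
        if "y \<in> rclass k" "y \<otimes> e \<in> rclass k" for \<chi> y using that by (simp add: ext_def del: Es)
      have ext1: "ext \<chi> y = \<one>\<^bsub>E\<^esub>" if "y \<in> rclass k" "y \<otimes> e \<notin> rclass k" for \<chi> y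
        using that by (simp add: ext_def del: Es)
      have extE: "ext \<chi> y \<in> carrier E" if "\<chi> \<in> ?I" "y \<in> rclass k" for \<chi> y
      proof (cases "y \<otimes> e \<in> rclass k")
        case True
        have "\<delta> (inv\<^bsub>D\<^esub> (avg \<chi>)) (y \<otimes> e) \<in> carrier E" "\<chi> (y \<otimes> e) \<in> carrier E"
          using \<delta>E Li IE[OF that(1)] RQ[OF that(2) True] by auto
        then show ?thesis using extv[OF that(2) True] E.m_closed by (simp del: Es)
      qed (use ext1 that E.one_closed in metis)
      have ext_idem: "ext \<chi> (y \<otimes> e) = ext \<chi> y" if "y \<in> rclass k" "y \<otimes> e \<in> rclass k" for \<chi> y
      proof -
        have "y \<otimes> e \<otimes> e = y \<otimes> e" using RA[OF that(1)] eA by (simp add: m_assoc)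
        then show ?thesis using extv[OF that] extv[of "y \<otimes> e"] that by (simp del: Es)
      qed
      have extF: "ext \<chi> \<in> carrier F.Fun" if \<chi>: "\<chi> \<in> ?I" for \<chi>
      proof -
        have P: "ext \<chi> \<in> rclass k \<rightarrow> carrier E" using extE[OF \<chi>] by blast
        let ?\<psi> = "\<lambda>q. \<delta> (inv\<^bsub>D\<^esub> (avg \<chi>)) q \<otimes>\<^bsub>E\<^esub> \<chi> q"
        note aL = IE(2)[OF \<chi>]
        have \<psi>E: "?\<psi> \<in> Q \<rightarrow> carrier E" using \<delta>E Li aL IE(1)[OF \<chi>] E.m_closed by (auto simp del: Es simp: Pi_iff)
        have "\<delta> (inv\<^bsub>D\<^esub> (avg \<chi>)) \<in> Q \<rightarrow> carrier E" using \<delta>E Li aL by blast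
        then have "avg ?\<psi> = inv\<^bsub>D\<^esub> (avg \<chi>) \<otimes>\<^bsub>D\<^esub> avg \<chi>"
          using avg_mult IE(1)[OF \<chi>] avg_\<delta>[OF Li[OF aL]] by simp
        then have a1: "avg ?\<psi> = \<one>\<^bsub>D\<^esub>" using LD[OF aL] by simp
        have "F.constr (ext \<chi>) y = \<one>\<^bsub>E\<^esub>" if y: "y \<in> rclass k" for y
        proof (cases "y \<otimes> e \<in> rclass k")
          case False
          have "ext \<chi> (q \<otimes> y) = \<one>\<^bsub>E\<^esub>" if q: "q \<in> Q" for q
          proof -
            have "(q \<otimes> y) \<otimes> e \<notin> rclass k"
              using \<rho>R_lam[OF k _ eA(1) y, of q] q False by (auto simp: \<rho>R_def Q_def split: if_splits)
            then show ?thesis using ext1 F.lam_closed[OF q y] by blast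
          qed
          then show ?thesis by (rule F.constr_one[OF y])
        next
          case True
          have g: "y \<otimes> e \<in> Q" using RQ[OF y True] .
          have "ext \<chi> (q \<otimes> y) = ?\<psi> (q \<otimes> (y \<otimes> e))" if q: "q \<in> Q" for q
          proof -
            have "(q \<otimes> y) \<otimes> e = q \<otimes> (y \<otimes> e)" using QA(1)[OF q] RA(1)[OF y] eA by (simp add: m_assoc)
            then show ?thesis using extv[OF F.lam_closed[OF q y]] QQ[OF q g] QR by (auto simp del: Es)
          qed
          then have "avg (\<lambda>q. ext \<chi> (q \<otimes> y)) = avg (\<lambda>q. ?\<psi> (q \<otimes> (y \<otimes> e)))"
            using \<psi>E QQ[OF _ g] by (intro avg_cong) (auto simp del: Es)
          also have "\<dots> = act (y \<otimes> e) (avg ?\<psi>)" by (rule avg_shift[OF g \<psi>E])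
          also have "\<dots> = \<one>\<^bsub>D\<^esub>"
            unfolding a1 using D.act_hom[OF QA(1)[OF g]] D.D.group_axioms
            by (metis group_hom.hom_one group_hom.intro group_hom_axioms.intro)
          finally show ?thesis using constr[OF P y] by simp
        qed
        then show ?thesis using extE[OF \<chi>] by (auto simp: F.Fun_iff ext_def simp del: Es)
      qed
      have extL: "ext \<chi> \<in> level F.Fun ?a k" if \<chi>: "\<chi> \<in> ?I" for \<chi>
      proof -
        have "F.pull (\<tau> (clip k)) (ext \<chi>) = ext \<chi>"
        proof (rule extensionalityI[of _ "rclass k"])
          show "F.pull (\<tau> (clip k)) (ext \<chi>) y = ext \<chi> y" if y: "y \<in> rclass k" for y
            using ext_idem[OF y] ext1[OF y] y by (simp add: F.pull_def ye del: Es)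
        qed (auto simp: F.pull_def ext_def)
        then show ?thesis using extF[OF \<chi>] by (simp add: level_def)
      qed
      have extH: "F.pull (\<tau> h) (ext \<chi>) = ext \<chi>" if \<chi>: "\<chi> \<in> ?I" and h: "h \<in> H" for \<chi> h
      proof (rule extensionalityI[of _ "rclass k"])
        fix y assume y: "y \<in> rclass k"
        have t: "\<tau> h \<in> carrier A" "e \<otimes> \<tau> h = \<tau> h" "\<tau> h \<otimes> e = \<tau> h" using QA[OF HQ[OF h]] by auto
        show "F.pull (\<tau> h) (ext \<chi>) y = ext \<chi> y"
        proof (cases "y \<otimes> e \<in> rclass k")
          case True
          let ?g = "y \<otimes> e"
          have g: "?g \<in> Q" using RQ[OF y True] .
          have yh: "y \<otimes> \<tau> h = ?g \<otimes> \<tau> h" using RA(1)[OF y] eA t by (simp add: m_assoc)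
          have ghQ: "?g \<otimes> \<tau> h \<in> Q" using QQ[OF g HQ[OF h]] .
          have ghR: "y \<otimes> \<tau> h \<in> rclass k" using ghQ QR yh by auto
          have he: "y \<otimes> \<tau> h \<otimes> e = ?g \<otimes> \<tau> h" using QA(3)[OF ghQ] yh by simp
          have "ext \<chi> (y \<otimes> \<tau> h) = \<delta> (inv\<^bsub>D\<^esub> (avg \<chi>)) (?g \<otimes> \<tau> h) \<otimes>\<^bsub>E\<^esub> \<chi> (?g \<otimes> \<tau> h)"
            using extv[OF ghR] he ghQ QR by (auto simp del: Es)
          also have "\<dots> = ext \<chi> y"
          proof -
            have "act (\<tau> h) (inv\<^bsub>D\<^esub> (avg \<chi>)) = inv\<^bsub>D\<^esub> (avg \<chi>)"
              using actinv[OF HQ[OF h] IE(2)[OF \<chi>]] avgH[OF \<chi> h] by simp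
            then have "\<delta> (inv\<^bsub>D\<^esub> (avg \<chi>)) (?g \<otimes> \<tau> h) = \<delta> (inv\<^bsub>D\<^esub> (avg \<chi>)) ?g"
              using \<delta>H[OF Li[OF IE(2)[OF \<chi>]] g h] by simp
            moreover have "\<chi> (?g \<otimes> \<tau> h) = \<chi> ?g" using \<chi> g h by blast
            ultimately show ?thesis using extv[OF y True] by (simp del: Es)
          qed
          finally show ?thesis using y ghR by (simp add: F.pull_def \<rho>R_def del: Es)
        next
          case False
          have "y \<otimes> \<tau> h \<notin> rclass k"
            using rclass_prefix[OF k y eA(1) t(1)] t(2) False by auto
          then show ?thesis using y ext1[OF y False] by (simp add: F.pull_def \<rho>R_def del: Es)
        qed
      qed (auto simp: F.pull_def ext_def)
      have "bij_betw (\<lambda>(x, \<phi>). \<lambda>q\<in>Q. \<delta> x q \<otimes>\<^bsub>E\<^esub> \<phi> q) (?X \<times> ?Y) ?I"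
      proof (rule bij_betw_byWitness[where f' = "\<lambda>\<chi>. (avg \<chi>, ext \<chi>)"])
        have rt: "(avg (\<lambda>q\<in>Q. \<delta> x q \<otimes>\<^bsub>E\<^esub> \<phi> q), ext (\<lambda>q\<in>Q. \<delta> x q \<otimes>\<^bsub>E\<^esub> \<phi> q)) = (x, \<phi>)"
          if x: "x \<in> L" and p: "\<phi> \<in> level F.Fun ?a k" for x \<phi>
        proof -
          let ?\<chi> = "\<lambda>q\<in>Q. \<delta> x q \<otimes>\<^bsub>E\<^esub> \<phi> q"
          have c: "\<delta> x \<in> Q \<rightarrow> carrier E" "\<phi> \<in> Q \<rightarrow> carrier E" using \<delta>E x val[OF p] QR by blast+
          have "avg ?\<chi> = avg (\<lambda>q. \<delta> x q \<otimes>\<^bsub>E\<^esub> \<phi> q)"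
            using c E.m_closed by (intro avg_cong) (auto simp del: Es simp: Pi_iff)
          also have "\<dots> = x" using avg_mult[OF c] avg_\<delta>[OF x] avg1[OF p] LD[OF x] by simp
          finally have a: "avg ?\<chi> = x" .
          have "ext ?\<chi> = \<phi>"
          proof (rule extensionalityI[of _ "rclass k"])
            show "\<phi> \<in> extensional (rclass k)" using lev(1)[OF p] by (auto simp: F.Fun_iff PiE_def)
            fix y assume y: "y \<in> rclass k"
            show "ext ?\<chi> y = \<phi> y"
            proof (cases "y \<otimes> e \<in> rclass k")
              case True
              then show ?thesis
                using extv[OF y True] RQ[OF y True] a levk[OF p y] \<delta>\<delta>(1)[OF x RQ[OF y True] val[OF p True]]
                by (simp del: Es)
            qed (use ext1[OF y] levk[OF p y] in simp)
          qed (simp add: ext_def)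
          then show ?thesis using a by simp
        qed
        show "\<forall>a\<in>?X \<times> ?Y. (avg (case a of (x, \<phi>) \<Rightarrow> \<lambda>q\<in>Q. \<delta> x q \<otimes>\<^bsub>E\<^esub> \<phi> q),
            ext (case a of (x, \<phi>) \<Rightarrow> \<lambda>q\<in>Q. \<delta> x q \<otimes>\<^bsub>E\<^esub> \<phi> q)) = a"
          using rt by (auto simp: fixed_def simp del: Es)
        show "\<forall>\<chi>\<in>?I. (case (avg \<chi>, ext \<chi>) of (x, \<phi>) \<Rightarrow> \<lambda>q\<in>Q. \<delta> x q \<otimes>\<^bsub>E\<^esub> \<phi> q) = \<chi>"
        proof
          fix \<chi> assume \<chi>: "\<chi> \<in> ?I"
          have "\<delta> (avg \<chi>) q \<otimes>\<^bsub>E\<^esub> ext \<chi> q = \<chi> q" if q: "q \<in> Q" for q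
          proof -
            have "q \<in> rclass k" "q \<otimes> e = q" using q QR QA by auto
            then have "ext \<chi> q = \<delta> (inv\<^bsub>D\<^esub> (avg \<chi>)) q \<otimes>\<^bsub>E\<^esub> \<chi> q" using extv[of q \<chi>] by simp
            then show ?thesis using \<delta>\<delta>(2)[OF IE(2)[OF \<chi>] q] IE(1)[OF \<chi>] q by (auto simp del: Es simp: Pi_iff)
          qed
          then have "(\<lambda>q\<in>Q. \<delta> (avg \<chi>) q \<otimes>\<^bsub>E\<^esub> ext \<chi> q) = \<chi>"
            using \<chi> by (intro extensionalityI[of _ Q]) (auto simp: PiE_def simp del: Es)
          then show "(case (avg \<chi>, ext \<chi>) of (x, \<phi>) \<Rightarrow> \<lambda>q\<in>Q. \<delta> x q \<otimes>\<^bsub>E\<^esub> \<phi> q) = \<chi>" by simp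
        qed
        show "(\<lambda>(x, \<phi>). \<lambda>q\<in>Q. \<delta> x q \<otimes>\<^bsub>E\<^esub> \<phi> q) ` (?X \<times> ?Y) \<subseteq> ?I"
        proof (rule image_subsetI)
          fix z assume "z \<in> ?X \<times> ?Y"
          then obtain x \<phi> where z: "z = (x, \<phi>)" and x: "x \<in> ?X" and p: "\<phi> \<in> ?Y" by blast
          have xL: "x \<in> L" and xH: "\<And>h. h \<in> H \<Longrightarrow> act (\<tau> h) x = x" using x by (auto simp: fixed_def)
          have pL: "\<phi> \<in> level F.Fun ?a k" and pH: "\<And>h. h \<in> H \<Longrightarrow> F.pull (\<tau> h) \<phi> = \<phi>"
            using p by (auto simp: fixed_def)
          have "\<delta> x q \<otimes>\<^bsub>E\<^esub> \<phi> q \<in> carrier E" if "q \<in> Q" for q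
            using \<delta>E[OF that xL] val[OF pL] QR that by (auto simp del: Es)
          moreover have "\<phi> (q \<otimes> \<tau> h) = \<phi> q" if "q \<in> Q" "h \<in> H" for q h
          proof -
            have "q \<otimes> \<tau> h \<in> rclass k" "q \<in> rclass k" using QQ[OF that(1) HQ[OF that(2)]] QR that(1) by auto
            then have "F.pull (\<tau> h) \<phi> q = \<phi> (q \<otimes> \<tau> h)" by (simp add: F.pull_def \<rho>R_def)
            then show ?thesis using pH[OF that(2)] by simp
          qed
          ultimately show "(case z of (x, \<phi>) \<Rightarrow> \<lambda>q\<in>Q. \<delta> x q \<otimes>\<^bsub>E\<^esub> \<phi> q) \<in> ?I"
            using \<delta>H[OF xL _ _ xH] QQ HQ z by (auto simp del: Es)
        qed
        show "(\<lambda>\<chi>. (avg \<chi>, ext \<chi>)) ` ?I \<subseteq> ?X \<times> ?Y"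
          using IE(2) avgH extL extH by (auto simp: fixed_def simp del: Es)
      qed
      then have "card (?X \<times> ?Y) = card ?I" by (rule bij_betw_same_card)
      then have "card ?X * card ?Y = card ?I" by (simp only: card_cartesian_product)
      also have "\<dots> = card (carrier E) ^ (card Q div card (\<tau> ` H))"
        using QG.card_coset_invariant_functions[OF group_hom.subgroup_img_is_subgroup[OF group_hom_perm_units[OF k] H],
            of "carrier E"] fQ bE QGs by (simp add: bounded_group_def del: Es)
      also have "card (\<tau> ` H) = card H"
        using Hp perms_maps maps_mono[OF k] by (intro card_image inj_on_subset[OF \<tau>_inj]) blast
      also have "card (carrier E) = card L * card (carrier U)" by (simp add: card_cartesian_product)
      finally show ?thesis by (simp add: mark_def L_def Q_def)
    qed
  qed
qed

end

section \<open>Matching two modules\<close>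

text \<open>
  The possible orders of finite abelian groups with exponent dividing \<open>m\<close>. They are closed under
  products and contain the sizes of all levels, which is what the choice of auxiliary groups
  needs.
\<close>

definition group_size :: "nat \<Rightarrow> nat \<Rightarrow> bool" where
  "group_size m s \<longleftrightarrow> (\<exists>U :: nat monoid. bounded_group m U \<and> card (carrier U) = s)"

lemma finite_nat_code: "finite X \<Longrightarrow> \<exists>j :: 'x \<Rightarrow> nat. inj_on j X"
  using finite_imp_inj_to_nat_seg by blast

lemma group_size_card: "bounded_group m D \<Longrightarrow> group_size m (card (carrier D))"
proof -
  assume D: "bounded_group m D"
  then obtain j :: "_ \<Rightarrow> nat" where j: "inj_on j (carrier D)"
    using finite_nat_code by (auto simp: bounded_group_def)
  have "card (carrier (copy_group j D)) = card (carrier D)"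
    using j by (simp add: copy_group_def card_image)
  then show ?thesis using bounded_group_copy[OF D j] by (auto simp: group_size_def)
qed

lemma group_size_mult: "\<lbrakk>group_size m s; group_size m t\<rbrakk> \<Longrightarrow> group_size m (s * t)"
  using group_size_card[OF bounded_group_prod] by (fastforce simp: group_size_def card_cartesian_product)

lemma group_size_1: "group_size m 1"
proof -
  let ?S = "singleton_group (0::nat)"
  interpret comm_group ?S by simp
  have "x [^]\<^bsub>?S\<^esub> m = \<one>\<^bsub>?S\<^esub>" if "x \<in> carrier ?S" for x
    using nat_pow_closed[OF that, of m] one_closed by simp
  then have "bounded_group m ?S" by (simp add: bounded_group_def)
  from group_size_card[OF this] show ?thesis by simp
qed

lemma group_size_power: "group_size m s \<Longrightarrow> group_size m (s ^ n)"
  by (induction n) (use group_size_1 in \<open>auto intro: group_size_mult\<close>)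

context map_ext
begin

lemma unconstrained_function_module:
  assumes "bounded_group m U" "finite Y"
    and "\<And>a y w. \<lbrakk>a \<in> carrier A; y \<in> Y; \<rho> a y = Some w\<rbrakk> \<Longrightarrow> w \<in> Y"
    and "\<And>a b y. \<lbrakk>a \<in> carrier A; b \<in> carrier A; y \<in> Y\<rbrakk> \<Longrightarrow> \<rho> (a \<otimes> b) y = Option.bind (\<rho> a y) (\<rho> b)"
  shows "function_module A N \<tau> U m Y \<rho> ({} :: unit set) (\<lambda>_ x. x) (\<lambda>_ y. y)"
proof -
  interpret U: comm_group U using assms(1) by (simp add: bounded_group_def)
  show ?thesis
  proof unfold_locales
    show "finite (carrier U)" "\<And>x. x \<in> carrier U \<Longrightarrow> x [^]\<^bsub>U\<^esub> m = \<one>\<^bsub>U\<^esub>"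
      using assms(1) by (auto simp: bounded_group_def)
  qed (rule assms(2) assms(3) assms(4), assumption+ | simp add: assms(2))+
qed

text \<open>Functions on the right regular act of \<open>A\<close> with an identity adjoined.\<close>

lemma faithful_module_exists:
  fixes U :: "('u, 'v) monoid_scheme"
  assumes U: "bounded_group m U" and x: "x \<in> carrier U" "x \<noteq> \<one>\<^bsub>U\<^esub>"
  shows "\<exists>(D :: ('a option \<Rightarrow> 'u) monoid) act. extensible_module m D act \<and> faithful D act"
proof -
  define Y where "Y = insert None (Some ` carrier A)"
  define \<rho> where "\<rho> a y = Some (Some (case y of None \<Rightarrow> a | Some b \<Rightarrow> b \<otimes> a))" for a y
  interpret F: function_module A N \<tau> U m Y \<rho> "{} :: unit set" "\<lambda>_ x. x" "\<lambda>_ y. y"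
    by (rule unconstrained_function_module[OF U]) (use finA in \<open>auto simp: Y_def \<rho>_def m_closed m_assoc split: option.splits\<close>)
  have "faithful F.Fun F.pull"
    unfolding faithful_def
  proof (intro ballI impI)
    fix a b assume ab: "a \<in> carrier A" "b \<in> carrier A" "a \<noteq> b"
    define \<phi> where "\<phi> = (\<lambda>y\<in>Y. if y = Some a then x else \<one>\<^bsub>U\<^esub>)"
    have "\<phi> \<in> carrier F.Fun" using x by (auto simp: F.Fun_iff F.constr_def \<phi>_def)
    moreover have "F.pull a \<phi> None \<noteq> F.pull b \<phi> None"
    proof -
      have "None \<in> Y" "Some a \<in> Y" "Some b \<in> Y" using ab by (auto simp: Y_def)
      then show ?thesis using ab x by (simp add: F.pull_def \<rho>_def \<phi>_def)
    qed
    ultimately show "\<exists>\<phi>\<in>carrier F.Fun. F.pull a \<phi> \<noteq> F.pull b \<phi>" by metis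
  qed
  then show ?thesis using F.act_module_Fun F.extensible_Fun by (auto simp: extensible_module_def)
qed

text \<open>
  Functions on a single point that everything fixes. Multiplying a module by this one multiplies
  all marks by the same number and keeps the spread.
\<close>

lemma trivial_module:
  assumes U: "bounded_group m (U :: nat monoid)"
  shows "\<exists>(Z :: (nat \<Rightarrow> nat) monoid) actZ. extensible_module m Z actZ \<and> spread Z actZ = 1 \<and>
     (\<forall>k H. mark Z actZ k H = card (carrier U))"
proof -
  interpret F: function_module A N \<tau> U m "{0 :: nat}" "\<lambda>_ _. Some 0" "{} :: unit set" "\<lambda>_ x. x" "\<lambda>_ y. y"
    by (rule unconstrained_function_module[OF U]) auto
  interpret G: comm_group F.Fun by (rule F.comm_group_Fun)
  have C: "carrier F.Fun = {0 :: nat} \<rightarrow>\<^sub>E carrier U"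
    by (rule Set.set_eqI) (simp only: F.Fun_iff F.constr_def F.E.finprod_empty simp_thms ball_simps)
  have t: "F.pull a \<phi> = \<phi>" if "\<phi> \<in> carrier F.Fun" for a \<phi>
    using that unfolding C by (intro extensionalityI[of _ "{0 :: nat}"]) (auto simp: F.pull_def PiE_def)
  have "level F.Fun (tact F.pull) k = carrier F.Fun" for k using t by (auto simp: level_def)
  then have "fixed (tact F.pull) H (level F.Fun (tact F.pull) k) = carrier F.Fun" for k H
    using t by (auto simp: fixed_def)
  then have "mark F.Fun F.pull k H = card (carrier U)" for k H
    unfolding mark_def C by (simp add: card_funcsetE)
  moreover have "diffs F.Fun (tact F.pull) = {\<one>\<^bsub>F.Fun\<^esub>}"
  proof -
    have "diffs F.Fun (tact F.pull) \<subseteq> {\<one>\<^bsub>F.Fun\<^esub>}"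
      using t G.r_inv by (auto simp: diffs_def simp del: F.Fun_simps)
    moreover have "diffs F.Fun (tact F.pull) \<noteq> {}"
      using G.one_closed by (auto simp: diffs_def simp del: F.Fun_simps)
    ultimately show ?thesis by blast
  qed
  moreover have "extensible_module m F.Fun F.pull" using F.act_module_Fun F.extensible_Fun by (simp add: extensible_module_def)
  ultimately show ?thesis by (intro exI[of _ F.Fun] exI[of _ F.pull]) (simp add: spread_def)
qed

text \<open>
  Functions on a single point on which nothing is defined. Multiplying a module by this one
  changes the size of the carrier only.
\<close>

lemma null_module:
  assumes U: "bounded_group m (U :: nat monoid)"
  shows "\<exists>(Z :: (nat \<Rightarrow> nat) monoid) actZ. extensible_module m Z actZ \<and> spread Z actZ = 1 \<and>
     (\<forall>k\<le>N. \<forall>H. mark Z actZ k H = 1) \<and> card (carrier Z) = card (carrier U)"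
proof -
  interpret F: function_module A N \<tau> U m "{0 :: nat}" "\<lambda>_ _. None" "{} :: unit set" "\<lambda>_ x. x" "\<lambda>_ y. y"
    by (rule unconstrained_function_module[OF U]) auto
  have extensible_module: "extensible_module m F.Fun F.pull" using F.act_module_Fun F.extensible_Fun by (simp add: extensible_module_def)
  interpret G: transf_module F.Fun N "tact F.pull" by (rule transf_module_extensible[OF extensible_module])
  have C: "carrier F.Fun = {0 :: nat} \<rightarrow>\<^sub>E carrier U"
    by (rule Set.set_eqI) (simp only: F.Fun_iff F.constr_def F.E.finprod_empty simp_thms ball_simps)
  have t: "F.pull a \<phi> = \<one>\<^bsub>F.Fun\<^esub>" for a \<phi> by (simp add: F.pull_def)
  have L: "level F.Fun (tact F.pull) k = {\<one>\<^bsub>F.Fun\<^esub>}" for k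
    using G.one_closed unfolding level_def t by auto
  have "fixed (tact F.pull) H {\<one>\<^bsub>F.Fun\<^esub>} = {\<one>\<^bsub>F.Fun\<^esub>}" for H
    unfolding fixed_def t by auto
  then have "mark F.Fun F.pull k H = 1" for k H unfolding mark_def L by simp
  moreover have "diffs F.Fun (tact F.pull) = {\<one>\<^bsub>F.Fun\<^esub>}"
  proof -
    have "diffs F.Fun (tact F.pull) \<subseteq> {\<one>\<^bsub>F.Fun\<^esub>}" using G.diffs_level[OF N1] unfolding L .
    moreover have "diffs F.Fun (tact F.pull) \<noteq> {}"
      using subgroup.one_closed[OF G.subgroup_diffs[OF N1]] by blast
    ultimately show ?thesis by blast
  qed
  moreover have "card (carrier F.Fun) = card (carrier U)" unfolding C by (simp add: card_funcsetE)
  ultimately show ?thesis using extensible_module by (intro exI[of _ F.Fun] exI[of _ F.pull]) (simp add: spread_def)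
qed

lemma extensible_module_bounded: "extensible_module m D act \<Longrightarrow> bounded_group m D"
  by (simp add: extensible_module_def act_module_iff)

lemma product_on_nat:
  fixes D :: "nat monoid"
  assumes D: "extensible_module m D act" and Z: "extensible_module m Z actZ"
  shows "\<exists>(D' :: nat monoid) act'. extensible_module m D' act' \<and> (faithful D act \<longrightarrow> faithful D' act') \<and>
    (\<forall>k\<le>N. \<forall>H\<subseteq>perms k. mark D' act' k H = mark D act k H * mark Z actZ k H) \<and>
    spread D' act' = spread D act * spread Z actZ \<and>
    card (carrier D') = card (carrier D) * card (carrier Z)"
proof -
  let ?P = "D \<times>\<times> Z" and ?a = "\<lambda>a. map_prod (act a) (actZ a)"
  have P: "extensible_module m ?P ?a" by (rule extensible_module_prod[OF D Z])
  then obtain j :: "_ \<Rightarrow> nat" where j: "inj_on j (carrier ?P)"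
    using finite_nat_code extensible_module_bounded unfolding bounded_group_def by meson
  have "spread ?P ?a = spread D act * spread Z actZ"
    by (rule spread_prod) (use D Z in \<open>auto simp: extensible_module_def\<close>)
  then show ?thesis
    using extensible_module_copy[OF P j] faithful_prod[of D act Z m actZ] Z
    by (intro exI[of _ "copy_group j ?P"] exI[of _ "copy_act j ?P ?a"])
      (auto simp: mark_prod card_cartesian_product extensible_module_def)
qed

lemma card_subgroup_dvd_units:
  assumes k: "k \<le> N" and H: "subgroup H (perm_group k)"
  shows "card H dvd card (Units (corner k))"
proof -
  interpret M: monoid "corner k" by (rule monoid_corner) fact
  interpret QG: group "units_of (corner k)" by (rule M.units_group)
  have "card (\<tau> ` H) dvd card (carrier (units_of (corner k)))"
    using QG.lagrange[OF group_hom.subgroup_img_is_subgroup[OF group_hom_perm_units[OF k] H]]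
    unfolding order_def by (metis dvd_triv_right)
  moreover have "card (\<tau> ` H) = card H"
    using subgroup.subset[OF H] perms_maps maps_mono[OF k]
    by (intro card_image inj_on_subset[OF \<tau>_inj]) auto
  ultimately show ?thesis by (simp add: units_of_carrier)
qed

lemma units_pos: "k \<le> N \<Longrightarrow> 0 < card (Units (corner k))" "card (Units (corner k)) \<le> card (carrier A)"
proof -
  have sub: "Units (corner k) \<subseteq> carrier A" by (auto simp: Units_def)
  then show "card (Units (corner k)) \<le> card (carrier A)" using finA card_mono by blast
  assume k: "k \<le> N"
  interpret M: monoid "corner k" by (rule monoid_corner) fact
  show "0 < card (Units (corner k))"
    using sub finA M.Units_one_closed finite_subset card_gt_0_iff by (metis empty_iff)
qed

lemma clip_subset_perms: "{clip k} \<subseteq> perms k"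
  by (simp add: clip_perms)

lemma card_level_mark: "card (level D (tact act) k) = mark D act k {clip k}"
proof -
  have "fixed (tact act) {clip k} (level D (tact act) k) = level D (tact act) k"
    by (auto simp: fixed_def level_def)
  then show ?thesis by (simp add: mark_def)
qed

lemma mark_pos: "\<lbrakk>extensible_module m D act; k \<le> N; H \<subseteq> perms k\<rbrakk> \<Longrightarrow> 0 < mark D act k H"
proof -
  assume a: "extensible_module m D act" "k \<le> N" "H \<subseteq> perms k"
  interpret transf_module D N "tact act" by (rule transf_module_extensible) fact
  have "\<one>\<^bsub>D\<^esub> \<in> fixed (tact act) H (level D (tact act) k)"
    using a level_one act_one perms_maps maps_mono[of k N] by (auto simp: fixed_def subset_iff)
  moreover have "finite (fixed (tact act) H (level D (tact act) k))"
    using finite_level by (auto simp: fixed_def)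
  ultimately show ?thesis by (auto simp: mark_def card_gt_0_iff)
qed

lemma group_size_level: "\<lbrakk>extensible_module m D act; k \<le> N\<rbrakk> \<Longrightarrow> group_size m (mark D act k {clip k})"
  using group_size_card[OF bounded_subgroup[OF extensible_module_bounded subgroup_level]]
  by (simp add: card_level_mark)

lemma group_size_spread: "extensible_module m D act \<Longrightarrow> group_size m (spread D act)"
proof -
  assume D: "extensible_module m D act"
  interpret transf_module D N "tact act" by (rule transf_module_extensible) fact
  show ?thesis
    using group_size_card[OF bounded_subgroup[OF extensible_module_bounded[OF D] subgroup_diffs[OF N1]]]
    by (simp add: spread_def)
qed

text \<open>
  The level \<open>k\<close> marks depend afterwards only on the order of the subgroup. The size of level 0
  and the spread change by a common factor, also if \<open>k = 0\<close>.
\<close>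

lemma free_step:
  fixes D :: "nat monoid"
  assumes D: "extensible_module m D act" and k: "k \<le> N" and s: "group_size m s"
    and tw: "t * card (Units (corner k)) = m * w + 1"
  shows "\<exists>(D' :: nat monoid) act'. extensible_module m D' act' \<and> (faithful D act \<longrightarrow> faithful D' act') \<and>
    (\<forall>j<k. \<forall>H\<subseteq>perms j. mark D' act' j H = mark D act j H) \<and>
    (\<forall>H. subgroup H (perm_group k) \<longrightarrow>
       mark D' act' k H = (mark D act k {clip k} * s) ^ (card (Units (corner k)) div card H)) \<and>
    (\<exists>z>0. spread D' act' = spread D act * z \<and> mark D' act' 0 {clip 0} = mark D act 0 {clip 0} * z)"
proof -
  obtain U :: "nat monoid" where U: "bounded_group m U" "card (carrier U) = s"
    using s by (auto simp: group_size_def)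
  obtain Z :: "('a \<Rightarrow> nat \<times> nat) monoid" and actZ where Z: "extensible_module m Z actZ"
    "\<And>j H. \<lbrakk>j < k; H \<subseteq> perms j\<rbrakk> \<Longrightarrow> mark Z actZ j H = 1"
    "\<And>H. subgroup H (perm_group k) \<Longrightarrow> mark D act k H * mark Z actZ k H =
       (card (level D (tact act) k) * card (carrier U)) ^ (card (Units (corner k)) div card H)"
    "0 < k \<Longrightarrow> spread Z actZ = 1" "k = 0 \<Longrightarrow> spread Z actZ = card (level Z (tact actZ) 0)"
    using free_level_adjustment[OF D k U(1) tw] by metis
  obtain D' :: "nat monoid" and act' where D': "extensible_module m D' act'" "faithful D act \<longrightarrow> faithful D' act'"
    "\<forall>k\<le>N. \<forall>H\<subseteq>perms k. mark D' act' k H = mark D act k H * mark Z actZ k H"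
    "spread D' act' = spread D act * spread Z actZ"
    using product_on_nat[OF D Z(1)] by blast
  have "spread Z actZ = mark Z actZ 0 {clip 0}"
    using Z(2)[OF _ clip_subset_perms] Z(4,5) by (cases "k = 0") (auto simp: card_level_mark)
  then have "\<exists>z>0. spread D' act' = spread D act * z \<and> mark D' act' 0 {clip 0} = mark D act 0 {clip 0} * z"
    using D'(3,4) mark_pos[OF Z(1) _ clip_subset_perms, of 0] clip_subset_perms[of 0] by auto
  moreover have "mark D' act' k H = (mark D act k {clip k} * s) ^ (card (Units (corner k)) div card H)"
    if H: "subgroup H (perm_group k)" for H
    using D'(3) Z(3)[OF H] subgroup.subset[OF H] k U(2) by (simp add: card_level_mark)
  ultimately show ?thesis
    using D' Z(2) k by (intro exI[of _ D'] exI[of _ act']) auto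
qed

end

lemma coprime_multiplier:
  assumes "0 < n" "n dvd M" "0 < M" shows "\<exists>t w. t * n = Suc M * w + 1"
proof -
  have "(M div n * M) * n = M * M" using assms(2) by (metis dvd_div_mult_self mult.commute mult.assoc)
  also have "\<dots> = Suc M * (M - 1) + 1" using assms(3) by (cases M) auto
  finally show ?thesis by blast
qed

locale two_map_ext = X1: map_ext A1 N \<tau>1 + X2: map_ext A2 N \<tau>2
  for A1 :: "('a, 'b) monoid_scheme" and N \<tau>1 and A2 :: "('c, 'd) monoid_scheme" and \<tau>2
begin

text \<open>This number is prime to the orders of all unit groups of corners in both semigroups.\<close>

definition modulus :: nat where "modulus = Suc (fact (card (carrier A1)) * fact (card (carrier A2)))"

text \<open>
  The last condition fixes the ratio of the size of level 0 to the spread. Every adjustment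
  multiplies both by the same factor, so the ratio has to be right from the beginning, and once
  the sizes of level 0 agree, the spreads agree.
\<close>

definition matched where
  "matched k D1 a1 D2 a2 \<longleftrightarrow>
     X1.extensible_module modulus D1 a1 \<and> X2.extensible_module modulus D2 a2 \<and> X1.faithful D1 a1 \<and> X2.faithful D2 a2 \<and>
     (\<forall>j<k. \<forall>H. subgroup H (perm_group j) \<longrightarrow> X1.mark D1 a1 j H = X2.mark D2 a2 j H) \<and>
     X1.mark D1 a1 0 {clip 0} * X2.spread D2 a2 = X2.mark D2 a2 0 {clip 0} * X1.spread D1 a1"

text \<open>The ratio is corrected by multiplying each module by a trivial one.\<close>

lemma matched_start: "\<exists>(D1 :: nat monoid) a1 (D2 :: nat monoid) a2. matched 0 D1 a1 D2 a2"
proof -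
  let ?K = "integer_mod_group modulus"
  have "0 < modulus" by (simp add: modulus_def)
  then have K: "bounded_group modulus ?K"
    by (auto simp: bounded_group_def carrier_integer_mod_group)
  have x: "1 \<in> carrier ?K" "1 \<noteq> \<one>\<^bsub>?K\<^esub>" by (auto simp: modulus_def carrier_integer_mod_group)
  obtain E1 :: "('a option \<Rightarrow> int) monoid" and b1 where E1: "X1.extensible_module modulus E1 b1" "X1.faithful E1 b1"
    using X1.faithful_module_exists[OF K x] by blast
  obtain E2 :: "('c option \<Rightarrow> int) monoid" and b2 where E2: "X2.extensible_module modulus E2 b2" "X2.faithful E2 b2"
    using X2.faithful_module_exists[OF K x] by blast
  obtain j1 :: "_ \<Rightarrow> nat" where j1: "inj_on j1 (carrier E1)"
    using finite_nat_code[of "carrier E1"] X1.extensible_module_bounded[OF E1(1)] by (auto simp: bounded_group_def)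
  obtain j2 :: "_ \<Rightarrow> nat" where j2: "inj_on j2 (carrier E2)"
    using finite_nat_code[of "carrier E2"] X2.extensible_module_bounded[OF E2(1)] by (auto simp: bounded_group_def)
  define F1 where "F1 = copy_group j1 E1" define c1 where "c1 = copy_act j1 E1 b1"
  define F2 where "F2 = copy_group j2 E2" define c2 where "c2 = copy_act j2 E2 b2"
  have F1: "X1.extensible_module modulus F1 c1" "X1.faithful F1 c1"
    using X1.extensible_module_copy(1,5)[OF E1(1) j1] E1(2) by (auto simp: F1_def c1_def)
  have F2: "X2.extensible_module modulus F2 c2" "X2.faithful F2 c2"
    using X2.extensible_module_copy(1,5)[OF E2(1) j2] E2(2) by (auto simp: F2_def c2_def)
  let ?m1 = "X1.mark F1 c1 0 {clip 0}" and ?m2 = "X2.mark F2 c2 0 {clip 0}"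
  have "group_size modulus (?m2 * X1.spread F1 c1)" "group_size modulus (?m1 * X2.spread F2 c2)"
    using X1.group_size_level[OF F1(1), of 0] X2.group_size_level[OF F2(1), of 0]
      X1.group_size_spread[OF F1(1)] X2.group_size_spread[OF F2(1)] by (auto intro: group_size_mult)
  then obtain U1 U2 :: "nat monoid" where
    U1: "bounded_group modulus U1" "card (carrier U1) = ?m2 * X1.spread F1 c1" and
    U2: "bounded_group modulus U2" "card (carrier U2) = ?m1 * X2.spread F2 c2"
    unfolding group_size_def by blast
  obtain Z1 :: "(nat \<Rightarrow> nat) monoid" and z1 where Z1: "X1.extensible_module modulus Z1 z1" "X1.spread Z1 z1 = 1"
    "\<forall>k H. X1.mark Z1 z1 k H = card (carrier U1)" using X1.trivial_module[OF U1(1)] by blast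
  obtain Z2 :: "(nat \<Rightarrow> nat) monoid" and z2 where Z2: "X2.extensible_module modulus Z2 z2" "X2.spread Z2 z2 = 1"
    "\<forall>k H. X2.mark Z2 z2 k H = card (carrier U2)" using X2.trivial_module[OF U2(1)] by blast
  obtain D1 :: "nat monoid" and a1 where D1: "X1.extensible_module modulus D1 a1" "X1.faithful D1 a1"
    "\<forall>k\<le>N. \<forall>H\<subseteq>perms k. X1.mark D1 a1 k H = X1.mark F1 c1 k H * X1.mark Z1 z1 k H"
    "X1.spread D1 a1 = X1.spread F1 c1 * X1.spread Z1 z1"
    using X1.product_on_nat[OF F1(1) Z1(1)] F1(2) by blast
  obtain D2 :: "nat monoid" and a2 where D2: "X2.extensible_module modulus D2 a2" "X2.faithful D2 a2"
    "\<forall>k\<le>N. \<forall>H\<subseteq>perms k. X2.mark D2 a2 k H = X2.mark F2 c2 k H * X2.mark Z2 z2 k H"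
    "X2.spread D2 a2 = X2.spread F2 c2 * X2.spread Z2 z2"
    using X2.product_on_nat[OF F2(1) Z2(1)] F2(2) by blast
  have "X1.mark D1 a1 0 {clip 0} * X2.spread D2 a2 = X2.mark D2 a2 0 {clip 0} * X1.spread D1 a1"
    using D1(3,4) D2(3,4) Z1(2,3) Z2(2,3) U1(2) U2(2) X1.clip_subset_perms[of 0] by (simp add: ac_simps)
  then show ?thesis using D1 D2 unfolding matched_def by blast
qed

text \<open>
  The marks at \<open>H\<close> become \<open>(c1 * s1) ^ (n1 / card H)\<close> and \<open>(c2 * s2) ^ (n2 / card H)\<close>, where
  \<open>c1, c2\<close> are the sizes of the levels, \<open>n1, n2\<close> the orders of the unit groups and \<open>s1, s2\<close> can
  be chosen. They agree for all \<open>H\<close> if \<open>c1 * s1 = x ^ n2\<close> and \<open>c2 * s2 = x ^ n1\<close>; take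
  \<open>x = c1 * c2\<close>.
\<close>

lemma matched_step:
  fixes D1 D2 :: "nat monoid"
  assumes M: "matched k D1 a1 D2 a2" and k: "k \<le> N"
  shows "\<exists>(D1 :: nat monoid) a1 (D2 :: nat monoid) a2. matched (Suc k) D1 a1 D2 a2"
proof -
  let ?c1 = "X1.mark D1 a1 k {clip k}" and ?c2 = "X2.mark D2 a2 k {clip k}"
  let ?n1 = "card (Units (X1.corner k))" and ?n2 = "card (Units (X2.corner k))"
  have n1: "X1.extensible_module modulus D1 a1" and n2: "X2.extensible_module modulus D2 a2" using M by (auto simp: matched_def)
  have p1: "0 < ?n1" and p2: "0 < ?n2" using X1.units_pos(1)[OF k] X2.units_pos(1)[OF k] by auto
  have "?n1 dvd fact (card (carrier A1)) * fact (card (carrier A2))"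
    using dvd_fact[of ?n1 "card (carrier A1)"] p1 X1.units_pos(2)[of k] by (simp add: dvd_mult2)
  then obtain t1 w1 where tw1: "t1 * ?n1 = modulus * w1 + 1"
    using coprime_multiplier[OF p1] unfolding modulus_def by force
  have "?n2 dvd fact (card (carrier A1)) * fact (card (carrier A2))"
    using dvd_fact[of ?n2 "card (carrier A2)"] p2 X2.units_pos(2)[of k] by (simp add: dvd_mult)
  then obtain t2 w2 where tw2: "t2 * ?n2 = modulus * w2 + 1"
    using coprime_multiplier[OF p2] unfolding modulus_def by force
  have g: "group_size modulus ?c1" "group_size modulus ?c2"
    using X1.group_size_level[OF n1 k] X2.group_size_level[OF n2 k] by auto
  \<comment> \<open>These are the orders with \<open>c1 * s1 = (c1 * c2) ^ n2\<close> and \<open>c2 * s2 = (c1 * c2) ^ n1\<close>;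
    products of level sizes are orders of admissible groups.\<close>
  let ?s1 = "?c1 ^ (?n2 - 1) * ?c2 ^ ?n2" and ?s2 = "?c2 ^ (?n1 - 1) * ?c1 ^ ?n1"
  have s: "group_size modulus ?s1" "group_size modulus ?s2"
    using g by (auto intro: group_size_mult group_size_power)
  have c1: "?c1 * ?s1 = (?c1 * ?c2) ^ ?n2"
    using p2 by (cases ?n2) (simp_all add: power_mult_distrib)
  have c2: "?c2 * ?s2 = (?c1 * ?c2) ^ ?n1"
    using p1 by (cases ?n1) (simp_all add: power_mult_distrib)
  obtain D1' :: "nat monoid" and a1' z1 where D1': "X1.extensible_module modulus D1' a1'"
    "X1.faithful D1 a1 \<longrightarrow> X1.faithful D1' a1'"
    "\<forall>j<k. \<forall>H\<subseteq>perms j. X1.mark D1' a1' j H = X1.mark D1 a1 j H"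
    "\<forall>H. subgroup H (perm_group k) \<longrightarrow> X1.mark D1' a1' k H = (?c1 * ?s1) ^ (?n1 div card H)"
    "z1 > 0" "X1.spread D1' a1' = X1.spread D1 a1 * z1" "X1.mark D1' a1' 0 {clip 0} = X1.mark D1 a1 0 {clip 0} * z1"
    using X1.free_step[OF n1 k s(1) tw1] by blast
  obtain D2' :: "nat monoid" and a2' z2 where D2': "X2.extensible_module modulus D2' a2'"
    "X2.faithful D2 a2 \<longrightarrow> X2.faithful D2' a2'"
    "\<forall>j<k. \<forall>H\<subseteq>perms j. X2.mark D2' a2' j H = X2.mark D2 a2 j H"
    "\<forall>H. subgroup H (perm_group k) \<longrightarrow> X2.mark D2' a2' k H = (?c2 * ?s2) ^ (?n2 div card H)"
    "z2 > 0" "X2.spread D2' a2' = X2.spread D2 a2 * z2" "X2.mark D2' a2' 0 {clip 0} = X2.mark D2 a2 0 {clip 0} * z2"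
    using X2.free_step[OF n2 k s(2) tw2] by blast
  have "X1.mark D1' a1' j H = X2.mark D2' a2' j H" if j: "j < Suc k" and H: "subgroup H (perm_group j)" for j H
  proof (cases "j = k")
    case True
    then have Hk: "subgroup H (perm_group k)" using H by simp
    obtain q1 q2 where q: "?n1 = card H * q1" "?n2 = card H * q2"
      using X1.card_subgroup_dvd_units[OF k Hk] X2.card_subgroup_dvd_units[OF k Hk] by (auto elim!: dvdE)
    have "0 < card H" using q p1 by (metis mult_0 neq0_conv)
    then have "?n2 * (?n1 div card H) = ?n1 * (?n2 div card H)" using q by simp
    then show ?thesis
      using D1'(4) D2'(4) Hk True unfolding c1 c2 by (simp flip: power_mult)
  next
    case False
    then have "j < k" "H \<subseteq> perms j" using j subgroup.subset[OF H] by auto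
    then show ?thesis using D1'(3) D2'(3) M H by (simp add: matched_def)
  qed
  moreover have "X1.mark D1' a1' 0 {clip 0} * X2.spread D2' a2' = X2.mark D2' a2' 0 {clip 0} * X1.spread D1' a1'"
  proof -
    have "X1.mark D1 a1 0 {clip 0} * X2.spread D2 a2 = X2.mark D2 a2 0 {clip 0} * X1.spread D1 a1"
      using M by (simp add: matched_def)
    then have "(X1.mark D1 a1 0 {clip 0} * X2.spread D2 a2) * (z1 * z2) =
        (X2.mark D2 a2 0 {clip 0} * X1.spread D1 a1) * (z1 * z2)" by simp
    then show ?thesis using D1'(6,7) D2'(6,7) by (simp only: ac_simps)
  qed
  ultimately have "matched (Suc k) D1' a1' D2' a2'" using D1' D2' M unfolding matched_def by blast
  then show ?thesis by blast
qed

text \<open>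
  After all levels are matched the carriers may still have different sizes. Multiplying each
  module by a null module of the size of the other one repairs this without changing any level.
\<close>

theorem common_faithful_set:
  obtains D1 D2 :: "nat monoid" and a1 a2 \<Psi> where
    "X1.extensible_module modulus D1 a1" "X2.extensible_module modulus D2 a2" "X1.faithful D1 a1" "X2.faithful D2 a2"
    "bij_betw \<Psi> (carrier D1) (carrier D2)"
    "\<And>f x. \<lbrakk>f \<in> maps N; x \<in> carrier D1\<rbrakk> \<Longrightarrow> \<Psi> (a1 (\<tau>1 f) x) = a2 (\<tau>2 f) (\<Psi> x)"
proof -
  have "\<exists>(D1 :: nat monoid) a1 (D2 :: nat monoid) a2. matched k D1 a1 D2 a2" if "k \<le> Suc N" for k
    using that
  proof (induction k)
    case 0
    then show ?case using matched_start by blast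
  next
    case (Suc k)
    then obtain D1 a1 D2 a2 where "matched k (D1 :: nat monoid) a1 (D2 :: nat monoid) a2" by auto
    then show ?case using matched_step Suc.prems by auto
  qed
  then obtain E1 b1 E2 b2 where M: "matched (Suc N) (E1 :: nat monoid) b1 (E2 :: nat monoid) b2" by blast
  have E: "X1.extensible_module modulus E1 b1" "X2.extensible_module modulus E2 b2" "X1.faithful E1 b1" "X2.faithful E2 b2"
    using M by (auto simp: matched_def)
  obtain Z1 :: "(nat \<Rightarrow> nat) monoid" and z1 where Z1: "X1.extensible_module modulus Z1 z1" "X1.spread Z1 z1 = 1"
     "\<forall>k\<le>N. \<forall>H. X1.mark Z1 z1 k H = 1" "card (carrier Z1) = card (carrier E2)"
    using X1.null_module[OF X2.extensible_module_bounded[OF E(2)]] by blast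
  obtain Z2 :: "(nat \<Rightarrow> nat) monoid" and z2 where Z2: "X2.extensible_module modulus Z2 z2" "X2.spread Z2 z2 = 1"
     "\<forall>k\<le>N. \<forall>H. X2.mark Z2 z2 k H = 1" "card (carrier Z2) = card (carrier E1)"
    using X2.null_module[OF X1.extensible_module_bounded[OF E(1)]] by blast
  obtain D1 :: "nat monoid" and a1 where D1: "X1.extensible_module modulus D1 a1" "X1.faithful D1 a1"
    "\<forall>k\<le>N. \<forall>H\<subseteq>perms k. X1.mark D1 a1 k H = X1.mark E1 b1 k H * X1.mark Z1 z1 k H"
    "X1.spread D1 a1 = X1.spread E1 b1 * X1.spread Z1 z1" "card (carrier D1) = card (carrier E1) * card (carrier Z1)"
    using X1.product_on_nat[OF E(1) Z1(1)] E(3) by blast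
  obtain D2 :: "nat monoid" and a2 where D2: "X2.extensible_module modulus D2 a2" "X2.faithful D2 a2"
    "\<forall>k\<le>N. \<forall>H\<subseteq>perms k. X2.mark D2 a2 k H = X2.mark E2 b2 k H * X2.mark Z2 z2 k H"
    "X2.spread D2 a2 = X2.spread E2 b2 * X2.spread Z2 z2" "card (carrier D2) = card (carrier E2) * card (carrier Z2)"
    using X2.product_on_nat[OF E(2) Z2(1)] E(4) by blast
  have t0: "subgroup {clip k} (perm_group k)" for k
    using group.triv_subgroup[OF group_perm_group, of k] by simp
  have "X1.mark E1 b1 0 {clip 0} = X2.mark E2 b2 0 {clip 0}"
    using M t0[of 0] by (simp add: matched_def)
  then have sp: "X1.spread E1 b1 = X2.spread E2 b2"
    using M X1.mark_pos[OF E(1) _ X1.clip_subset_perms, of 0] by (simp add: matched_def)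
  have mk: "X1.mark D1 a1 k H = X2.mark D2 a2 k H" if "k \<le> N" "subgroup H (perm_group k)" for k H
    using that M D1(3) D2(3) Z1(3) Z2(3) subgroup.subset[OF that(2)] by (simp add: matched_def)
  have "\<exists>\<Psi>. bij_betw \<Psi> (carrier D1) (carrier D2) \<and>
    (\<forall>f\<in>maps N. \<forall>x\<in>carrier D1. \<Psi> (a1 (\<tau>1 f) x) = a2 (\<tau>2 f) (\<Psi> x))"
  proof (rule equivariant_bijection[OF X1.transf_module_extensible[OF D1(1)] X2.transf_module_extensible[OF D2(1)] X1.N1])
    show "extensible D1 N (X1.tact a1)" "extensible D2 N (X2.tact a2)"
      using D1(1) D2(1) by (auto simp: X1.extensible_module_def X2.extensible_module_def)
    show "card (diffs D1 (X1.tact a1)) = card (diffs D2 (X2.tact a2))"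
      using sp D1(4) D2(4) Z1(2) Z2(2) by (simp add: X1.spread_def X2.spread_def)
    show "card (carrier D1) = card (carrier D2)" using D1(5) D2(5) Z1(4) Z2(4) by simp
  qed (use mk in \<open>auto simp: X1.mark_def X2.mark_def\<close>)
  then show thesis using that D1 D2 by blast
qed

end

section \<open>Full transformation semigroups are amalgamation bases\<close>

lemma mon_iff:
  "f \<in> mon G H \<longleftrightarrow> (\<forall>x\<in>carrier G. f x \<in> carrier H) \<and>
     (\<forall>x\<in>carrier G. \<forall>y\<in>carrier G. f (x \<otimes>\<^bsub>G\<^esub> y) = f x \<otimes>\<^bsub>H\<^esub> f y) \<and> inj_on f (carrier G)"
  by (auto simp: mon_def hom_def Pi_iff)

lemma mon_comp: "\<lbrakk>f \<in> mon G H; g \<in> mon H K\<rbrakk> \<Longrightarrow> g \<circ> f \<in> mon G K"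
  by (auto simp: mon_iff inj_on_def)

lemma iso_mon: "f \<in> iso G H \<Longrightarrow> f \<in> mon G H"
  by (simp add: iso_iff_mon_epi)

lemma mon_closed: "\<lbrakk>f \<in> mon G H; x \<in> carrier G\<rbrakk> \<Longrightarrow> f x \<in> carrier H"
  by (simp add: mon_iff)

lemma mon_mult:
  "\<lbrakk>f \<in> mon G H; x \<in> carrier G; y \<in> carrier G\<rbrakk> \<Longrightarrow> f (x \<otimes>\<^bsub>G\<^esub> y) = f x \<otimes>\<^bsub>H\<^esub> f y"
  by (simp add: mon_iff)

lemma mon_eq_iff: "\<lbrakk>f \<in> mon G H; x \<in> carrier G; y \<in> carrier G\<rbrakk> \<Longrightarrow> f x = f y \<longleftrightarrow> x = y"
  by (auto simp: mon_iff dest: inj_onD)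

lemma iso_inverse:
  assumes S: "semigrp S" and f: "f \<in> iso S T"
  shows "inv_into (carrier S) f \<in> iso T S"
proof -
  interpret semigrp S by fact
  have b: "bij_betw f (carrier S) (carrier T)" using f by (simp add: iso_def)
  have i: "f (inv_into (carrier S) f y) = y" "inv_into (carrier S) f y \<in> carrier S" if "y \<in> carrier T" for y
    using b that by (auto simp: bij_betw_def f_inv_into_f inv_into_into)
  have "inv_into (carrier S) f (x \<otimes>\<^bsub>T\<^esub> y) = inv_into (carrier S) f x \<otimes>\<^bsub>S\<^esub> inv_into (carrier S) f y"
    if "x \<in> carrier T" "y \<in> carrier T" for x y
  proof -
    have "f (inv_into (carrier S) f x \<otimes>\<^bsub>S\<^esub> inv_into (carrier S) f y) = x \<otimes>\<^bsub>T\<^esub> y"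
      using hom_mult[of f S T, OF _ i(2)[OF that(1)] i(2)[OF that(2)]] i(1) that f by (simp add: iso_def)
    then show ?thesis using i that m_closed b by (metis bij_betw_inv_into_left)
  qed
  then show ?thesis using i bij_betw_inv_into[OF b] by (auto simp: iso_def hom_def)
qed

lemma copy_group_iso: "inj_on j (carrier S) \<Longrightarrow> semigrp S \<Longrightarrow> j \<in> iso S (copy_group j S)"
  unfolding iso_def hom_def copy_group_def by (auto simp: bij_betw_def semigrp.m_closed)

lemma semigrp_iso:
  assumes S: "semigrp S" and f: "f \<in> epi S T"
  shows "semigrp T"
proof -
  interpret semigrp S by fact
  have im: "carrier T = f ` carrier S" and h: "f \<in> hom S T" using f by (auto simp: epi_def)
  show ?thesis
    using nonempty h by unfold_locales (auto simp: im m_closed m_assoc simp flip: hom_mult[OF h])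
qed

lemma semigrp_copy: "inj_on j (carrier S) \<Longrightarrow> semigrp S \<Longrightarrow> semigrp (copy_group j S)"
  by (rule semigrp_iso) (use copy_group_iso[of j S] in \<open>auto simp: iso_iff_mon_epi\<close>)

lemma finite_semigrp_nat_copy:
  assumes "finite_semigrp S"
  obtains T :: "nat monoid" and j where "finite_semigrp T" "j \<in> iso S T"
proof -
  obtain j :: "_ \<Rightarrow> nat" where j: "inj_on j (carrier S)"
    using finite_nat_code assms by (auto simp: finite_semigrp_def)
  then show thesis
    using that[of "copy_group j S" j] assms semigrp_copy[OF j] copy_group_iso[OF j]
    by (simp add: finite_semigrp_def copy_group_def)
qed

lemma semigrp_restrict: "\<lbrakk>semigrp S; subsemigrp H S\<rbrakk> \<Longrightarrow> semigrp (S\<lparr>carrier := H\<rparr>)"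
  unfolding semigrp_def subsemigrp_def by (auto simp: subset_iff)

lemma full_transf_simps [simp]:
  "carrier (full_transf n) = {1..n} \<rightarrow>\<^sub>E {1..n}" "f \<otimes>\<^bsub>full_transf n\<^esub> g = compose {1..n} g f"
  by (simp_all add: full_transf_def)

lemma finite_semigrp_full_transf: "finite_semigrp (full_transf n)"
proof -
  have "semigrp (full_transf n)"
  proof
    show "carrier (full_transf n) \<noteq> {}" by (auto simp: PiE_eq_empty_iff)
    show "f \<otimes>\<^bsub>full_transf n\<^esub> g \<in> carrier (full_transf n)"
      if "f \<in> carrier (full_transf n)" "g \<in> carrier (full_transf n)" for f g
      using that by (auto simp: compose_def PiE_iff)
    show "f \<otimes>\<^bsub>full_transf n\<^esub> g \<otimes>\<^bsub>full_transf n\<^esub> h = f \<otimes>\<^bsub>full_transf n\<^esub> (g \<otimes>\<^bsub>full_transf n\<^esub> h)"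
      if "f \<in> carrier (full_transf n)" for f g h
      using that by (auto simp: compose_def PiE_iff intro!: restrict_ext)
  qed
  then show ?thesis by (auto simp: finite_semigrp_def intro: finite_PiE)
qed

text \<open>
  The right regular representation on the semigroup with an identity adjoined, extended by fixed
  points.
\<close>

lemma embeds_in_full_transf:
  assumes T: "finite_semigrp T" and n: "card (carrier T) < n"
  shows "\<exists>u. u \<in> mon T (full_transf n)"
proof -
  interpret semigrp T using T by (simp add: finite_semigrp_def)
  have fT: "finite (carrier T)" using T by (simp add: finite_semigrp_def)
  define X where "X = insert None (Some ` carrier T)"
  have fX: "finite X" using fT by (simp add: X_def)
  have "card X = Suc (card (carrier T))" using fT by (simp add: X_def card_image)
  then have "card X \<le> card {1..n}" using n by simp
  then obtain c where c: "c ` X \<subseteq> {1..n}" "inj_on c X"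
    using card_le_inj[OF fX, of "{1..n}"] by auto
  define d where "d = inv_into X c"
  have d: "d (c z) = z" if "z \<in> X" for z using c that by (simp add: d_def)
  define r where "r a z = Some (case z of None \<Rightarrow> a | Some b \<Rightarrow> b \<otimes>\<^bsub>T\<^esub> a)" for a z
  have rX: "r a z \<in> X" if "a \<in> carrier T" "z \<in> X" for a z
    using that m_closed by (auto simp: r_def X_def split: option.splits)
  define u where "u a = (\<lambda>i\<in>{1..n}. if i \<in> c ` X then c (r a (d i)) else i)" for a
  have u: "u a (c z) = c (r a z)" if "z \<in> X" for a z
    using that c d by (auto simp: u_def)
  have "u \<in> mon T (full_transf n)"
    unfolding mon_iff
  proof (intro conjI ballI inj_onI)
    show "u a \<in> carrier (full_transf n)" if a: "a \<in> carrier T" for a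
      using c rX[OF a] d by (auto simp: u_def image_subset_iff)
    show "u (a \<otimes>\<^bsub>T\<^esub> b) = u a \<otimes>\<^bsub>full_transf n\<^esub> u b" if ab: "a \<in> carrier T" "b \<in> carrier T" for a b
    proof -
      have "u (a \<otimes>\<^bsub>T\<^esub> b) i = u b (u a i)" if i: "i \<in> {1..n}" for i
      proof (cases "i \<in> c ` X")
        case True
        then obtain z where z: "z \<in> X" "i = c z" by blast
        have "r (a \<otimes>\<^bsub>T\<^esub> b) z = r b (r a z)"
          using ab z m_assoc by (auto simp: r_def X_def)
        then show ?thesis using u[OF z(1)] u[OF rX[OF ab(1) z(1)]] z by simp
      next
        case False
        then show ?thesis using i by (simp add: u_def)
      qed
      moreover have "u (a \<otimes>\<^bsub>T\<^esub> b) \<in> extensional {1..n}" by (simp add: u_def)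
      ultimately show ?thesis
        by (intro extensionalityI[of _ "{1..n}"]) (auto simp: compose_def)
    qed
    show "a = b" if "a \<in> carrier T" "b \<in> carrier T" "u a = u b" for a b
    proof -
      have N: "None \<in> X" by (simp add: X_def)
      have "c (r a None) = c (r b None)" using u[OF N, of a] u[OF N, of b] that by simp
      then have "r a None = r b None" using c(2) rX N that by (auto dest: inj_onD)
      then show ?thesis by (simp add: r_def)
    qed
  qed
  then show ?thesis by blast
qed

text \<open>Transport from \<open>{0..k}\<close> to \<open>{1..k + 1}\<close>.\<close>

definition shifted :: "nat \<Rightarrow> (nat \<Rightarrow> nat) \<Rightarrow> nat \<Rightarrow> nat" where
  "shifted k f = (\<lambda>i\<in>{1..Suc k}. Suc (f (i - 1)))"

lemma shifted_comp:
  "\<lbrakk>f \<in> maps k; g \<in> maps k\<rbrakk> \<Longrightarrow> shifted k (g \<circ> f) = shifted k f \<otimes>\<^bsub>full_transf (Suc k)\<^esub> shifted k g"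
  by (auto simp: shifted_def compose_def maps_le intro!: restrict_ext)

lemma bij_shifted: "bij_betw (shifted k) (maps k) (carrier (full_transf (Suc k)))"
proof (rule bij_betw_byWitness[where f' = "\<lambda>F i. F (Suc (min i k)) - 1"])
  show "\<forall>f\<in>maps k. (\<lambda>i. shifted k f (Suc (min i k)) - 1) = f"
    by (auto simp: shifted_def maps_min fun_eq_iff)
  show "\<forall>F\<in>carrier (full_transf (Suc k)). shifted k (\<lambda>i. F (Suc (min i k)) - 1) = F"
  proof
    fix F assume F: "F \<in> carrier (full_transf (Suc k))"
    then have "1 \<le> F i" if "1 \<le> i" "i \<le> Suc k" for i using that by (auto simp: PiE_iff)
    then have "Suc (F i - 1) = F i" if "1 \<le> i" "i \<le> Suc k" for i using that by force
    then show "shifted k (\<lambda>i. F (Suc (min i k)) - 1) = F"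
      using F by (intro extensionalityI[of _ "{1..Suc k}"]) (auto simp: shifted_def PiE_iff min_absorb1)
  qed
  show "shifted k ` maps k \<subseteq> carrier (full_transf (Suc k))"
    by (auto simp: shifted_def maps_le)
  show "(\<lambda>F i. F (Suc (min i k)) - 1) ` carrier (full_transf (Suc k)) \<subseteq> maps k"
  proof (rule image_subsetI)
    fix F assume F: "F \<in> carrier (full_transf (Suc k))"
    have "F (Suc (min i k)) \<in> {1..Suc k}" for i using F by (auto simp: PiE_iff)
    then show "(\<lambda>i. F (Suc (min i k)) - 1) \<in> maps k"
      by (auto simp: maps_iff le_diff_conv)
  qed
qed

lemma map_ext_of_mon:
  assumes A: "finite_semigrp A" and f: "f \<in> mon (full_transf (Suc N)) A" and N: "1 \<le> N"
  shows "map_ext A N (f \<circ> shifted N)"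
proof -
  interpret semigrp A using A by (simp add: finite_semigrp_def)
  have s: "shifted N g \<in> carrier (full_transf (Suc N))" if "g \<in> maps N" for g
    using bij_shifted that bij_betwE by blast
  show ?thesis
  proof
    show "finite (carrier A)" using A by (simp add: finite_semigrp_def)
    show "(f \<circ> shifted N) g \<in> carrier A" if "g \<in> maps N" for g
      using mon_closed[OF f s[OF that]] by simp
    show "(f \<circ> shifted N) (h \<circ> g) = (f \<circ> shifted N) g \<otimes>\<^bsub>A\<^esub> (f \<circ> shifted N) h"
      if "g \<in> maps N" "h \<in> maps N" for g h
      using mon_mult[OF f s[OF that(1)] s[OF that(2)]] shifted_comp[OF that] by simp
    show "inj_on (f \<circ> shifted N) (maps N)"
      using bij_shifted[of N] f by (auto simp: mon_iff bij_betw_def intro: comp_inj_on)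
  qed (rule N)
qed

text \<open>
  Both semigroups act faithfully on the set of \<open>common_faithful_set\<close>, and the two actions agree
  on the common subsemigroup; the amalgam is the semigroup of all self-maps of this set,
  composed so that left actions become homomorphisms.
\<close>

theorem full_transf_amalgam:
  assumes n: "2 \<le> n" and A1: "finite_semigrp A1" and A2: "finite_semigrp A2"
    and f1: "f1 \<in> mon (full_transf n) A1" and f2: "f2 \<in> mon (full_transf n) A2"
  obtains B :: "nat monoid" and g1 g2 where "finite_semigrp B" "g1 \<in> mon A1 B" "g2 \<in> mon A2 B"
    "\<And>x. x \<in> carrier (full_transf n) \<Longrightarrow> g1 (f1 x) = g2 (f2 x)"
proof -
  obtain N where N: "n = Suc N" "1 \<le> N" using n by (cases n) auto
  interpret two_map_ext A1 N "f1 \<circ> shifted N" A2 "f2 \<circ> shifted N"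
    using map_ext_of_mon[OF A1 f1[unfolded N(1)] N(2)] map_ext_of_mon[OF A2 f2[unfolded N(1)] N(2)]
    by (simp add: two_map_ext_def)
  obtain D1 D2 :: "nat monoid" and a1 a2 \<Psi> where D: "X1.extensible_module modulus D1 a1" "X2.extensible_module modulus D2 a2"
    "X1.faithful D1 a1" "X2.faithful D2 a2"
    and \<Psi>: "bij_betw \<Psi> (carrier D1) (carrier D2)"
    "\<And>f x. \<lbrakk>f \<in> maps N; x \<in> carrier D1\<rbrakk> \<Longrightarrow> \<Psi> (a1 ((f1 \<circ> shifted N) f) x) = a2 ((f2 \<circ> shifted N) f) (\<Psi> x)"
    by (rule common_faithful_set) (rule that; assumption)
  interpret D1: act_module A1 D1 modulus a1 using D(1) by (simp add: X1.extensible_module_def)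
  interpret D2: act_module A2 D2 modulus a2 using D(2) by (simp add: X2.extensible_module_def)
  let ?X = "carrier D1"
  define B where "B = \<lparr>carrier = ?X \<rightarrow>\<^sub>E ?X, mult = (\<lambda>f g. compose ?X f g), one = (\<lambda>x\<in>?X. x)\<rparr>"
  have B [simp]: "carrier B = ?X \<rightarrow>\<^sub>E ?X" "f \<otimes>\<^bsub>B\<^esub> g = compose ?X f g" for f g by (simp_all add: B_def)
  have "semigrp B"
  proof
    show "carrier B \<noteq> {}" using D1.D.one_closed by (auto simp: PiE_eq_empty_iff)
    show "f \<otimes>\<^bsub>B\<^esub> g \<in> carrier B" if "f \<in> carrier B" "g \<in> carrier B" for f g
      using that by (auto simp: compose_def PiE_iff)
    show "f \<otimes>\<^bsub>B\<^esub> g \<otimes>\<^bsub>B\<^esub> h = f \<otimes>\<^bsub>B\<^esub> (g \<otimes>\<^bsub>B\<^esub> h)" if "h \<in> carrier B" for f g h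
      using that by (auto simp: compose_def PiE_iff intro!: restrict_ext)
  qed
  then have fB: "finite_semigrp B" using D1.fin by (auto simp: finite_semigrp_def intro: finite_PiE)
  define i where "i = inv_into ?X \<Psi>"
  have i: "i (\<Psi> x) = x" if "x \<in> ?X" for x using \<Psi>(1) that by (simp add: i_def bij_betw_inv_into_left)
  have i': "i y \<in> ?X" "\<Psi> (i y) = y" if "y \<in> carrier D2" for y
    using \<Psi>(1) that by (auto simp: i_def bij_betw_def f_inv_into_f inv_into_into)
  have \<Psi>c: "\<Psi> x \<in> carrier D2" if "x \<in> ?X" for x using \<Psi>(1) that bij_betwE by blast
  define h1 where "h1 a = (\<lambda>x\<in>?X. a1 a x)" for a
  \<comment> \<open>The action of the second semigroup, transported to the set on which the first one acts.\<close>
  define h2 where "h2 b = (\<lambda>x\<in>?X. i (a2 b (\<Psi> x)))" for b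
  have c1: "a1 a x \<in> ?X" if "a \<in> carrier A1" "x \<in> ?X" for a x
    using D1.act_hom[OF that(1)] that(2) by (rule hom_in_carrier)
  have c2: "a2 a x \<in> carrier D2" if "a \<in> carrier A2" "x \<in> carrier D2" for a x
    using D2.act_hom[OF that(1)] that(2) by (rule hom_in_carrier)
  have "h1 \<in> mon A1 B"
    unfolding mon_iff
  proof (intro conjI ballI inj_onI)
    show "h1 a \<in> carrier B" if "a \<in> carrier A1" for a using c1[OF that] by (auto simp: h1_def)
    show "h1 (a \<otimes>\<^bsub>A1\<^esub> b) = h1 a \<otimes>\<^bsub>B\<^esub> h1 b" if "a \<in> carrier A1" "b \<in> carrier A1" for a b
      using that c1 D1.act_comp by (auto simp: h1_def compose_def intro!: restrict_ext)
    show "a = b" if "a \<in> carrier A1" "b \<in> carrier A1" "h1 a = h1 b" for a b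
      using that D(3) unfolding X1.faithful_def h1_def by (metis restrict_apply')
  qed
  moreover have "h2 \<in> mon A2 B"
    unfolding mon_iff
  proof (intro conjI ballI inj_onI)
    show "h2 a \<in> carrier B" if "a \<in> carrier A2" for a using c2[OF that] i' \<Psi>c by (auto simp: h2_def)
    show "h2 (a \<otimes>\<^bsub>A2\<^esub> b) = h2 a \<otimes>\<^bsub>B\<^esub> h2 b" if "a \<in> carrier A2" "b \<in> carrier A2" for a b
      using that c2 i' \<Psi>c D2.act_comp by (auto simp: h2_def compose_def intro!: restrict_ext)
    show "a = b" if ab: "a \<in> carrier A2" "b \<in> carrier A2" "h2 a = h2 b" for a b
    proof (rule ccontr)
      assume "a \<noteq> b"
      then obtain y where y: "y \<in> carrier D2" "a2 a y \<noteq> a2 b y" using D(4) ab by (auto simp: X2.faithful_def)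
      have "h2 a (i y) = h2 b (i y)" using ab by simp
      then have "i (a2 a y) = i (a2 b y)" using i'[OF y(1)] by (simp add: h2_def)
      then show False using y i'(2) c2 ab by metis
    qed
  qed
  moreover have "h1 (f1 x) = h2 (f2 x)" if x: "x \<in> carrier (full_transf n)" for x
  proof -
    have "x \<in> shifted N ` maps N" using bij_betw_imp_surj_on[OF bij_shifted[of N]] x N by simp
    then obtain f where f: "f \<in> maps N" "x = shifted N f" by blast
    have "a1 (f1 x) z = i (a2 (f2 x) (\<Psi> z))" if "z \<in> ?X" for z
    proof -
      have "f1 x \<in> carrier A1" using mon_closed[OF f1 x] .
      then show ?thesis using \<Psi>(2)[OF f(1) that] i[OF c1[OF _ that]] f(2) by (metis comp_apply)
    qed
    then show ?thesis by (auto simp: h1_def h2_def intro!: restrict_ext)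
  qed
  moreover obtain B' :: "nat monoid" and j where j: "finite_semigrp B'" "j \<in> iso B B'"
    using finite_semigrp_nat_copy[OF fB] .
  ultimately show thesis
    using that[OF j(1) mon_comp[OF _ iso_mon[OF j(2)]] mon_comp[OF _ iso_mon[OF j(2)]]] by simp
qed

lemma amalgamation_base_copy:
  assumes n: "2 \<le> n" and T: "finite_semigrp T" and j: "j \<in> iso (full_transf n) T"
  shows "amalgamation_base T"
  unfolding amalgamation_base_def
proof (intro conjI allI impI ballI T)
  fix A1 A2 :: "nat monoid" and f1 f2
  assume A: "finite_semigrp A1 \<and> finite_semigrp A2" and f: "f1 \<in> mon T A1" "f2 \<in> mon T A2"
  obtain B :: "nat monoid" and g1 g2 where B: "finite_semigrp B" "g1 \<in> mon A1 B" "g2 \<in> mon A2 B"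
    "\<And>x. x \<in> carrier (full_transf n) \<Longrightarrow> g1 ((f1 \<circ> j) x) = g2 ((f2 \<circ> j) x)"
    using full_transf_amalgam[OF n _ _ mon_comp[OF iso_mon[OF j] f(1)] mon_comp[OF iso_mon[OF j] f(2)]] A
    by metis
  have "g1 (f1 x) = g2 (f2 x)" if x: "x \<in> carrier T" for x
  proof -
    obtain z where "z \<in> carrier (full_transf n)" "x = j z" using j x by (auto simp: iso_def bij_betw_def)
    then show ?thesis using B(4)[of z] by simp
  qed
  then show "\<exists>B :: nat monoid. finite_semigrp B \<and>
      (\<exists>g1\<in>mon A1 B. \<exists>g2\<in>mon A2 B. \<forall>x\<in>carrier T. g1 (f1 x) = g2 (f2 x))"
    using B by blast
qed

section \<open>Back and forth\<close>

definition filtration :: "('a, 'b) monoid_scheme \<Rightarrow> (nat \<Rightarrow> 'a set) \<Rightarrow> bool" where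
  "filtration S C \<longleftrightarrow> semigrp S \<and> (\<forall>k. subsemigrp (C k) S \<and> finite (C k) \<and> C k \<subseteq> C (Suc k)) \<and>
     carrier S = (\<Union>k. C k)"

text \<open>
  The target \<open>F\<close> ranges over finite semigroups on the natural numbers; by \<open>absorbs_any\<close> this
  restriction is immaterial.
\<close>

definition absorbs :: "('a, 'b) monoid_scheme \<Rightarrow> (nat \<Rightarrow> 'a set) \<Rightarrow> bool" where
  "absorbs S C \<longleftrightarrow> (\<forall>k (F :: nat monoid) g. finite_semigrp F \<and> g \<in> mon (S\<lparr>carrier := C k\<rparr>) F \<longrightarrow>
     (\<exists>f\<in>mon F S. \<forall>x\<in>C k. f (g x) = x))"

lemma filtration_mono: "filtration S C \<Longrightarrow> j \<le> k \<Longrightarrow> C j \<subseteq> C k"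
  unfolding filtration_def by (rule lift_Suc_mono_le[of C]) auto

lemma filtration_finite_semigrp: "filtration S C \<Longrightarrow> finite_semigrp (S\<lparr>carrier := C k\<rparr>)"
  by (simp add: filtration_def finite_semigrp_def semigrp_restrict)

lemma filtration_cover:
  assumes F: "filtration S C" and X: "finite X" "X \<subseteq> carrier S"
  obtains k where "n \<le> k" "X \<subseteq> C k"
proof -
  have "\<exists>k\<ge>n. X \<subseteq> C k"
    using X
  proof (induction X rule: finite_induct)
    case (insert x X)
    then obtain k where k: "n \<le> k" "X \<subseteq> C k" by auto
    obtain l where l: "x \<in> C l" using insert F by (auto simp: filtration_def)
    have "C k \<subseteq> C (max k l)" "C l \<subseteq> C (max k l)" using filtration_mono[OF F] by auto
    then show ?case using k l by (intro exI[of _ "max k l"]) auto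
  qed auto
  then show thesis using that by blast
qed

lemma absorbs_any:
  assumes ab: "absorbs S C" and F: "finite_semigrp F" and g: "g \<in> mon (S\<lparr>carrier := C k\<rparr>) F"
  obtains f where "f \<in> mon F S" "\<And>x. x \<in> C k \<Longrightarrow> f (g x) = x"
proof -
  obtain F' :: "nat monoid" and j where j: "finite_semigrp F'" "j \<in> iso F F'"
    using finite_semigrp_nat_copy[OF F] .
  obtain f where "f \<in> mon F' S" "\<forall>x\<in>C k. f ((j \<circ> g) x) = x"
    using ab j(1) mon_comp[OF g iso_mon[OF j(2)]] unfolding absorbs_def by blast
  then show thesis using that[of "f \<circ> j"] mon_comp[OF iso_mon[OF j(2)], of f S] by simp
qed

lemma mon_restrict_codomain: "\<lbrakk>f \<in> mon G S; f ` carrier G \<subseteq> D\<rbrakk> \<Longrightarrow> f \<in> mon G (S\<lparr>carrier := D\<rparr>)"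
  by (auto simp: mon_iff image_subset_iff)

text \<open>
  The image of \<open>f\<close> lies in some \<open>C' b\<close>. Absorbing \<open>C' b\<close> into \<open>S\<close> gives a partial inverse \<open>g\<close> of
  \<open>f\<close>, defined on \<open>C' b\<close>. Its image lies in some \<open>C l\<close>, and absorbing \<open>C l\<close> into \<open>S'\<close> gives a
  partial inverse of \<open>g\<close>, which extends \<open>f\<close> and covers \<open>C' b\<close>.
\<close>

lemma zigzag_step:
  assumes F: "filtration S C" "filtration S' C'" and ab: "absorbs S C" "absorbs S' C'"
    and f: "f \<in> mon (S\<lparr>carrier := C k\<rparr>) S'"
  obtains l h where "k < l" "h \<in> mon (S\<lparr>carrier := C l\<rparr>) S'" "\<And>x. x \<in> C k \<Longrightarrow> h x = f x" "C' n \<subseteq> h ` C l"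
proof -
  have fin: "finite (C k)" "finite (C' b)" for b using F by (auto simp: filtration_def)
  have CS: "C j \<subseteq> carrier S" "C' j \<subseteq> carrier S'" for j using F by (auto simp: filtration_def)
  have "f ` C k \<subseteq> carrier S'" using f by (auto simp: mon_iff)
  then obtain b where b: "n \<le> b" "f ` C k \<subseteq> C' b"
    using filtration_cover[OF F(2) finite_imageI[OF fin(1)]] by metis
  have "f \<in> mon (S\<lparr>carrier := C k\<rparr>) (S'\<lparr>carrier := C' b\<rparr>)"
    using f b by (intro mon_restrict_codomain) auto
  then obtain g where g: "g \<in> mon (S'\<lparr>carrier := C' b\<rparr>) S" "\<And>x. x \<in> C k \<Longrightarrow> g (f x) = x"
    using absorbs_any[OF ab(1) filtration_finite_semigrp[OF F(2)]] by metis
  have "g ` C' b \<subseteq> carrier S" using g by (auto simp: mon_iff)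
  then obtain l where l: "Suc k \<le> l" "g ` C' b \<subseteq> C l"
    using filtration_cover[OF F(1) finite_imageI[OF fin(2)]] by metis
  have "g \<in> mon (S'\<lparr>carrier := C' b\<rparr>) (S\<lparr>carrier := C l\<rparr>)"
    using g l by (intro mon_restrict_codomain) auto
  then obtain h where h: "h \<in> mon (S\<lparr>carrier := C l\<rparr>) S'" "\<And>y. y \<in> C' b \<Longrightarrow> h (g y) = y"
    using absorbs_any[OF ab(2) filtration_finite_semigrp[OF F(1)]] by metis
  have "h x = f x" if "x \<in> C k" for x using h(2)[of "f x"] g(2)[OF that] b that by auto
  moreover have "C' n \<subseteq> h ` C l"
  proof
    fix y assume "y \<in> C' n"
    then have "y \<in> C' b" using filtration_mono[OF F(2) b(1)] by blast
    then show "y \<in> h ` C l" using h(2) l(2) by (metis image_eqI image_subset_iff)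
  qed
  ultimately show thesis using that[of l h] h(1) l(1) by simp
qed

text \<open>
  Iterating \<open>zigzag_step\<close> gives embeddings of larger and larger members of the filtration that
  extend each other and whose images exhaust the target.
\<close>

theorem back_and_forth:
  assumes F: "filtration S C" "filtration S' C'" and ab: "absorbs S C" "absorbs S' C'"
    and f0: "f0 \<in> mon (S\<lparr>carrier := C k0\<rparr>) S'"
  obtains \<Phi> where "\<Phi> \<in> iso S S'" "\<And>x. x \<in> C k0 \<Longrightarrow> \<Phi> x = f0 x"
proof -
  interpret S: semigrp S using F by (simp add: filtration_def)
  define P where "P n s \<longleftrightarrow> snd s \<in> mon (S\<lparr>carrier := C (fst s)\<rparr>) S' \<and> k0 \<le> fst s \<and> (\<forall>x\<in>C k0. snd s x = f0 x) \<and> n \<le> fst s"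
    for n s
  define Q where "Q n s s' \<longleftrightarrow> fst s \<le> fst s' \<and> (\<forall>x\<in>C (fst s). snd s' x = snd s x) \<and> C' n \<subseteq> snd s' ` C (fst s')"
    for n and s s' :: "nat \<times> ('a \<Rightarrow> 'c)"
  have "\<exists>s. \<forall>n. P n (s n) \<and> Q n (s n) (s (Suc n))"
  proof (rule dependent_nat_choice)
    show "\<exists>s. P 0 s" using f0 by (intro exI[of _ "(k0, f0)"]) (simp add: P_def)
    fix s n assume p: "P n s"
    then have "snd s \<in> mon (S\<lparr>carrier := C (fst s)\<rparr>) S'" by (simp add: P_def)
    then obtain l h where lh: "fst s < l" "h \<in> mon (S\<lparr>carrier := C l\<rparr>) S'"
      "\<And>x. x \<in> C (fst s) \<Longrightarrow> h x = snd s x" "C' n \<subseteq> h ` C l"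
      using zigzag_step[OF F ab] by metis
    have "C k0 \<subseteq> C (fst s)" using p filtration_mono[OF F(1)] by (simp add: P_def)
    then have "P (Suc n) (l, h)" using p lh by (auto simp: P_def)
    moreover have "Q n s (l, h)" using lh by (simp add: Q_def)
    ultimately show "\<exists>s'. P (Suc n) s' \<and> Q n s s'" by blast
  qed
  then obtain s where s: "\<And>n. P n (s n)" "\<And>n. Q n (s n) (s (Suc n))" by blast
  define c where "c n = fst (s n)" for n
  define h where "h n = snd (s n)" for n
  have h: "h n \<in> mon (S\<lparr>carrier := C (c n)\<rparr>) S'" "n \<le> c n" "k0 \<le> c n" "\<And>x. x \<in> C k0 \<Longrightarrow> h n x = f0 x" for n
    using s(1)[of n] by (auto simp: P_def c_def h_def)
  have Cc: "C (c m) \<subseteq> C (c n)" if "m \<le> n" for m n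
    using that
  proof (induction n rule: dec_induct)
    case (step n)
    then show ?case using s(2)[of n] filtration_mono[OF F(1)] by (fastforce simp: Q_def c_def)
  qed simp
  have ext: "h n x = h m x" if "m \<le> n" "x \<in> C (c m)" for m n x
    using that
  proof (induction n rule: dec_induct)
    case (step n)
    then have "x \<in> C (c n)" using Cc by blast
    then show ?case using step s(2)[of n] by (simp add: Q_def c_def h_def)
  qed simp
  have loc: "\<exists>n. x \<in> C (c n)" if "x \<in> carrier S" for x
  proof -
    from that obtain n where "x \<in> C n" using F(1) by (auto simp: filtration_def)
    then have "x \<in> C (c n)" using filtration_mono[OF F(1) h(2)] by blast
    then show ?thesis by blast
  qed
  have CS: "C j \<subseteq> carrier S" for j using F(1) by (auto simp: filtration_def)
  define \<Phi> where "\<Phi> x = h (LEAST n. x \<in> C (c n)) x" for x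
  have \<Phi>: "\<Phi> x = h n x" if "x \<in> C (c n)" for x n
  proof -
    have "(LEAST n. x \<in> C (c n)) \<le> n" "x \<in> C (c (LEAST n. x \<in> C (c n)))"
      using that by (rule Least_le, rule LeastI)
    then show ?thesis using ext by (simp add: \<Phi>_def)
  qed
  have two: "\<exists>n. x \<in> C (c n) \<and> y \<in> C (c n)" if xy: "x \<in> carrier S" "y \<in> carrier S" for x y
  proof -
    obtain m n where "x \<in> C (c m)" "y \<in> C (c n)" using loc xy by blast
    then show ?thesis using Cc[of m "max m n"] Cc[of n "max m n"] by (intro exI[of _ "max m n"]) auto
  qed
  have "\<Phi> \<in> mon S S'"
    unfolding mon_iff
  proof (intro conjI ballI inj_onI)
    show "\<Phi> x \<in> carrier S'" if "x \<in> carrier S" for x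
      using loc[OF that] \<Phi> h(1) by (auto simp: mon_iff)
    show "\<Phi> (x \<otimes>\<^bsub>S\<^esub> y) = \<Phi> x \<otimes>\<^bsub>S'\<^esub> \<Phi> y" if xy: "x \<in> carrier S" "y \<in> carrier S" for x y
    proof -
      obtain n where n: "x \<in> C (c n)" "y \<in> C (c n)" using two[OF xy] by blast
      then have "x \<otimes>\<^bsub>S\<^esub> y \<in> C (c n)" using F(1) by (auto simp: filtration_def subsemigrp_def)
      then show ?thesis using \<Phi> n h(1)[of n] by (simp add: mon_iff)
    qed
    show "x = y" if xy: "x \<in> carrier S" "y \<in> carrier S" "\<Phi> x = \<Phi> y" for x y
    proof -
      obtain n where n: "x \<in> C (c n)" "y \<in> C (c n)" using two[OF xy(1,2)] by blast
      then show ?thesis using xy(3) \<Phi> mon_eq_iff[OF h(1)[of n]] by simp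
    qed
  qed
  moreover have "carrier S' \<subseteq> \<Phi> ` carrier S"
  proof
    fix y assume "y \<in> carrier S'"
    then obtain n where "y \<in> C' n" using F(2) by (auto simp: filtration_def)
    then obtain x where x: "x \<in> C (c (Suc n))" "y = h (Suc n) x"
      using s(2)[of n] by (auto simp: Q_def c_def h_def)
    then have "y = \<Phi> x" "x \<in> carrier S" using \<Phi>[OF x(1)] CS[of "c (Suc n)"] by auto
    then show "y \<in> \<Phi> ` carrier S" by blast
  qed
  ultimately have "\<Phi> \<in> iso S S'" unfolding iso_iff_mon_epi epi_iff_subset by (simp add: mon_def)
  moreover have "\<Phi> x = f0 x" if "x \<in> C k0" for x
    using that \<Phi>[of x 0] h(4)[of x 0] filtration_mono[OF F(1) h(3)[of 0]] by auto
  ultimately show thesis using that by blast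
qed

lemma auto_of_iso: "\<Phi> \<in> iso S S \<Longrightarrow> semigrp S \<Longrightarrow> restrict \<Phi> (carrier S) \<in> auto S"
  unfolding auto_def iso_def Bij_def
  by (auto simp: hom_def semigrp.m_closed bij_betw_def inj_on_def)

text \<open>
  Put both copies of \<open>T\<close> in one \<open>C k\<close>. Amalgamate \<open>C k\<close> with itself over \<open>T\<close>, embedded once by
  the inclusion of the first copy and once through \<open>h\<close>. Absorbing the amalgam over the second
  factor makes the first factor an embedding of \<open>C k\<close> into \<open>S\<close> that agrees with \<open>h\<close> on the first
  copy; \<open>back_and_forth\<close> extends it to an automorphism.
\<close>

theorem absorbs_imp_homogeneous:
  assumes F: "filtration S C" and ab: "absorbs S C" and T: "amalgamation_base (T :: nat monoid)"
  shows "acts_homogeneously S T"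
  unfolding acts_homogeneously_def
proof (intro allI impI ballI, elim conjE)
  fix T1 T2 h
  assume sub: "subsemigrp T1 S" "subsemigrp T2 S" and i1: "S\<lparr>carrier := T1\<rparr> \<cong> T"
    and h: "h \<in> iso (S\<lparr>carrier := T1\<rparr>) (S\<lparr>carrier := T2\<rparr>)"
  have S: "semigrp S" using F by (simp add: filtration_def)
  obtain i where i: "i \<in> iso (S\<lparr>carrier := T1\<rparr>) T" using i1 by (auto simp: is_iso_def)
  define j where "j = inv_into T1 i"
  have j: "j \<in> iso T (S\<lparr>carrier := T1\<rparr>)"
    using iso_inverse[OF semigrp_restrict[OF S sub(1)] i] by (simp add: j_def)
  have "finite (carrier T)" using T by (simp add: amalgamation_base_def finite_semigrp_def)
  then have fT1: "finite T1" using i by (auto simp: iso_def dest: bij_betw_finite)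
  have "bij_betw h T1 T2" using h by (simp add: iso_def)
  then have fT2: "finite T2" and T2: "T2 = h ` T1" using fT1 by (auto simp: bij_betw_def)
  have TS: "T1 \<union> T2 \<subseteq> carrier S" using sub by (auto simp: subsemigrp_def)
  obtain k where k: "T1 \<union> T2 \<subseteq> C k" using filtration_cover[OF F _ TS] fT1 fT2 by blast
  let ?K = "S\<lparr>carrier := C k\<rparr>"
  obtain K :: "nat monoid" and d where K: "finite_semigrp K" "d \<in> iso ?K K"
    using finite_semigrp_nat_copy[OF filtration_finite_semigrp[OF F]] .
  have "j \<in> mon T ?K" using iso_mon[OF j] k by (auto simp: mon_iff)
  then have f1: "d \<circ> j \<in> mon T K" by (rule mon_comp[OF _ iso_mon[OF K(2)]])
  have "h \<circ> j \<in> mon T (S\<lparr>carrier := T2\<rparr>)" by (rule mon_comp[OF iso_mon[OF j] iso_mon[OF h]])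
  then have "h \<circ> j \<in> mon T ?K" using k by (auto simp: mon_iff)
  then have f2: "d \<circ> (h \<circ> j) \<in> mon T K" by (rule mon_comp[OF _ iso_mon[OF K(2)]])
  obtain B :: "nat monoid" and g1 g2 where B: "finite_semigrp B" "g1 \<in> mon K B" "g2 \<in> mon K B"
    "\<forall>x\<in>carrier T. g1 ((d \<circ> j) x) = g2 ((d \<circ> (h \<circ> j)) x)"
    using T K(1) f1 f2 unfolding amalgamation_base_def by meson
  obtain \<beta> where \<beta>: "\<beta> \<in> mon B S" "\<And>x. x \<in> C k \<Longrightarrow> \<beta> ((g2 \<circ> d) x) = x"
    using absorbs_any[OF ab B(1) mon_comp[OF iso_mon[OF K(2)] B(3)]] by metis
  have f0: "\<beta> \<circ> (g1 \<circ> d) \<in> mon ?K S"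
    by (rule mon_comp[OF mon_comp[OF iso_mon[OF K(2)] B(2)] \<beta>(1)])
  obtain \<Phi> where \<Phi>: "\<Phi> \<in> iso S S" "\<And>x. x \<in> C k \<Longrightarrow> \<Phi> x = (\<beta> \<circ> (g1 \<circ> d)) x"
    using back_and_forth[OF F F ab ab f0] by metis
  have "\<Phi> x = h x" if x: "x \<in> T1" for x
  proof -
    have t: "i x \<in> carrier T" "j (i x) = x"
      using i x by (auto simp: iso_def bij_betw_def j_def)
    have "\<Phi> x = \<beta> (g1 ((d \<circ> j) (i x)))" using \<Phi>(2)[of x] x k t by auto
    also have "g1 ((d \<circ> j) (i x)) = g2 ((d \<circ> (h \<circ> j)) (i x))" using B(4) t(1) by blast
    also have "\<beta> \<dots> = \<beta> ((g2 \<circ> d) (h x))" using t(2) by simp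
    also have "\<dots> = h x" using \<beta>(2) k T2 x by blast
    finally show ?thesis .
  qed
  then show "\<exists>\<alpha>\<in>auto S. \<forall>x\<in>T1. \<alpha> x = h x"
    using auto_of_iso[OF \<Phi>(1) S] TS by (intro bexI[of _ "restrict \<Phi> (carrier S)"]) auto
qed

text \<open>
  A presentation of \<open>S\<close> as the limit of a chain by its canonical maps, free of equivalence
  classes.
\<close>

definition limit_maps where
  "limit_maps S i f \<eta> \<longleftrightarrow> semigrp S \<and> (\<forall>k. \<eta> k \<in> mon (full_transf (i k)) S) \<and>
     (\<forall>k. \<forall>x\<in>carrier (full_transf (i k)). \<eta> (Suc k) (f k x) = \<eta> k x) \<and>
     (\<forall>k. f k \<in> mon (full_transf (i k)) (full_transf (i (Suc k)))) \<and>
     carrier S = (\<Union>k. \<eta> k ` carrier (full_transf (i k)))"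

lemma image_subsemigrp:
  assumes "semigrp G" "f \<in> mon G S" shows "subsemigrp (f ` carrier G) S"
  unfolding subsemigrp_def
proof (intro conjI ballI)
  interpret semigrp G by fact
  show "f ` carrier G \<noteq> {}" using nonempty by simp
  show "f ` carrier G \<subseteq> carrier S" using assms(2) by (auto simp: mon_iff)
  fix x y assume "x \<in> f ` carrier G" "y \<in> f ` carrier G"
  then obtain a b where "a \<in> carrier G" "x = f a" "b \<in> carrier G" "y = f b" by blast
  then show "x \<otimes>\<^bsub>S\<^esub> y \<in> f ` carrier G" using mon_mult[OF assms(2), of a b] m_closed by (metis image_eqI)
qed

lemma mon_iso_image: "f \<in> mon G S \<Longrightarrow> f \<in> iso G (S\<lparr>carrier := f ` carrier G\<rparr>)"
  by (auto simp: iso_def mon_def hom_def bij_betw_def)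

text \<open>
  The shift by \<open>c\<close> makes it possible to drop the first members of a chain, where the full
  transformation semigroups are too small for \<open>full_transf_amalgam\<close>.
\<close>

lemma limit_filtration:
  assumes L: "limit_maps S i f \<eta>"
  shows "filtration S (\<lambda>k. \<eta> (k + c) ` carrier (full_transf (i (k + c))))"
proof -
  let ?C = "\<lambda>k. \<eta> k ` carrier (full_transf (i k))"
  have G: "semigrp (full_transf n)" "finite (carrier (full_transf n))" for n
    using finite_semigrp_full_transf[of n] by (auto simp: finite_semigrp_def)
  have inc: "?C k \<subseteq> ?C (Suc k)" for k
  proof (rule image_subsetI)
    fix x assume x: "x \<in> carrier (full_transf (i k))"
    have "f k \<in> mon (full_transf (i k)) (full_transf (i (Suc k)))" "\<eta> k x = \<eta> (Suc k) (f k x)"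
      using L x by (simp_all add: limit_maps_def del: full_transf_simps)
    moreover from this(1) have "f k x \<in> carrier (full_transf (i (Suc k)))" using x by (rule mon_closed)
    ultimately show "\<eta> k x \<in> ?C (Suc k)" by blast
  qed
  then have "?C k \<subseteq> ?C (k + c)" for k using lift_Suc_mono_le[of ?C k "k + c"] by simp
  then have "(\<Union>k. ?C k) = (\<Union>k. ?C (k + c))" by blast
  moreover have "subsemigrp (?C k) S" for k
    by (rule image_subsemigrp[OF G(1)]) (use L in \<open>simp add: limit_maps_def\<close>)
  ultimately show ?thesis
    using L inc G(2) unfolding filtration_def limit_maps_def by (simp del: full_transf_simps)
qed

text \<open>
  Universality embeds \<open>F\<close> by some \<open>u\<close>. Then \<open>u \<circ> g\<close> carries the given copy of a full
  transformation semigroup to another one, and homogeneity, applicable by \<open>full_transf_amalgam\<close>,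
  gives an automorphism that undoes this.
\<close>

lemma homogeneous_imp_absorbs:
  assumes L: "limit_maps S i f \<eta>" and i: "\<And>k. 2 \<le> i (k + c)" and M: "maximally_homogeneous S"
  shows "absorbs S (\<lambda>k. \<eta> (k + c) ` carrier (full_transf (i (k + c))))"
  unfolding absorbs_def
proof (intro allI impI, elim conjE)
  fix k and F :: "nat monoid" and g
  let ?G = "full_transf (i (k + c))" and ?e = "\<eta> (k + c)"
  let ?C = "?e ` carrier ?G"
  assume F: "finite_semigrp F" and g: "g \<in> mon (S\<lparr>carrier := ?C\<rparr>) F"
  have S: "semigrp S" and e: "?e \<in> mon ?G S" using L by (auto simp: limit_maps_def)
  have G: "semigrp ?G" using finite_semigrp_full_transf by (simp add: finite_semigrp_def)
  obtain u where u: "u \<in> mon F S" using M F by (auto simp: maximally_homogeneous_def universal_def)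
  obtain T :: "nat monoid" and j where T: "finite_semigrp T" "j \<in> iso ?G T"
    using finite_semigrp_nat_copy[OF finite_semigrp_full_transf] .
  have hom: "acts_homogeneously S T"
    using M amalgamation_base_copy[OF i T] by (simp add: maximally_homogeneous_def)
  have ie: "?e \<in> iso ?G (S\<lparr>carrier := ?C\<rparr>)" by (rule mon_iso_image[OF e])
  have m: "u \<circ> (g \<circ> ?e) \<in> mon ?G S" by (rule mon_comp[OF mon_comp[OF iso_mon[OF ie] g] u])
  let ?D = "(u \<circ> (g \<circ> ?e)) ` carrier ?G"
  have im: "u \<circ> (g \<circ> ?e) \<in> iso ?G (S\<lparr>carrier := ?D\<rparr>)" by (rule mon_iso_image[OF m])
  have comp: "q \<circ> p \<in> iso X Z" if "p \<in> iso X Y" "q \<in> iso Y Z" for p q and X :: "('p, 'q) monoid_scheme" and Y :: "('r, 's) monoid_scheme" and Z :: "('t, 'v) monoid_scheme"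
    using that by (auto simp: iso_def hom_def Pi_iff intro: bij_betw_trans)
  have inv: "inv_into (carrier ?G) (u \<circ> (g \<circ> ?e)) \<in> iso (S\<lparr>carrier := ?D\<rparr>) ?G"
    by (rule iso_inverse[OF G im])
  have "?e \<circ> inv_into (carrier ?G) (u \<circ> (g \<circ> ?e)) \<in> iso (S\<lparr>carrier := ?D\<rparr>) (S\<lparr>carrier := ?C\<rparr>)"
    by (rule comp[OF inv ie])
  moreover have "S\<lparr>carrier := ?D\<rparr> \<cong> T" by (rule is_isoI[OF comp[OF inv T(2)]])
  moreover have "T \<cong> S\<lparr>carrier := ?C\<rparr>" by (rule is_isoI[OF comp[OF iso_inverse[OF G T(2)] ie]])
  moreover have "subsemigrp ?C S" "subsemigrp ?D S" using image_subsemigrp[OF G e] image_subsemigrp[OF G m] .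
  ultimately obtain \<alpha> where \<alpha>: "\<alpha> \<in> auto S"
    "\<forall>x\<in>?D. \<alpha> x = (?e \<circ> inv_into (carrier ?G) (u \<circ> (g \<circ> ?e))) x"
    using hom unfolding acts_homogeneously_def by blast
  have am: "\<alpha> \<in> mon S S" using \<alpha>(1) by (auto simp: auto_def Bij_def mon_def bij_betw_def)
  have "(\<alpha> \<circ> u) (g y) = y" if "y \<in> ?C" for y
  proof -
    obtain x where x: "x \<in> carrier ?G" "y = ?e x" using \<open>y \<in> ?C\<close> by blast
    have "\<alpha> (u (g y)) = \<alpha> ((u \<circ> (g \<circ> ?e)) x)" using x by simp
    also have "\<dots> = ?e (inv_into (carrier ?G) (u \<circ> (g \<circ> ?e)) ((u \<circ> (g \<circ> ?e)) x))"
      using \<alpha>(2) x(1) by (metis comp_apply image_eqI)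
    also have "\<dots> = y" using m x by (simp add: mon_iff inv_into_f_f del: full_transf_simps comp_apply)
    finally show ?thesis by simp
  qed
  then show "\<exists>f\<in>mon F S. \<forall>x\<in>?C. f (g x) = x" using mon_comp[OF u am] by blast
qed

section \<open>Direct limits and the construction\<close>

locale chain =
  fixes G :: "nat \<Rightarrow> 'a monoid" and f :: "nat \<Rightarrow> 'a \<Rightarrow> 'a"
  assumes semigrp_G: "semigrp (G k)" and f: "f k \<in> mon (G k) (G (Suc k))"
begin

lemma chain_map_mon: "chain_map f k d \<in> mon (G k) (G (k + d))"
proof (induction d)
  case 0
  then show ?case by (auto simp: mon_iff)
next
  case (Suc d)
  have "chain_map f k (Suc d) = f (k + d) \<circ> chain_map f k d" by (simp add: fun_eq_iff)
  then show ?case using mon_comp[OF Suc f] by (simp only: add_Suc_right)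
qed

lemma chain_map_add: "chain_map f k (d + e) x = chain_map f (k + d) e (chain_map f k d x)"
  by (induction e) (simp_all add: add.assoc)

definition up :: "nat \<Rightarrow> nat \<Rightarrow> 'a \<Rightarrow> 'a" where "up k l = chain_map f k (l - k)"

lemma up_mon: "k \<le> l \<Longrightarrow> up k l \<in> mon (G k) (G l)"
  using chain_map_mon[of k "l - k"] by (simp add: up_def)

lemma up_up: "\<lbrakk>k \<le> l; l \<le> m\<rbrakk> \<Longrightarrow> up l m (up k l x) = up k m x"
  using chain_map_add[of k "l - k" "m - l" x] by (simp add: up_def)

lemma up_refl [simp]: "up k k x = x"
  by (simp add: up_def)

lemma up_Suc [simp]: "up k (Suc k) x = f k x"
  by (simp add: up_def)

abbreviation Rel where "Rel \<equiv> limit_rel G f"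
abbreviation Lim where "Lim \<equiv> direct_limit G f"

lemma Rel_iff: "((k, x), (l, y)) \<in> Rel \<longleftrightarrow> x \<in> carrier (G k) \<and> y \<in> carrier (G l) \<and>
    (\<exists>m. k \<le> m \<and> l \<le> m \<and> up k m x = up l m y)"
  by (simp add: limit_rel_def up_def)

lemma equiv_Rel: "equiv (SIGMA k : UNIV. carrier (G k)) Rel"
proof (rule equivI)
  show "Rel \<subseteq> (SIGMA k:UNIV. carrier (G k)) \<times> (SIGMA k:UNIV. carrier (G k))" by (auto simp: limit_rel_def)
  show "refl_on (SIGMA k:UNIV. carrier (G k)) Rel" by (auto simp: refl_on_def Rel_iff)
  show "sym Rel" by (rule symI) (auto simp: Rel_iff; metis)
  show "trans Rel"
  proof (rule transI)
    fix p q r assume pq: "(p, q) \<in> Rel" and qr: "(q, r) \<in> Rel"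
    obtain k x l y n z where s: "p = (k, x)" "q = (l, y)" "r = (n, z)" by (metis surj_pair)
    obtain a where a: "k \<le> a" "l \<le> a" "up k a x = up l a y" using pq s by (auto simp: Rel_iff)
    obtain b where b: "l \<le> b" "n \<le> b" "up l b y = up n b z" using qr s by (auto simp: Rel_iff)
    let ?m = "max a b"
    have "up k ?m x = up a ?m (up k a x)" using a(1) by (simp add: up_up)
    also have "\<dots> = up a ?m (up l a y)" by (simp only: a(3))
    also have "\<dots> = up b ?m (up l b y)" using a(2) b(1) by (simp add: up_up)
    also have "\<dots> = up b ?m (up n b z)" by (simp only: b(3))
    also have "\<dots> = up n ?m z" using b(2) by (simp add: up_up)
    finally show "(p, r) \<in> Rel" using pq qr s a b by (auto simp: Rel_iff intro!: exI[of _ ?m])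
  qed
qed

definition leg where "leg k x = Rel `` {(k, x)}"

lemma limit_carrier: "carrier Lim = (\<Union>k. leg k ` carrier (G k))"
  by (auto simp: direct_limit_def quotient_def leg_def)

lemma leg_eq_iff:
  assumes "x \<in> carrier (G k)" "y \<in> carrier (G l)"
  shows "leg k x = leg l y \<longleftrightarrow> ((k, x), (l, y)) \<in> Rel"
  unfolding leg_def using eq_equiv_class_iff[OF equiv_Rel] assms by simp

lemma leg_up: "\<lbrakk>k \<le> l; x \<in> carrier (G k)\<rbrakk> \<Longrightarrow> leg l (up k l x) = leg k x"
  using mon_closed[OF up_mon] by (subst leg_eq_iff) (auto simp: Rel_iff up_up)

text \<open>
  The product of two classes is defined as a union over all representatives. All terms of this
  union are the same class, because representatives agree once they are moved far enough.
\<close>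

lemma leg_mult:
  assumes x: "x \<in> carrier (G k)" and y: "y \<in> carrier (G l)"
  shows "leg k x \<otimes>\<^bsub>Lim\<^esub> leg l y = leg (max k l) (up k (max k l) x \<otimes>\<^bsub>G (max k l)\<^esub> up l (max k l) y)"
proof -
  let ?h = "\<lambda>(k, x) (l, y). let m = max k l in Rel `` {(m, up k m x \<otimes>\<^bsub>G m\<^esub> up l m y)}"
  have cong: "?h (k, x) (l, y) = ?h (k', x') (l', y')"
    if xx: "((k, x), (k', x')) \<in> Rel" and yy: "((l, y), (l', y')) \<in> Rel" for k x k' x' l y l' y'
  proof -
    obtain a where a: "k \<le> a" "k' \<le> a" "up k a x = up k' a x'" using xx by (auto simp: Rel_iff)
    obtain b where b: "l \<le> b" "l' \<le> b" "up l b y = up l' b y'" using yy by (auto simp: Rel_iff)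
    have c: "x \<in> carrier (G k)" "x' \<in> carrier (G k')" "y \<in> carrier (G l)" "y' \<in> carrier (G l')"
      using xx yy by (auto simp: Rel_iff)
    let ?n = "max a b"
    have push: "Rel `` {(max k l, up k (max k l) x \<otimes>\<^bsub>G (max k l)\<^esub> up l (max k l) y)} =
        leg ?n (up k ?n x \<otimes>\<^bsub>G ?n\<^esub> up l ?n y)"
      if "x \<in> carrier (G k)" "y \<in> carrier (G l)" "k \<le> a" "l \<le> b" for k l x y
    proof -
      let ?m = "max k l"
      have m: "?m \<le> ?n" "k \<le> ?m" "l \<le> ?m" using that by auto
      have u: "up k ?m x \<in> carrier (G ?m)" "up l ?m y \<in> carrier (G ?m)"
        using mon_closed[OF up_mon[OF m(2)] that(1)] mon_closed[OF up_mon[OF m(3)] that(2)] .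
      have "leg ?m (up k ?m x \<otimes>\<^bsub>G ?m\<^esub> up l ?m y) = leg ?n (up ?m ?n (up k ?m x \<otimes>\<^bsub>G ?m\<^esub> up l ?m y))"
        using leg_up[OF m(1) semigrp.m_closed[OF semigrp_G u]] by simp
      also have "up ?m ?n (up k ?m x \<otimes>\<^bsub>G ?m\<^esub> up l ?m y) = up k ?n x \<otimes>\<^bsub>G ?n\<^esub> up l ?n y"
        using mon_mult[OF up_mon[OF m(1)] u] m by (simp add: up_up)
      finally show ?thesis by (simp add: leg_def)
    qed
    have xa: "up k ?n x = up k' ?n x'" using up_up[of k a ?n x] up_up[of k' a ?n x'] a by simp
    have yb: "up l ?n y = up l' ?n y'" using up_up[of l b ?n y] up_up[of l' b ?n y'] b by simp
    show ?thesis
      using push[OF c(1,3) a(1) b(1)] push[OF c(2,4) a(2) b(2)] xa yb by (simp add: Let_def)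
  qed
  have self: "(k, x) \<in> leg k x" if "x \<in> carrier (G k)" for k x
    using equiv_class_self[OF equiv_Rel, of "(k, x)"] that by (simp add: leg_def)
  have eq: "?h p q = ?h (k, x) (l, y)" if "p \<in> leg k x" "q \<in> leg l y" for p q
  proof -
    have "((k, x), p) \<in> Rel" "((l, y), q) \<in> Rel" using that by (auto simp: leg_def)
    then show ?thesis using cong[of k x "fst p" "snd p" l y "fst q" "snd q"] by simp
  qed
  have "leg k x \<otimes>\<^bsub>Lim\<^esub> leg l y = (\<Union>p\<in>leg k x. \<Union>q\<in>leg l y. ?h p q)"
    by (auto simp: direct_limit_def up_def split_beta)
  also have "\<dots> = ?h (k, x) (l, y)" using eq self[OF x] self[OF y] by blast
  finally show ?thesis by (simp add: leg_def Let_def)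
qed

lemma leg_mon: "leg k \<in> mon (G k) Lim"
  unfolding mon_iff
proof (intro conjI ballI inj_onI)
  show "leg k x \<in> carrier Lim" if "x \<in> carrier (G k)" for x using that by (auto simp: limit_carrier)
  show "leg k (x \<otimes>\<^bsub>G k\<^esub> y) = leg k x \<otimes>\<^bsub>Lim\<^esub> leg k y" if "x \<in> carrier (G k)" "y \<in> carrier (G k)" for x y
    using leg_mult[OF that] by simp
  show "x = y" if xy: "x \<in> carrier (G k)" "y \<in> carrier (G k)" "leg k x = leg k y" for x y
  proof -
    obtain m where "k \<le> m" "up k m x = up k m y" using xy leg_eq_iff[OF xy(1,2)] by (auto simp: Rel_iff)
    then show ?thesis using mon_eq_iff[OF up_mon xy(1,2)] by blast
  qed
qed

lemma leg_f: "x \<in> carrier (G k) \<Longrightarrow> leg (Suc k) (f k x) = leg k x"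
  using leg_up[of k "Suc k" x] by simp

lemma semigrp_limit: "semigrp Lim"
proof
  obtain x where "x \<in> carrier (G 0)" using semigrp.nonempty[OF semigrp_G] by blast
  then show "carrier Lim \<noteq> {}" by (auto simp: limit_carrier)
  have common: "\<exists>x'\<in>carrier (G n). leg k x = leg n x'" if "x \<in> carrier (G k)" "k \<le> n" for x k n
    using leg_up[OF that(2,1)] mon_closed[OF up_mon[OF that(2)] that(1)] by metis
  show "X \<otimes>\<^bsub>Lim\<^esub> Y \<in> carrier Lim" if XY: "X \<in> carrier Lim" "Y \<in> carrier Lim" for X Y
  proof -
    obtain k x l y where s: "x \<in> carrier (G k)" "X = leg k x" "y \<in> carrier (G l)" "Y = leg l y"
      using XY by (auto simp: limit_carrier)
    let ?n = "max k l"
    obtain x' y' where "x' \<in> carrier (G ?n)" "X = leg ?n x'" "y' \<in> carrier (G ?n)" "Y = leg ?n y'"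
    proof -
      have n: "k \<le> ?n" "l \<le> ?n" by auto
      show ?thesis using that common[OF s(1) n(1)] common[OF s(3) n(2)] s(2,4) by blast
    qed
    then show ?thesis
      using mon_mult[OF leg_mon, of x' ?n y'] semigrp.m_closed[OF semigrp_G, of x' ?n y'] limit_carrier by auto
  qed
  show "X \<otimes>\<^bsub>Lim\<^esub> Y \<otimes>\<^bsub>Lim\<^esub> Z = X \<otimes>\<^bsub>Lim\<^esub> (Y \<otimes>\<^bsub>Lim\<^esub> Z)"
    if XYZ: "X \<in> carrier Lim" "Y \<in> carrier Lim" "Z \<in> carrier Lim" for X Y Z
  proof -
    obtain k x l y j z where s: "x \<in> carrier (G k)" "X = leg k x" "y \<in> carrier (G l)" "Y = leg l y"
      "z \<in> carrier (G j)" "Z = leg j z"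
      using XYZ by (auto simp: limit_carrier)
    let ?n = "max k (max l j)"
    obtain x' y' z' where c: "x' \<in> carrier (G ?n)" "X = leg ?n x'" "y' \<in> carrier (G ?n)" "Y = leg ?n y'"
      "z' \<in> carrier (G ?n)" "Z = leg ?n z'"
    proof -
      have n: "k \<le> ?n" "l \<le> ?n" "j \<le> ?n" by auto
      show ?thesis using that common[OF s(1) n(1)] common[OF s(3) n(2)] common[OF s(5) n(3)] s(2,4,6) by blast
    qed
    interpret semigrp "G ?n" by (rule semigrp_G)
    show ?thesis
      using c mon_mult[OF leg_mon, symmetric] m_closed m_assoc by simp
  qed
qed

end

lemma full_transf_chain:
  "(\<And>k. f k \<in> mon (full_transf (i k)) (full_transf (i (Suc k)))) \<Longrightarrow> chain (\<lambda>k. full_transf (i k)) f"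
  using finite_semigrp_full_transf by (auto simp: chain_def finite_semigrp_def)

lemma limit_maps_of_iso:
  assumes S: "semigrp S" and f: "\<And>k. f k \<in> mon (full_transf (i k)) (full_transf (i (Suc k)))"
    and h: "h \<in> iso S (direct_limit (\<lambda>k. full_transf (i k)) f)"
  shows "\<exists>\<eta>. limit_maps S i f \<eta>"
proof -
  interpret chain "\<lambda>k. full_transf (i k)" f by (rule full_transf_chain) (rule f)
  let ?q = "inv_into (carrier S) h"
  have q: "?q \<in> iso Lim S" by (rule iso_inverse[OF S h])
  have "carrier S = ?q ` carrier Lim" using q by (auto simp: iso_def bij_betw_def)
  also have "\<dots> = (\<Union>k. (?q \<circ> leg k) ` carrier (full_transf (i k)))"
    by (simp add: limit_carrier image_UN image_comp del: full_transf_simps)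
  finally have "limit_maps S i f (\<lambda>k. ?q \<circ> leg k)"
    unfolding limit_maps_def
    using S f mon_comp[OF leg_mon iso_mon[OF q]] leg_f by (simp del: full_transf_simps)
  then show ?thesis by blast
qed

text \<open>
  Both limits absorb. Universality of the second one provides the embedding of the first member
  of the filtration from which the zigzag starts.
\<close>

theorem homogeneous_limits_isomorphic:
  fixes S :: "('a, 'b) monoid_scheme" and S' :: "('c, 'd) monoid_scheme"
  assumes S: "full_transf_limit S" "maximally_homogeneous S"
    and S': "full_transf_limit S'" "maximally_homogeneous S'"
  shows "S \<cong> S'"
proof -
  have main: "\<exists>C. filtration S C \<and> absorbs S C" if "full_transf_limit S" "maximally_homogeneous S"
    for S :: "('x, 'y) monoid_scheme"
  proof -
    from that(1) obtain i f h where i: "strict_mono (i :: nat \<Rightarrow> nat)" "1 \<le> i 0"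
      and f: "\<And>k. f k \<in> mon (full_transf (i k)) (full_transf (i (Suc k)))"
      and h: "h \<in> iso S (direct_limit (\<lambda>k. full_transf (i k)) f)" and sS: "semigrp S"
      unfolding full_transf_limit_def is_iso_def by blast
    obtain \<eta> where L: "limit_maps S i f \<eta>" using limit_maps_of_iso[OF sS f h] by blast
    have "2 \<le> i (k + 1)" for k
    proof -
      have "i 0 < i (k + 1)" using i(1) by (simp add: strict_mono_less)
      then show ?thesis using i(2) by simp
    qed
    then show ?thesis
      using limit_filtration[OF L, of 1] homogeneous_imp_absorbs[OF L _ that(2), of 1] by blast
  qed
  obtain C where C: "filtration S C" "absorbs S C" using main[OF S] by blast
  obtain C' where C': "filtration S' C'" "absorbs S' C'" using main[OF S'] by blast
  have F: "finite_semigrp (S\<lparr>carrier := C 0\<rparr>)" by (rule filtration_finite_semigrp[OF C(1)])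
  obtain T :: "nat monoid" and j where T: "finite_semigrp T" "j \<in> iso (S\<lparr>carrier := C 0\<rparr>) T"
    using finite_semigrp_nat_copy[OF F] .
  obtain u where "u \<in> mon T S'" using S'(2) T(1) by (auto simp: maximally_homogeneous_def universal_def)
  then have "u \<circ> j \<in> mon (S\<lparr>carrier := C 0\<rparr>) S'" by (rule mon_comp[OF iso_mon[OF T(2)]])
  then obtain \<Phi> where "\<Phi> \<in> iso S S'" using back_and_forth[OF C(1) C'(1) C(2) C'(2)] by metis
  then show ?thesis by (rule is_isoI)
qed

text \<open>
  The embeddings that have to be absorbed. They are normalised to be undefined outside the
  carrier, so that there are only countably many.
\<close>

definition tasks :: "nat \<Rightarrow> (nat \<times> ((nat \<Rightarrow> nat) \<Rightarrow> (nat \<Rightarrow> nat))) set" where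
  "tasks n = (SIGMA m : UNIV. mon (full_transf n) (full_transf m) \<inter> extensional (carrier (full_transf n)))"

lemma countable_tasks: "countable (tasks n)"
proof -
  have "finite (mon (full_transf n) (full_transf m) \<inter> extensional (carrier (full_transf n)))" for m
  proof (rule finite_subset)
    show "mon (full_transf n) (full_transf m) \<inter> extensional (carrier (full_transf n))
        \<subseteq> carrier (full_transf n) \<rightarrow>\<^sub>E carrier (full_transf m)"
      by (auto simp: mon_iff PiE_def simp del: full_transf_simps)
    show "finite (carrier (full_transf n) \<rightarrow>\<^sub>E carrier (full_transf m))"
      using finite_semigrp_full_transf by (intro finite_PiE) (auto simp: finite_semigrp_def)
  qed
  then show ?thesis unfolding tasks_def by (intro countable_SIGMA) (auto intro: countable_finite)
qed

lemma mon_restrict_iff: "semigrp G \<Longrightarrow> restrict g (carrier G) \<in> mon G H \<longleftrightarrow> g \<in> mon G H"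
  by (auto simp: mon_iff semigrp.m_closed inj_on_def)

definition task :: "nat \<Rightarrow> nat \<Rightarrow> nat \<times> ((nat \<Rightarrow> nat) \<Rightarrow> (nat \<Rightarrow> nat))" where
  "task n c = from_nat_into (tasks n) c"

lemma tasks_nonempty: "tasks n \<noteq> {}"
proof -
  have "restrict (\<lambda>x. x) (carrier (full_transf n)) \<in> mon (full_transf n) (full_transf n)"
    using finite_semigrp_full_transf by (subst mon_restrict_iff) (auto simp: finite_semigrp_def mon_iff)
  then have "(n, restrict (\<lambda>x. x) (carrier (full_transf n))) \<in> tasks n"
    by (simp add: tasks_def del: full_transf_simps)
  then show ?thesis by blast
qed

lemma task_mon: "task n c = (m, g) \<Longrightarrow> g \<in> mon (full_transf n) (full_transf m)"
  using from_nat_into[OF tasks_nonempty, of n c] by (auto simp: task_def tasks_def simp del: full_transf_simps)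

lemma task_exists:
  assumes "g \<in> mon (full_transf n) (full_transf m)"
  shows "\<exists>c. task n c = (m, restrict g (carrier (full_transf n)))"
proof -
  have "(m, restrict g (carrier (full_transf n))) \<in> tasks n"
    using assms finite_semigrp_full_transf[of n]
    by (simp add: tasks_def mon_restrict_iff finite_semigrp_def del: full_transf_simps)
  then show ?thesis unfolding task_def using from_nat_into_surj[OF countable_tasks] by blast
qed

text \<open>
  One embedding \<open>g\<close> of an earlier member \<open>j\<close> is absorbed: amalgamate it with the chain map \<open>e\<close>
  that leads from \<open>j\<close> to the present member \<open>n\<close>.
\<close>

lemma chain_step:
  assumes j: "2 \<le> j" and e: "e \<in> mon (full_transf j) (full_transf n)"
    and g: "g \<in> mon (full_transf j) (full_transf m)"
  shows "\<exists>n' F w. n < n' \<and> F \<in> mon (full_transf n) (full_transf n') \<and> w \<in> mon (full_transf m) (full_transf n') \<and>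
    (\<forall>x\<in>carrier (full_transf j). w (g x) = F (e x))"
proof -
  obtain B :: "nat monoid" and g1 g2 where B: "finite_semigrp B" "g1 \<in> mon (full_transf n) B"
    "g2 \<in> mon (full_transf m) B" "\<And>x. x \<in> carrier (full_transf j) \<Longrightarrow> g1 (e x) = g2 (g x)"
    by (rule full_transf_amalgam[OF j finite_semigrp_full_transf finite_semigrp_full_transf e g])
      (rule that; assumption)
  obtain u where u: "u \<in> mon B (full_transf (max (Suc n) (Suc (card (carrier B)))))"
    using embeds_in_full_transf[OF B(1), of "max (Suc n) (Suc (card (carrier B)))"]
    by (auto simp: less_Suc_eq_le)
  show ?thesis
    by (intro exI[of _ "max (Suc n) (Suc (card (carrier B)))"] exI[of _ "u \<circ> g1"] exI[of _ "u \<circ> g2"])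
      (use mon_comp[OF B(2) u] mon_comp[OF B(3) u] B(4) in \<open>auto simp del: full_transf_simps\<close>)
qed

lemma chain_map_cong: "(\<And>l. \<lbrakk>k \<le> l; l < k + d\<rbrakk> \<Longrightarrow> f l = f' l) \<Longrightarrow> chain_map f k d x = chain_map f' k d x"
  by (induction d) auto

text \<open>
  Stage \<open>k\<close> treats the task with number \<open>c\<close> of the member \<open>j\<close>, where \<open>(j, c)\<close> is the pair coded
  by \<open>k\<close>. As \<open>j \<le> k\<close>, the member \<open>j\<close> is already constructed at this stage, and every task of
  every member is treated at some stage.
\<close>

theorem absorbing_chain_exists:
  obtains i :: "nat \<Rightarrow> nat" and f where "strict_mono i" "2 \<le> i 0"
    "\<And>k. f k \<in> mon (full_transf (i k)) (full_transf (i (Suc k)))"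
    "\<And>j m g. g \<in> mon (full_transf (i j)) (full_transf m) \<Longrightarrow>
       \<exists>l w. j \<le> l \<and> w \<in> mon (full_transf m) (full_transf (i l)) \<and>
         (\<forall>x\<in>carrier (full_transf (i j)). w (g x) = chain_map f j (l - j) x)"
proof -
  define P where "P k s \<longleftrightarrow> 2 \<le> fst s 0 \<and> (\<forall>l<k. fst s l < fst s (Suc l) \<and>
      snd s l \<in> mon (full_transf (fst s l)) (full_transf (fst s (Suc l))))"
    for k and s :: "(nat \<Rightarrow> nat) \<times> (nat \<Rightarrow> (nat \<Rightarrow> nat) \<Rightarrow> (nat \<Rightarrow> nat))"
  \<comment> \<open>A state consists of the sizes and the connecting maps; only the part up to \<open>k\<close> is
    meaningful at stage \<open>k\<close>.\<close>
  define met where "met k s s' \<longleftrightarrow> (let (j, c) = prod_decode k; (m, g) = task (fst s j) c in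
      \<exists>w\<in>mon (full_transf m) (full_transf (fst s' (Suc k))). \<forall>x\<in>carrier (full_transf (fst s j)).
        w (g x) = snd s' k (chain_map (snd s) j (k - j) x))"
    for k and s s' :: "(nat \<Rightarrow> nat) \<times> (nat \<Rightarrow> (nat \<Rightarrow> nat) \<Rightarrow> (nat \<Rightarrow> nat))"
  define Q where "Q k s s' \<longleftrightarrow> (\<forall>l\<le>k. fst s' l = fst s l) \<and> (\<forall>l<k. snd s' l = snd s l) \<and> met k s s'"
    for k and s s' :: "(nat \<Rightarrow> nat) \<times> (nat \<Rightarrow> (nat \<Rightarrow> nat) \<Rightarrow> (nat \<Rightarrow> nat))"
  have "\<exists>s. \<forall>k. P k (s k) \<and> Q k (s k) (s (Suc k))"
  proof (rule dependent_nat_choice)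
    show "\<exists>s. P 0 s" by (intro exI[of _ "(\<lambda>_. 2, \<lambda>_ x. x)"]) (simp add: P_def)
    fix s k assume p: "P k s"
    obtain i f where s: "s = (i, f)" by (cases s)
    have i2: "2 \<le> i l" if "l \<le> k" for l
      using that
    proof (induction l)
      case 0
      then show ?case using p s by (simp add: P_def)
    next
      case (Suc l)
      moreover have "i l < i (Suc l)" using p s Suc.prems by (simp add: P_def)
      ultimately show ?case by simp
    qed
    obtain j c where jc: "prod_decode k = (j, c)" by (cases "prod_decode k")
    then have jk: "j \<le> k" using le_prod_encode_1[of j c] by (metis prod_decode_inverse)
    obtain m g where mg: "task (i j) c = (m, g)" by (cases "task (i j) c")
    have cm: "chain_map f j d \<in> mon (full_transf (i j)) (full_transf (i (j + d)))" if "j + d \<le> k" for d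
      using that
    proof (induction d)
      case 0
      then show ?case by (auto simp: mon_iff simp del: full_transf_simps)
    next
      case (Suc d)
      have "f (j + d) \<in> mon (full_transf (i (j + d))) (full_transf (i (Suc (j + d))))"
        using p s Suc.prems by (simp add: P_def)
      moreover have "chain_map f j (Suc d) = f (j + d) \<circ> chain_map f j d" by (simp add: fun_eq_iff)
      moreover have "chain_map f j d \<in> mon (full_transf (i j)) (full_transf (i (j + d)))"
        using Suc by simp
      ultimately show ?case using mon_comp by (simp only: add_Suc_right)
    qed
    have "chain_map f j (k - j) \<in> mon (full_transf (i j)) (full_transf (i k))"
      using cm[of "k - j"] jk by simp
    then obtain n' F w where st: "i k < n'" "F \<in> mon (full_transf (i k)) (full_transf n')"
      "w \<in> mon (full_transf m) (full_transf n')"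
      "\<forall>x\<in>carrier (full_transf (i j)). w (g x) = F (chain_map f j (k - j) x)"
      using chain_step[OF i2[OF jk] _ task_mon[OF mg]] by blast
    let ?s = "(i(Suc k := n'), f(k := F))"
    have "P (Suc k) ?s" using p s st by (auto simp: P_def less_Suc_eq)
    moreover have "Q k s ?s" using st jc mg s by (auto simp: Q_def met_def simp del: full_transf_simps)
    ultimately show "\<exists>s'. P (Suc k) s' \<and> Q k s s'" by blast
  qed
  then obtain s where s: "\<And>k. P k (s k)" "\<And>k. Q k (s k) (s (Suc k))" by blast
  define i where "i k = fst (s k) k" for k
  define f where "f k = snd (s (Suc k)) k" for k
  have si: "fst (s l) k = i k" if "k \<le> l" for k l
    using that
  proof (induction l rule: dec_induct)
    case (step l)
    then show ?case using s(2)[of l] by (simp add: Q_def)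
  qed (simp add: i_def)
  have sf: "snd (s l) k = f k" if "k < l" for k l
    using that[unfolded less_eq_Suc_le]
  proof (induction l rule: dec_induct)
    case (step l)
    then show ?case using s(2)[of l] by (simp add: Q_def)
  qed (simp add: f_def)
  have st: "i k < i (Suc k)" "f k \<in> mon (full_transf (i k)) (full_transf (i (Suc k)))" for k
    using s(1)[of "Suc k"] si[of k "Suc k"] si[of "Suc k" "Suc k"] sf[of k "Suc k"] by (auto simp: P_def)
  show thesis
  proof (rule that[of i f])
    show "strict_mono i" using st(1) by (simp add: strict_mono_Suc_iff)
    show "2 \<le> i 0" using s(1)[of 0] by (simp add: P_def i_def)
    show "f k \<in> mon (full_transf (i k)) (full_transf (i (Suc k)))" for k by (rule st(2))
    fix j m g assume g: "g \<in> mon (full_transf (i j)) (full_transf m)"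
    obtain c where c: "task (i j) c = (m, restrict g (carrier (full_transf (i j))))"
      using task_exists[OF g] by blast
    let ?k = "prod_encode (j, c)"
    have jk: "j \<le> ?k" by (rule le_prod_encode_1)
    have "met ?k (s ?k) (s (Suc ?k))" using s(2)[of ?k] by (simp add: Q_def)
    then obtain w where w: "w \<in> mon (full_transf m) (full_transf (fst (s (Suc ?k)) (Suc ?k)))"
      "\<forall>x\<in>carrier (full_transf (i j)). w (restrict g (carrier (full_transf (i j))) x) =
        snd (s (Suc ?k)) ?k (chain_map (snd (s ?k)) j (?k - j) x)"
      using c si[OF jk] by (auto simp: met_def simp del: full_transf_simps)
    have "w (g x) = chain_map f j (Suc ?k - j) x" if x: "x \<in> carrier (full_transf (i j))" for x
    proof -
      have "chain_map (snd (s ?k)) j (?k - j) x = chain_map f j (?k - j) x"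
        by (rule chain_map_cong) (use sf jk in auto)
      moreover have "Suc ?k - j = Suc (?k - j)" "j + (?k - j) = ?k" using jk by auto
      ultimately show ?thesis using w(2) x sf[of ?k "Suc ?k"] by simp
    qed
    moreover have "w \<in> mon (full_transf m) (full_transf (i (Suc ?k)))" using w(1) si[of "Suc ?k" "Suc ?k"] by simp
    ultimately show "\<exists>l w. j \<le> l \<and> w \<in> mon (full_transf m) (full_transf (i l)) \<and>
         (\<forall>x\<in>carrier (full_transf (i j)). w (g x) = chain_map f j (l - j) x)"
      using jk by (intro exI[of _ "Suc ?k"] exI[of _ w]) auto
  qed
qed

text \<open>
  The limit of an absorbing chain absorbs: a finite semigroup embeds in a full transformation
  semigroup, and the resulting embedding of a member of the chain was treated at some stage.
  Being countable, the limit has a copy on the natural numbers.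
\<close>

theorem homogeneous_limit_exists: "\<exists>S :: nat monoid. full_transf_limit S \<and> maximally_homogeneous S"
proof -
  obtain i :: "nat \<Rightarrow> nat" and f where i: "strict_mono i" "2 \<le> i 0"
    and f: "\<And>k. f k \<in> mon (full_transf (i k)) (full_transf (i (Suc k)))"
    and abs: "\<And>j m g. g \<in> mon (full_transf (i j)) (full_transf m) \<Longrightarrow>
       \<exists>l w. j \<le> l \<and> w \<in> mon (full_transf m) (full_transf (i l)) \<and>
         (\<forall>x\<in>carrier (full_transf (i j)). w (g x) = chain_map f j (l - j) x)"
    using absorbing_chain_exists by metis
  interpret chain "\<lambda>k. full_transf (i k)" f by (rule full_transf_chain) (rule f)
  have "countable (carrier Lim)"
    unfolding limit_carrier
  proof (intro countable_UN countable_image)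
    show "countable (carrier (full_transf (i k)))" for k
      by (rule countable_finite) (use finite_semigrp_full_transf in \<open>simp add: finite_semigrp_def\<close>)
  qed simp
  then obtain j :: "_ \<Rightarrow> nat" where j: "inj_on j (carrier Lim)" by (auto simp: countable_def)
  define S where "S = copy_group j Lim"
  have sS: "semigrp S" unfolding S_def by (rule semigrp_copy[OF j semigrp_limit])
  have h: "inv_into (carrier Lim) j \<in> iso S Lim"
    unfolding S_def by (rule iso_inverse[OF semigrp_limit copy_group_iso[OF j semigrp_limit]])
  have lim: "full_transf_limit S"
    unfolding full_transf_limit_def using sS i f is_isoI[OF h]
    by (intro conjI exI[of _ i] exI[of _ f]) auto
  obtain \<eta> where L: "limit_maps S i f \<eta>" using limit_maps_of_iso[OF sS f h] by blast
  let ?C = "\<lambda>k. \<eta> k ` carrier (full_transf (i k))"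
  have F: "filtration S ?C" using limit_filtration[OF L, of 0] by simp
  have \<eta>: "\<eta> k \<in> mon (full_transf (i k)) S" for k using L by (simp add: limit_maps_def)
  have \<eta>f: "\<eta> (Suc k) (f k x) = \<eta> k x" if "x \<in> carrier (full_transf (i k))" for k x
    using L that by (simp add: limit_maps_def del: full_transf_simps)
  have \<eta>c: "\<eta> (k + d) (chain_map f k d x) = \<eta> k x" if "x \<in> carrier (full_transf (i k))" for k d x
  proof (induction d)
    case (Suc d)
    then show ?case using \<eta>f[OF mon_closed[OF chain_map_mon that, of d]] by simp
  qed simp
  have ab: "absorbs S ?C"
    unfolding absorbs_def
  proof (intro allI impI, elim conjE)
    fix k and T :: "nat monoid" and g
    assume T: "finite_semigrp T" and g: "g \<in> mon (S\<lparr>carrier := ?C k\<rparr>) T"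
    obtain m v where v: "v \<in> mon T (full_transf m)" using embeds_in_full_transf[OF T] by blast
    have "v \<circ> (g \<circ> \<eta> k) \<in> mon (full_transf (i k)) (full_transf m)"
      by (rule mon_comp[OF mon_comp[OF iso_mon[OF mon_iso_image[OF \<eta>]] g] v])
    then obtain l w where w: "k \<le> l" "w \<in> mon (full_transf m) (full_transf (i l))"
      "\<forall>x\<in>carrier (full_transf (i k)). w ((v \<circ> (g \<circ> \<eta> k)) x) = chain_map f k (l - k) x"
      using abs by blast
    have "(\<eta> l \<circ> (w \<circ> v)) (g y) = y" if "y \<in> ?C k" for y
    proof -
      obtain x where x: "x \<in> carrier (full_transf (i k))" "y = \<eta> k x" using \<open>y \<in> ?C k\<close> by blast
      have "(\<eta> l \<circ> (w \<circ> v)) (g y) = \<eta> l (w ((v \<circ> (g \<circ> \<eta> k)) x))" using x by simp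
      also have "\<dots> = \<eta> l (chain_map f k (l - k) x)" using w(3) x(1) by simp
      also have "\<dots> = y" using \<eta>c[OF x(1), of "l - k"] w(1) x(2) by simp
      finally show ?thesis .
    qed
    then show "\<exists>f\<in>mon T S. \<forall>x\<in>?C k. f (g x) = x"
      using mon_comp[OF mon_comp[OF v w(2)] \<eta>[of l]] by blast
  qed
  have "universal S"
    unfolding universal_def
  proof (intro allI impI)
    fix T :: "nat monoid" assume T: "finite_semigrp T"
    let ?m = "Suc (max (card (carrier T)) (card (carrier (full_transf (i 0)))))"
    obtain v where v: "v \<in> mon T (full_transf ?m)" using embeds_in_full_transf[OF T, of ?m] by (auto simp: less_Suc_eq_le)
    obtain g where "g \<in> mon (full_transf (i 0)) (full_transf ?m)"
      using embeds_in_full_transf[OF finite_semigrp_full_transf, of "i 0" ?m]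
      by (auto simp: less_Suc_eq_le simp del: full_transf_simps)
    then obtain l w where "w \<in> mon (full_transf ?m) (full_transf (i l))" using abs by blast
    then have "\<eta> l \<circ> (w \<circ> v) \<in> mon T S" using mon_comp[OF mon_comp[OF v] \<eta>[of l]] by blast
    then show "mon T S \<noteq> {}" by blast
  qed
  moreover have "locally_finite S"
    unfolding locally_finite_def
  proof (intro allI impI, elim conjE)
    fix X assume X: "finite X" "X \<subseteq> carrier S"
    obtain k where k: "X \<subseteq> ?C k" using filtration_cover[OF F X] by metis
    have "x \<in> ?C k" if "x \<in> semigrp_generate S X" for x
      using that
    proof induction
      case (mult x y)
      have "subsemigrp (?C k) S" using F by (simp add: filtration_def del: full_transf_simps)
      then show ?case using mult.IH unfolding subsemigrp_def by blast
    qed (use k in blast)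
    then have "semigrp_generate S X \<subseteq> ?C k" by blast
    moreover have "finite (?C k)" using F by (simp add: filtration_def del: full_transf_simps)
    ultimately show "finite (semigrp_generate S X)" by (rule finite_subset)
  qed
  ultimately have "maximally_homogeneous S"
    unfolding maximally_homogeneous_def using sS absorbs_imp_homogeneous[OF F ab] by blast
  then show ?thesis using lim by blast
qed

theorem theorem3p3:
  shows "(\<exists>S :: nat monoid. full_transf_limit S \<and> maximally_homogeneous S) \<and>
    (\<forall>(S :: 'a monoid) (S' :: 'b monoid).
       full_transf_limit S \<and> maximally_homogeneous S \<and>
       full_transf_limit S' \<and> maximally_homogeneous S' \<longrightarrow> S \<cong> S')"
  using homogeneous_limit_exists homogeneous_limits_isomorphic by blast

end
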